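(* Let $G$ be a finitely generated abelian group, and let $f:\mathbb{Z}^k\to G$ be a homomorphism. Let $P=f(\mathbb{N}^k)\subseteq G$ and let $H=\ker(f)\subseteq\mathbb{Z}^k$. Let $\Gamma$ be a row-finite $P$-graph with no sources. For $z\in\mathbb{T}^k$, let $q_z:C^*(f^*\Gamma)\to C^*(f^*\Gamma)/I_z$ be the quotient map, and let $\psi_z:C^*(f^*\Gamma)/I_z\to C^*(\Gamma)$ be the isomorphism satisfying $\psi_z(s_{(\lambda,n)}+I_z)=z^ns_\lambda$ for all $(\lambda,n)\in f^*\Gamma$. Let $\pi$ be an irreducible representation of $C^*(\Gamma)$. Then $\pi\circ\psi_z\circ q_z$ is an irreducible representation of $C^*(f^*\Gamma)$. Fix a map $\gamma\mapsto z_\gamma$ from $\widehat H$ to $\mathbb{T}^k$ such that $z_\gamma^h=\gamma(h)$ for all $\gamma\in\widehat H$ and $h\in H$. Then $(\gamma,\pi)\mapsto\pi\circ\psi_{z_\gamma}\circ q_{z_\gamma}$ is a bijection of $\widehat H\times\operatorname{Irr}(C^*(\Gamma))$ onto $\operatorname{Irr}(C^*(f^*\Gamma))$.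
   Context: Conventions: $\mathbb{N}$ contains $0$; "ideal" means closed two-sided ideal; for $z\in\mathbb{T}^k$, $n\in\mathbb{Z}^k$, $z^n=\prod_iz_i^{n_i}$; $\widehat H$ is the group of characters $H\to\mathbb{T}$. $\operatorname{Irr}(A)$ denotes the collection of all (nonzero) irreducible representations of the $C^*$-algebra $A$ (representations themselves, not unitary equivalence classes). For a finitely generated cancellative abelian monoid $P$ (regarded as a category with one object), a $P$-graph is a countable small category $\Gamma$ (identified with its set of morphisms) with a functor $d:\Gamma\to P$ satisfying the factorisation property: whenever $d(\xi)=p+q$ there exist unique $\eta,\zeta\in\Gamma$ with $d(\eta)=p$, $d(\zeta)=q$ and $\xi=\eta\zeta$. A $k$-graph is an $\mathbb{N}^k$-graph. $\Gamma^p=d^{-1}(p)$; $r,s$ denote codomain and domain; $\Gamma^0$ is the set of identity morphisms, identified with the objects; $v\Gamma^p=\{\xi\in\Gamma^p:r(\xi)=v\}$. $\Gamma$ is row-finite with no sources if $0<|v\Gamma^p|<\infty$ for all $v\in\Gamma^0,p\in P$. For such $\Gamma$, a Cuntz-Krieger $\Gamma$-family is a collection $\{t_\xi:\xi\in\Gamma\}$ in a $C^*$-algebra such that: the $t_v$, $v\in\Gamma^0$, are mutually orthogonal projections; $t_\xi t_\eta=t_{\xi\eta}$ if $s(\xi)=r(\eta)$; $t_\xi^*t_\xi=t_{s(\xi)}$; and $t_v=\sum_{\xi\in v\Gamma^p}t_\xi t_\xi^*$ for all $v\in\Gamma^0$, $p\in P$. $C^*(\Gamma)$ is the universal $C^*$-algebra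 generated by a Cuntz-Krieger $\Gamma$-family $\{s_\xi\}$. Pullback: $f^*\Gamma=\{(\lambda,n)\in\Gamma\times\mathbb{N}^k:d(\lambda)=f(n)\}$ with $d(\lambda,n)=n$, $s(\lambda,n)=(s(\lambda),0)$, $r(\lambda,n)=(r(\lambda),0)$ and $(\mu,m)(\nu,n)=(\mu\nu,m+n)$; it is a row-finite $k$-graph with no sources. For $z\in\mathbb{T}^k$, $I_z$ is the ideal of $C^*(f^*\Gamma)$ generated by $\{z^{-n_1}s_{(\lambda,n_1)}-z^{-n_2}s_{(\lambda,n_2)}:\lambda\in\Gamma,\ n_1,n_2\in\mathbb{N}^k,\ f(n_1)=f(n_2)=d(\lambda)\}$. There is an isomorphism $\psi_z:C^*(f^*\Gamma)/I_z\to C^*(\Gamma)$ with $\psi_z(s_{(\lambda,n)}+I_z)=z^ns_\lambda$. *)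

theory Defs
  imports "HOL-Analysis.Analysis" "HOL-Algebra.QuotRing" "HOL-Algebra.Module"
begin

section \<open>Complex Hilbert spaces\<close>

text \<open>
  A complex Hilbert space is a complete real inner product space whose real structure is
  induced by a complex scalar multiplication and a complex inner product, linear in the
  first variable. In particular \<^prop>\<open>cinner x x = of_real ((norm x)\<^sup>2)\<close>.
\<close>

class complex_hilbert = real_inner + complete_space +
  fixes cscale :: "complex \<Rightarrow> 'a \<Rightarrow> 'a"
    and cinner :: "'a \<Rightarrow> 'a \<Rightarrow> complex"
  assumes cscale_add_right: "cscale a (x + y) = cscale a x + cscale a y"
    and cscale_add_left: "cscale (a + b) x = cscale a x + cscale b x"
    and cscale_cscale: "cscale a (cscale b x) = cscale (a * b) x"
    and cscale_of_real: "cscale (complex_of_real r) x = scaleR r x"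
    and cinner_add_left: "cinner (x + y) z = cinner x z + cinner y z"
    and cinner_cscale_left: "cinner (cscale a x) y = a * cinner x y"
    and cinner_commute: "cinner x y = cnj (cinner y x)"
    and Re_cinner: "Re (cinner x y) = inner x y"


section \<open>C*-algebras\<close>

text \<open>
  C*-algebras need not be unital: the field \<^const>\<open>one\<close> inherited from the library's ring
  record carries no meaning and is never used.
\<close>

record 'a cstar = "(complex, 'a) module" +
  adj :: "'a \<Rightarrow> 'a"
  nrm :: "'a \<Rightarrow> real"

text \<open>
  \<^locale>\<open>Metric_space\<close> requires symmetry and nonnegativity also off the carrier, hence the
  case distinction.
\<close>

definition cdist :: "('a, 'x) cstar_scheme \<Rightarrow> 'a \<Rightarrow> 'a \<Rightarrow> real" where
  "cdist A x y = (if x \<in> carrier A \<and> y \<in> carrier A then nrm A (x \<ominus>\<^bsub>A\<^esub> y) else 0)"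

abbreviation ctopology :: "('a, 'x) cstar_scheme \<Rightarrow> 'a topology" where
  "ctopology A \<equiv> Metric_space.mtopology (carrier A) (cdist A)"

locale cstar_algebra = abelian_group A for A (structure) +
  assumes mult_closed: "\<lbrakk>x \<in> carrier A; y \<in> carrier A\<rbrakk> \<Longrightarrow> x \<otimes> y \<in> carrier A"
    and mult_assoc: "\<lbrakk>x \<in> carrier A; y \<in> carrier A; z \<in> carrier A\<rbrakk>
          \<Longrightarrow> (x \<otimes> y) \<otimes> z = x \<otimes> (y \<otimes> z)"
    and distrib_right: "\<lbrakk>x \<in> carrier A; y \<in> carrier A; z \<in> carrier A\<rbrakk>
          \<Longrightarrow> (x \<oplus> y) \<otimes> z = x \<otimes> z \<oplus> y \<otimes> z"
    and distrib_left: "\<lbrakk>x \<in> carrier A; y \<in> carrier A; z \<in> carrier A\<rbrakk>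
          \<Longrightarrow> z \<otimes> (x \<oplus> y) = z \<otimes> x \<oplus> z \<otimes> y"
    and smult_closed: "x \<in> carrier A \<Longrightarrow> a \<odot> x \<in> carrier A"
    and smult_add_left: "x \<in> carrier A \<Longrightarrow> (a + b) \<odot> x = a \<odot> x \<oplus> b \<odot> x"
    and smult_add_right: "\<lbrakk>x \<in> carrier A; y \<in> carrier A\<rbrakk>
          \<Longrightarrow> a \<odot> (x \<oplus> y) = a \<odot> x \<oplus> a \<odot> y"
    and smult_smult: "x \<in> carrier A \<Longrightarrow> (a * b) \<odot> x = a \<odot> (b \<odot> x)"
    and smult_one: "x \<in> carrier A \<Longrightarrow> 1 \<odot> x = x"
    and smult_mult_left: "\<lbrakk>x \<in> carrier A; y \<in> carrier A\<rbrakk> \<Longrightarrow> (a \<odot> x) \<otimes> y = a \<odot> (x \<otimes> y)"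
    and smult_mult_right: "\<lbrakk>x \<in> carrier A; y \<in> carrier A\<rbrakk> \<Longrightarrow> x \<otimes> (a \<odot> y) = a \<odot> (x \<otimes> y)"
    and adj_closed: "x \<in> carrier A \<Longrightarrow> adj A x \<in> carrier A"
    and adj_add: "\<lbrakk>x \<in> carrier A; y \<in> carrier A\<rbrakk> \<Longrightarrow> adj A (x \<oplus> y) = adj A x \<oplus> adj A y"
    and adj_smult: "x \<in> carrier A \<Longrightarrow> adj A (a \<odot> x) = cnj a \<odot> adj A x"
    and adj_mult: "\<lbrakk>x \<in> carrier A; y \<in> carrier A\<rbrakk> \<Longrightarrow> adj A (x \<otimes> y) = adj A y \<otimes> adj A x"
    and adj_adj: "x \<in> carrier A \<Longrightarrow> adj A (adj A x) = x"
    and nrm_nonneg: "x \<in> carrier A \<Longrightarrow> 0 \<le> nrm A x"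
    and nrm_eq_0: "x \<in> carrier A \<Longrightarrow> nrm A x = 0 \<longleftrightarrow> x = \<zero>"
    and nrm_triangle: "\<lbrakk>x \<in> carrier A; y \<in> carrier A\<rbrakk> \<Longrightarrow> nrm A (x \<oplus> y) \<le> nrm A x + nrm A y"
    and nrm_smult: "x \<in> carrier A \<Longrightarrow> nrm A (a \<odot> x) = cmod a * nrm A x"
    and nrm_mult: "\<lbrakk>x \<in> carrier A; y \<in> carrier A\<rbrakk> \<Longrightarrow> nrm A (x \<otimes> y) \<le> nrm A x * nrm A y"
    and cstar_identity: "x \<in> carrier A \<Longrightarrow> nrm A (adj A x \<otimes> x) = (nrm A x)\<^sup>2"
    and complete: "Metric_space.mcomplete (carrier A) (cdist A)"

definition star_hom :: "('a, 'x) cstar_scheme \<Rightarrow> ('b, 'y) cstar_scheme \<Rightarrow> ('a \<Rightarrow> 'b) set" where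
  "star_hom A B = {\<phi>. \<phi> \<in> carrier A \<rightarrow> carrier B \<and>
     (\<forall>x\<in>carrier A. \<forall>y\<in>carrier A. \<phi> (x \<oplus>\<^bsub>A\<^esub> y) = \<phi> x \<oplus>\<^bsub>B\<^esub> \<phi> y) \<and>
     (\<forall>a. \<forall>x\<in>carrier A. \<phi> (a \<odot>\<^bsub>A\<^esub> x) = a \<odot>\<^bsub>B\<^esub> \<phi> x) \<and>
     (\<forall>x\<in>carrier A. \<forall>y\<in>carrier A. \<phi> (x \<otimes>\<^bsub>A\<^esub> y) = \<phi> x \<otimes>\<^bsub>B\<^esub> \<phi> y) \<and>
     (\<forall>x\<in>carrier A. \<phi> (adj A x) = adj B (\<phi> x))}"

definition star_iso :: "('a, 'x) cstar_scheme \<Rightarrow> ('b, 'y) cstar_scheme \<Rightarrow> ('a \<Rightarrow> 'b) set" where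
  "star_iso A B = {\<phi> \<in> star_hom A B. bij_betw \<phi> (carrier A) (carrier B)}"

definition closed_star_subalgebra :: "('a, 'x) cstar_scheme \<Rightarrow> 'a set \<Rightarrow> bool" where
  "closed_star_subalgebra A S \<longleftrightarrow>
     closedin (ctopology A) S \<and> \<zero>\<^bsub>A\<^esub> \<in> S \<and>
     (\<forall>x\<in>S. \<forall>y\<in>S. x \<oplus>\<^bsub>A\<^esub> y \<in> S \<and> x \<otimes>\<^bsub>A\<^esub> y \<in> S) \<and>
     (\<forall>a. \<forall>x\<in>S. a \<odot>\<^bsub>A\<^esub> x \<in> S) \<and>
     (\<forall>x\<in>S. adj A x \<in> S)"

definition generates_cstar :: "('a, 'x) cstar_scheme \<Rightarrow> 'a set \<Rightarrow> bool" where
  "generates_cstar A X \<longleftrightarrow>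
     X \<subseteq> carrier A \<and> (\<forall>S. closed_star_subalgebra A S \<and> X \<subseteq> S \<longrightarrow> S = carrier A)"

definition closed_ideal :: "('a, 'x) cstar_scheme \<Rightarrow> 'a set \<Rightarrow> bool" where
  "closed_ideal A I \<longleftrightarrow>
     closedin (ctopology A) I \<and> \<zero>\<^bsub>A\<^esub> \<in> I \<and>
     (\<forall>x\<in>I. \<forall>y\<in>I. x \<oplus>\<^bsub>A\<^esub> y \<in> I) \<and>
     (\<forall>a. \<forall>x\<in>I. a \<odot>\<^bsub>A\<^esub> x \<in> I) \<and>
     (\<forall>x\<in>I. \<forall>y\<in>carrier A. x \<otimes>\<^bsub>A\<^esub> y \<in> I \<and> y \<otimes>\<^bsub>A\<^esub> x \<in> I)"

definition ideal_generated :: "('a, 'x) cstar_scheme \<Rightarrow> 'a set \<Rightarrow> 'a set" where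
  "ideal_generated A X = \<Inter> {I. closed_ideal A I \<and> X \<subseteq> I}"

text \<open>
  The operations on cosets follow the pattern of the library's \<^const>\<open>rcoset_mult\<close>; the norm is
  the quotient norm.
\<close>

definition quotient_cstar :: "('a, 'x) cstar_scheme \<Rightarrow> 'a set \<Rightarrow> 'a set cstar" where
  "quotient_cstar A I =
     \<lparr>carrier = carrier (A Quot I), mult = mult (A Quot I), one = one (A Quot I),
      zero = zero (A Quot I), add = add (A Quot I),
      smult = (\<lambda>a X. \<Union>x\<in>X. I +>\<^bsub>A\<^esub> (a \<odot>\<^bsub>A\<^esub> x)),
      adj = (\<lambda>X. \<Union>x\<in>X. I +>\<^bsub>A\<^esub> adj A x),
      nrm = (\<lambda>X. INF x\<in>X. nrm A x)\<rparr>"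

definition quot_map :: "('a, 'x) cstar_scheme \<Rightarrow> 'a set \<Rightarrow> 'a \<Rightarrow> 'a set" where
  "quot_map A I x = I +>\<^bsub>A\<^esub> x"


section \<open>Irreducible representations\<close>

text \<open>
  Library operators \<^typ>\<open>'h \<Rightarrow>\<^sub>L 'h\<close> are bounded and real linear, so complex linearity is added.
  Representations are taken to be \<^const>\<open>undefined\<close> off the carrier, so that two of them are
  equal in HOL iff they agree on the algebra.
\<close>

definition representation ::
    "('a, 'x) cstar_scheme \<Rightarrow> ('a \<Rightarrow> ('h::complex_hilbert \<Rightarrow>\<^sub>L 'h)) \<Rightarrow> bool" where
  "representation A \<pi> \<longleftrightarrow>
     \<pi> \<in> extensional (carrier A) \<and>
     (\<forall>x\<in>carrier A. \<forall>c v. blinfun_apply (\<pi> x) (cscale c v) = cscale c (blinfun_apply (\<pi> x) v)) \<and>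
     (\<forall>x\<in>carrier A. \<forall>y\<in>carrier A. \<pi> (x \<oplus>\<^bsub>A\<^esub> y) = \<pi> x + \<pi> y) \<and>
     (\<forall>c. \<forall>x\<in>carrier A. \<forall>v. blinfun_apply (\<pi> (c \<odot>\<^bsub>A\<^esub> x)) v = cscale c (blinfun_apply (\<pi> x) v)) \<and>
     (\<forall>x\<in>carrier A. \<forall>y\<in>carrier A. \<pi> (x \<otimes>\<^bsub>A\<^esub> y) = \<pi> x o\<^sub>L \<pi> y) \<and>
     (\<forall>x\<in>carrier A. \<forall>v w.
        cinner (blinfun_apply (\<pi> x) v) w = cinner v (blinfun_apply (\<pi> (adj A x)) w))"

definition irreducible_rep ::
    "('a, 'x) cstar_scheme \<Rightarrow> ('a \<Rightarrow> ('h::complex_hilbert \<Rightarrow>\<^sub>L 'h)) \<Rightarrow> bool" where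
  "irreducible_rep A \<pi> \<longleftrightarrow>
     representation A \<pi> \<and> (\<exists>x\<in>carrier A. \<pi> x \<noteq> 0) \<and>
     (\<forall>W. closed W \<and> subspace W \<and> (\<forall>c. \<forall>v\<in>W. cscale c v \<in> W) \<and>
          (\<forall>x\<in>carrier A. \<forall>v\<in>W. blinfun_apply (\<pi> x) v \<in> W)
        \<longrightarrow> W = {0} \<or> W = UNIV)"

text \<open>
  The irreducible representations on the Hilbert space given by the type \<^typ>\<open>'h\<close>; letting
  \<^typ>\<open>'h\<close> vary gives all of them.
\<close>

definition Irr :: "('a, 'x) cstar_scheme \<Rightarrow> ('a \<Rightarrow> ('h::complex_hilbert \<Rightarrow>\<^sub>L 'h)) set" where
  "Irr A = {\<pi>. irreducible_rep A \<pi>}"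


section \<open>P-graphs\<close>

definition fg_submonoid :: "'p::cancel_comm_monoid_add set \<Rightarrow> bool" where
  "fg_submonoid P \<longleftrightarrow>
     0 \<in> P \<and> (\<forall>p\<in>P. \<forall>q\<in>P. p + q \<in> P) \<and>
     (\<exists>S. finite S \<and> S \<subseteq> P \<and>
        (\<forall>M. 0 \<in> M \<and> (\<forall>p\<in>M. \<forall>q\<in>M. p + q \<in> M) \<and> S \<subseteq> M \<longrightarrow> P \<subseteq> M))"

definition finitely_generated_group :: "'g::ab_group_add itself \<Rightarrow> bool" where
  "finitely_generated_group _ \<longleftrightarrow>
     (\<exists>S::'g set. finite S \<and>
        (\<forall>M. 0 \<in> M \<and> (\<forall>x\<in>M. \<forall>y\<in>M. x - y \<in> M) \<and> S \<subseteq> M \<longrightarrow> M = UNIV))"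

text \<open>
  A small category is identified with its set of morphisms and an object with its identity
  morphism, so that source and range are themselves morphisms. \<open>comp \<Gamma> \<xi> \<eta>\<close> is the
  product \<open>\<xi> \<eta>\<close>, meaningful when \<open>src \<Gamma> \<xi> = rng \<Gamma> \<eta>\<close>.
\<close>

record ('m, 'p) graded_category =
  mor :: "'m set"
  src :: "'m \<Rightarrow> 'm"
  rng :: "'m \<Rightarrow> 'm"
  comp :: "'m \<Rightarrow> 'm \<Rightarrow> 'm"
  deg :: "'m \<Rightarrow> 'p"

definition vertices :: "('m, 'p) graded_category \<Rightarrow> 'm set" where
  "vertices \<Gamma> = {v \<in> mor \<Gamma>. src \<Gamma> v = v}"

text \<open>The set \<open>v\<Gamma>\<^sup>p\<close>.\<close>

definition paths_into :: "('m, 'p) graded_category \<Rightarrow> 'm \<Rightarrow> 'p \<Rightarrow> 'm set" where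
  "paths_into \<Gamma> v p = {\<xi> \<in> mor \<Gamma>. deg \<Gamma> \<xi> = p \<and> rng \<Gamma> \<xi> = v}"

locale P_graph =
  fixes P :: "'p::cancel_comm_monoid_add set"
    and \<Gamma> :: "('m, 'p) graded_category"
  assumes monoid: "fg_submonoid P"
    and countable_mor: "countable (mor \<Gamma>)"
    and src_in: "\<xi> \<in> mor \<Gamma> \<Longrightarrow> src \<Gamma> \<xi> \<in> mor \<Gamma>"
    and rng_in: "\<xi> \<in> mor \<Gamma> \<Longrightarrow> rng \<Gamma> \<xi> \<in> mor \<Gamma>"
    and src_src: "\<xi> \<in> mor \<Gamma> \<Longrightarrow> src \<Gamma> (src \<Gamma> \<xi>) = src \<Gamma> \<xi>"
    and rng_src: "\<xi> \<in> mor \<Gamma> \<Longrightarrow> rng \<Gamma> (src \<Gamma> \<xi>) = src \<Gamma> \<xi>"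
    and src_rng: "\<xi> \<in> mor \<Gamma> \<Longrightarrow> src \<Gamma> (rng \<Gamma> \<xi>) = rng \<Gamma> \<xi>"
    and rng_rng: "\<xi> \<in> mor \<Gamma> \<Longrightarrow> rng \<Gamma> (rng \<Gamma> \<xi>) = rng \<Gamma> \<xi>"
    and comp_in: "\<lbrakk>\<xi> \<in> mor \<Gamma>; \<eta> \<in> mor \<Gamma>; src \<Gamma> \<xi> = rng \<Gamma> \<eta>\<rbrakk> \<Longrightarrow> comp \<Gamma> \<xi> \<eta> \<in> mor \<Gamma>"
    and src_comp: "\<lbrakk>\<xi> \<in> mor \<Gamma>; \<eta> \<in> mor \<Gamma>; src \<Gamma> \<xi> = rng \<Gamma> \<eta>\<rbrakk>
          \<Longrightarrow> src \<Gamma> (comp \<Gamma> \<xi> \<eta>) = src \<Gamma> \<eta>"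
    and rng_comp: "\<lbrakk>\<xi> \<in> mor \<Gamma>; \<eta> \<in> mor \<Gamma>; src \<Gamma> \<xi> = rng \<Gamma> \<eta>\<rbrakk>
          \<Longrightarrow> rng \<Gamma> (comp \<Gamma> \<xi> \<eta>) = rng \<Gamma> \<xi>"
    and comp_assoc: "\<lbrakk>\<xi> \<in> mor \<Gamma>; \<eta> \<in> mor \<Gamma>; \<zeta> \<in> mor \<Gamma>;
            src \<Gamma> \<xi> = rng \<Gamma> \<eta>; src \<Gamma> \<eta> = rng \<Gamma> \<zeta>\<rbrakk>
          \<Longrightarrow> comp \<Gamma> (comp \<Gamma> \<xi> \<eta>) \<zeta> = comp \<Gamma> \<xi> (comp \<Gamma> \<eta> \<zeta>)"
    and comp_src: "\<xi> \<in> mor \<Gamma> \<Longrightarrow> comp \<Gamma> \<xi> (src \<Gamma> \<xi>) = \<xi>"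
    and comp_rng: "\<xi> \<in> mor \<Gamma> \<Longrightarrow> comp \<Gamma> (rng \<Gamma> \<xi>) \<xi> = \<xi>"
    and deg_in: "\<xi> \<in> mor \<Gamma> \<Longrightarrow> deg \<Gamma> \<xi> \<in> P"
    and deg_vertex: "v \<in> vertices \<Gamma> \<Longrightarrow> deg \<Gamma> v = 0"
    and deg_comp: "\<lbrakk>\<xi> \<in> mor \<Gamma>; \<eta> \<in> mor \<Gamma>; src \<Gamma> \<xi> = rng \<Gamma> \<eta>\<rbrakk>
          \<Longrightarrow> deg \<Gamma> (comp \<Gamma> \<xi> \<eta>) = deg \<Gamma> \<xi> + deg \<Gamma> \<eta>"
    and factorisation: "\<lbrakk>\<xi> \<in> mor \<Gamma>; p \<in> P; q \<in> P; deg \<Gamma> \<xi> = p + q\<rbrakk>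
          \<Longrightarrow> \<exists>!x. case x of (\<eta>, \<zeta>) \<Rightarrow>
                \<eta> \<in> mor \<Gamma> \<and> \<zeta> \<in> mor \<Gamma> \<and> deg \<Gamma> \<eta> = p \<and> deg \<Gamma> \<zeta> = q \<and>
                src \<Gamma> \<eta> = rng \<Gamma> \<zeta> \<and> \<xi> = comp \<Gamma> \<eta> \<zeta>"

definition row_finite_no_sources :: "'p set \<Rightarrow> ('m, 'p) graded_category \<Rightarrow> bool" where
  "row_finite_no_sources P \<Gamma> \<longleftrightarrow>
     (\<forall>v\<in>vertices \<Gamma>. \<forall>p\<in>P. finite (paths_into \<Gamma> v p) \<and> paths_into \<Gamma> v p \<noteq> {})"


section \<open>Cuntz-Krieger families and universal algebras\<close>

definition ck_family ::
    "'p set \<Rightarrow> ('m, 'p) graded_category \<Rightarrow> ('a, 'x) cstar_scheme \<Rightarrow> ('m \<Rightarrow> 'a) \<Rightarrow> bool" where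
  "ck_family P \<Gamma> A t \<longleftrightarrow>
     (\<forall>\<xi>\<in>mor \<Gamma>. t \<xi> \<in> carrier A) \<and>
     (\<forall>v\<in>vertices \<Gamma>. t v \<otimes>\<^bsub>A\<^esub> t v = t v \<and> adj A (t v) = t v) \<and>
     (\<forall>v\<in>vertices \<Gamma>. \<forall>w\<in>vertices \<Gamma>. v \<noteq> w \<longrightarrow> t v \<otimes>\<^bsub>A\<^esub> t w = \<zero>\<^bsub>A\<^esub>) \<and>
     (\<forall>\<xi>\<in>mor \<Gamma>. \<forall>\<eta>\<in>mor \<Gamma>. src \<Gamma> \<xi> = rng \<Gamma> \<eta> \<longrightarrow> t \<xi> \<otimes>\<^bsub>A\<^esub> t \<eta> = t (comp \<Gamma> \<xi> \<eta>)) \<and>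
     (\<forall>\<xi>\<in>mor \<Gamma>. adj A (t \<xi>) \<otimes>\<^bsub>A\<^esub> t \<xi> = t (src \<Gamma> \<xi>)) \<and>
     (\<forall>v\<in>vertices \<Gamma>. \<forall>p\<in>P.
        t v = finsum A (\<lambda>\<xi>. t \<xi> \<otimes>\<^bsub>A\<^esub> adj A (t \<xi>)) (paths_into \<Gamma> v p))"

text \<open>
  \<open>universal_ck_algebra P \<Gamma> A s\<close>: the C*-algebra \<open>A\<close> together with \<open>s\<close> is \<open>C\<^sup>*(\<Gamma>)\<close> with its
  universal Cuntz-Krieger family. HOL cannot quantify over types inside a formula, so the
  C*-algebras tested in the universal property are those whose carrier is a set of real
  numbers (with arbitrary operations, unrelated to those of the reals). This is no loss of
  generality: as \<open>\<Gamma>\<close> is countable, the C*-subalgebra generated by a Cuntz-Krieger family is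
  separable, so has at most continuum many elements and is isomorphic to such a C*-algebra.
  Uniqueness of the homomorphism follows from generation.
\<close>

definition universal_ck_algebra ::
    "'p set \<Rightarrow> ('m, 'p) graded_category \<Rightarrow> 'a cstar \<Rightarrow> ('m \<Rightarrow> 'a) \<Rightarrow> bool" where
  "universal_ck_algebra P \<Gamma> A s \<longleftrightarrow>
     cstar_algebra A \<and> ck_family P \<Gamma> A s \<and> generates_cstar A (s ` mor \<Gamma>) \<and>
     (\<forall>(C :: real cstar) t. cstar_algebra C \<and> ck_family P \<Gamma> C t \<longrightarrow>
        (\<exists>\<phi>\<in>star_hom A C. \<forall>\<xi>\<in>mor \<Gamma>. \<phi> (s \<xi>) = t \<xi>))"


section \<open>The pullback and the ideals\<close>

text \<open>\<open>\<nat>\<^sup>k\<close> as a submonoid of \<open>\<int>\<^sup>k\<close>, with \<open>k\<close> the cardinality of the index type.\<close>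

definition Nk :: "(int^'k) set" where
  "Nk = {n. \<forall>i. 0 \<le> n $ i}"

definition pullback ::
    "(int^'k \<Rightarrow> 'g) \<Rightarrow> ('m, 'g) graded_category \<Rightarrow> ('m \<times> (int^'k), int^'k) graded_category" where
  "pullback f \<Gamma> =
     \<lparr>mor = {(\<xi>, n). \<xi> \<in> mor \<Gamma> \<and> n \<in> Nk \<and> deg \<Gamma> \<xi> = f n},
      src = (\<lambda>(\<xi>, n). (src \<Gamma> \<xi>, 0)),
      rng = (\<lambda>(\<xi>, n). (rng \<Gamma> \<xi>, 0)),
      comp = (\<lambda>(\<xi>, m) (\<eta>, n). (comp \<Gamma> \<xi> \<eta>, m + n)),
      deg = snd\<rparr>"

definition torus :: "(complex^'k) set" where
  "torus = {z. \<forall>i. cmod (z $ i) = 1}"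

definition zpow :: "complex^'k \<Rightarrow> int^'k \<Rightarrow> complex" where
  "zpow z n = (\<Prod>i\<in>UNIV. (z $ i) powi (n $ i))"

text \<open>Characters of a subgroup \<open>H\<close>, extended by \<^const>\<open>undefined\<close> off \<open>H\<close>.\<close>

definition characters :: "'g::ab_group_add set \<Rightarrow> ('g \<Rightarrow> complex) set" where
  "characters H = {\<gamma> \<in> H \<rightarrow>\<^sub>E sphere 0 1. \<forall>g\<in>H. \<forall>h\<in>H. \<gamma> (g + h) = \<gamma> g * \<gamma> h}"

text \<open>The ideal \<open>I\<^sub>z\<close> of the algebra \<open>A\<close> of the pullback with universal family \<open>s\<close>.\<close>

definition ideal_z ::
    "(int^'k \<Rightarrow> 'g) \<Rightarrow> ('m, 'g) graded_category \<Rightarrow> 'a cstar \<Rightarrow> ('m \<times> (int^'k) \<Rightarrow> 'a) \<Rightarrow>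
     complex^'k \<Rightarrow> 'a set" where
  "ideal_z f \<Gamma> A s z = ideal_generated A
     {(zpow z (- m) \<odot>\<^bsub>A\<^esub> s (\<xi>, m)) \<ominus>\<^bsub>A\<^esub> (zpow z (- n) \<odot>\<^bsub>A\<^esub> s (\<xi>, n)) | \<xi> m n.
        \<xi> \<in> mor \<Gamma> \<and> m \<in> Nk \<and> n \<in> Nk \<and> f m = deg \<Gamma> \<xi> \<and> f n = deg \<Gamma> \<xi>}"

end

theory Submission
  imports Defs
begin

text \<open>
  Fix \<open>z\<close> in the torus. The composite \<open>\<theta>\<^sub>z = \<psi>\<^sub>z \<circ> q\<^sub>z\<close> is a surjective *-homomorphism
  from \<open>C\<^sup>*(f\<^sup>*\<Gamma>)\<close> to \<open>C\<^sup>*(\<Gamma>)\<close> with kernel \<open>I\<^sub>z\<close>. Composing a representation with a surjection does not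
  change the set of operators, hence neither the invariant subspaces, so \<open>\<pi> \<circ> \<theta>\<^sub>z\<close> is irreducible
  whenever \<open>\<pi>\<close> is (\<open>irreducible_rep_comp_star_hom\<close>). An irreducible representation
  of \<open>C\<^sup>*(f\<^sup>*\<Gamma>)\<close> comes from \<open>C\<^sup>*(\<Gamma>)\<close> through \<open>\<theta>\<^sub>z\<close> exactly when it kills \<open>I\<^sub>z\<close>
  (\<open>irreducible_rep_factor\<close>).

  Why every irreducible \<open>\<rho>\<close> kills one of the ideals: let \<open>h = m - n\<close> be in \<open>H\<close>, so that
  \<open>p = f m = f n\<close>. The sums \<open>\<Sum> s\<^bsub>(\<xi>,m)\<^esub> s\<^bsub>(\<xi>,n)\<^esub>\<^sup>*\<close> over \<open>\<xi>\<close> in \<open>v\<Gamma>\<^sup>p\<close>, one for each vertex \<open>v\<close>, are the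
  pieces of a central multiplier (\<open>U_central\<close>). By Schur's lemma it is a scalar \<open>\<gamma>(h)\<close> under \<open>\<rho>\<close>,
  which says \<open>\<rho>(s\<^bsub>(\<xi>,m)\<^esub>) = \<gamma>(m - n) \<rho>(s\<^bsub>(\<xi>,n)\<^esub>)\<close>. Comparing different ways of writing elements
  of \<open>H\<close> shows that \<open>\<gamma>\<close> is a well-defined character (\<open>exists_character\<close>), and the displayed relation
  is precisely the vanishing of \<open>\<rho>\<close> on the generators of \<open>I\<^sub>z\<close> for any \<open>z\<close> whose powers
  restrict to \<open>\<gamma>\<close> on \<open>H\<close>. Conversely \<open>\<gamma>\<close> can be read off from \<open>\<pi> \<circ> \<theta>\<^sub>z\<close>, because for every degree
  \<open>p\<close> some \<open>\<pi>(t\<^sub>\<xi>)\<close> with \<open>\<xi>\<close> of degree \<open>p\<close> is nonzero; and since \<open>\<theta>\<^sub>z\<close> is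
  surjective, \<open>\<pi>\<close> can then be read off as well. This is the bijection.

  Three analytic facts carry the argument; their proofs avoid spectral theory.
  If \<open>x\<close> is self-adjoint of norm at most one, iterating \<open>y \<mapsto> (x + y\<^sup>2)/2\<close>
  from zero converges (\<open>quadratic_iteration_fixed_point\<close>), and \<open>1 - y\<close> is a square root of \<open>1 - x\<close>. Inside a
  C*-algebra this makes representations contractive, so that their kernels are closed
  ideals; inside the bounded operators it produces the absolute value needed for Schur's lemma
  (\<open>symmetric_abs\<close>, \<open>corner_central_scalar\<close>). The last fact is that projections whose sum
  is a projection dominating them are mutually orthogonal (\<open>orthogonal_summands\<close>), which follows
  from the unit being an extreme point of the unit ball. It makes \<open>I\<^sub>z\<close>
  closed under adjoints, without which \<open>q\<^sub>z\<close> would not be a *-homomorphism.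
\<close>

section \<open>Square roots by iteration\<close>

text \<open>
  The hypotheses describe the map \<open>S y = (x + y\<^sup>2)/2\<close> of a Banach algebra, with \<open>\<parallel>x\<parallel> \<le> 1\<close> and \<open>z = 0\<close>.
  It need not be a contraction, but its iterates are dominated by those of the scalar map
  \<open>r \<mapsto> (1 + r\<^sup>2)/2\<close>, which increase to one; so they form a Cauchy sequence. The last
  conclusion transports to the limit any closed property that the iteration preserves, such as being self-adjoint.
\<close>
lemma (in Metric_space) quadratic_iteration_fixed_point:
  assumes complete: "mcomplete" and z: "z \<in> M" and S: "\<And>a. a \<in> M \<Longrightarrow> S a \<in> M"
    and bound: "\<And>a. a \<in> M \<Longrightarrow> d z (S a) \<le> (1 + (d z a)\<^sup>2) / 2"
    and lip: "\<And>a b. \<lbrakk>a \<in> M; b \<in> M\<rbrakk> \<Longrightarrow> d (S a) (S b) \<le> (d z a + d z b) / 2 * d a b"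
  obtains y where "y \<in> M" "S y = y"
    "\<And>C. \<lbrakk>closedin mtopology C; z \<in> C; \<And>a. a \<in> C \<Longrightarrow> S a \<in> C\<rbrakk> \<Longrightarrow> y \<in> C"
proof -
  \<comment> \<open>The dominating scalar sequence; its increments bound the distances of consecutive iterates.\<close>
  define r :: "nat \<Rightarrow> real" where "r = rec_nat 0 (\<lambda>_ t. (1 + t\<^sup>2) / 2)"
  have r0: "r 0 = 0" and rS: "\<And>n. r (Suc n) = (1 + (r n)\<^sup>2) / 2"
    by (simp_all add: r_def)
  have r_bounds: "0 \<le> r n \<and> r n \<le> 1" for n
    by (induction n) (auto simp: r0 rS power_le_one)
  have r_step: "r n \<le> r (Suc n)" for n
  proof -
    have "0 \<le> (1 - r n)\<^sup>2" by simp
    then show ?thesis by (simp add: rS power2_eq_square algebra_simps)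
  qed
  then have r_mono: "incseq r" by (rule incseq_SucI)
  have "convergent r"
    using r_bounds by (meson incseq_convergent[OF r_mono] convergent_def)
  then have r_Cauchy: "Cauchy r" by (simp add: Cauchy_convergent_iff)
  define X where "X n = (S ^^ n) z" for n
  have X0: "X 0 = z" and XS: "\<And>n. X (Suc n) = S (X n)" by (simp_all add: X_def)
  have XM: "X n \<in> M" for n by (induction n) (auto simp: X0 XS z S)
  have Xb: "d z (X n) \<le> r n" for n
  proof (induction n)
    case 0 then show ?case using z by (simp add: X0 r0)
  next
    case (Suc n)
    have "d z (X (Suc n)) \<le> (1 + (d z (X n))\<^sup>2) / 2" using bound[OF XM[of n]] by (simp add: XS)
    also have "\<dots> \<le> r (Suc n)" using Suc power_mono[OF Suc, of 2] by (simp add: rS)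
    finally show ?case .
  qed
  have Xstep: "d (X n) (X (Suc n)) \<le> r (Suc n) - r n" for n
  proof (induction n)
    case 0 then show ?case using Xb[of "Suc 0"] by (simp add: X0 r0)
  next
    case (Suc n)
    have "d (X (Suc n)) (X (Suc (Suc n))) \<le> (d z (X n) + d z (X (Suc n))) / 2 * d (X n) (X (Suc n))"
      using lip[OF XM[of n] XM[of "Suc n"]] by (simp add: XS)
    also have "\<dots> \<le> (r n + r (Suc n)) / 2 * (r (Suc n) - r n)"
      by (intro mult_mono) (use Suc Xb[of n] Xb[of "Suc n"] r_bounds in \<open>auto simp: add_mono\<close>)
    also have "\<dots> = r (Suc (Suc n)) - r (Suc n)"
      by (simp only: rS[of "Suc n"] rS[of n]) (simp add: field_simps power2_eq_square)
    finally show ?case .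
  qed
  have Xdist: "d (X m) (X n) \<le> r n - r m" if "m \<le> n" for m n
    using that
  proof (induction n rule: dec_induct)
    case base then show ?case using XM by simp
  next
    case (step n)
    then show ?case using triangle[OF XM[of m] XM[of n] XM[of "Suc n"]] Xstep[of n] by linarith
  qed
  have "MCauchy X"
    unfolding MCauchy_def
  proof (intro conjI allI impI)
    show "range X \<subseteq> M" using XM by blast
    fix e :: real assume "e > 0"
    with r_Cauchy obtain N where N: "\<And>m n. \<lbrakk>N \<le> m; N \<le> n\<rbrakk> \<Longrightarrow> dist (r m) (r n) < e"
      unfolding Cauchy_def by metis
    have "d (X m) (X n) < e" if "N \<le> m" "N \<le> n" for m n
    proof (cases "m \<le> n")
      case True
      then show ?thesis using Xdist[OF True] N[OF that] by (auto simp: dist_real_def)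
    next
      case False
      then show ?thesis using Xdist[of n m] N[OF that] commute[of "X m"] by (auto simp: dist_real_def)
    qed
    then show "\<exists>N. \<forall>n n'. N \<le> n \<longrightarrow> N \<le> n' \<longrightarrow> d (X n) (X n') < e" by blast
  qed
  then obtain y where lim: "limitin mtopology X y sequentially"
    using complete unfolding mcomplete_def by blast
  then have y: "y \<in> M" and d0: "(\<lambda>n. d (X n) y) \<longlonglongrightarrow> 0"
    by (auto simp: limitin_metric_dist_null)
  have "(\<lambda>n. d (S y) (X (Suc n))) \<longlonglongrightarrow> 0"
  proof (rule real_tendsto_sandwich[where f = "\<lambda>_. 0" and h = "\<lambda>n. (d z y + 1) / 2 * d (X n) y"])
    have "d (S y) (X (Suc n)) \<le> (d z y + 1) / 2 * d (X n) y" for n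
    proof -
      have "d (S y) (X (Suc n)) \<le> (d z y + d z (X n)) / 2 * d (X n) y"
        using lip[OF y XM[of n]] commute[of y] by (simp add: XS)
      also have "\<dots> \<le> (d z y + 1) / 2 * d (X n) y"
        using Xb[of n] r_bounds[of n] by (intro mult_right_mono) auto
      finally show ?thesis .
    qed
    then show "\<forall>\<^sub>F n in sequentially. d (S y) (X (Suc n)) \<le> (d z y + 1) / 2 * d (X n) y" by simp
    show "(\<lambda>n. (d z y + 1) / 2 * d (X n) y) \<longlonglongrightarrow> 0"
      using tendsto_mult_left[OF d0, of "(d z y + 1) / 2"] by simp
  qed auto
  moreover have "(\<lambda>n. d (X (Suc n)) y) \<longlonglongrightarrow> 0" using d0 by (rule LIMSEQ_Suc)
  ultimately have "(\<lambda>n. d (S y) (X (Suc n)) + d (X (Suc n)) y) \<longlonglongrightarrow> 0 + 0"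
    by (rule tendsto_add)
  then have "d (S y) y \<le> 0"
    by (intro LIMSEQ_le_const[where a = "d (S y) y"])
       (use triangle[OF S[OF y] XM y] in auto)
  then have "S y = y" using S[OF y] y by (metis antisym nonneg zero)
  moreover have "y \<in> C"
    if C: "closedin mtopology C" "z \<in> C" "\<And>a. a \<in> C \<Longrightarrow> S a \<in> C" for C
  proof -
    have "X n \<in> C" for n by (induction n) (auto simp: X0 XS C)
    then show ?thesis
      using limitin_closedin[OF lim C(1)] by (metis eventually_sequentiallyI trivial_limit_sequentially)
  qed
  ultimately show thesis using that y by blast
qed

section \<open>Elementary calculus in C*-algebras\<close>
context cstar_algebra
begin

lemma smult_zero_left [simp]: "x \<in> carrier A \<Longrightarrow> 0 \<odot> x = \<zero>"
  using smult_add_left[of x 0 0] smult_closed by (metis add.l_cancel_one' add_0)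

lemma smult_zero_right [simp]: "c \<odot> \<zero> = \<zero>"
  by (metis mult_zero_right smult_smult smult_zero_left zero_closed)

lemma minus_eq_smult: "x \<in> carrier A \<Longrightarrow> \<ominus> x = (-1) \<odot> x"
  using smult_add_left[of x 1 "-1"] smult_closed smult_one
  by (metis add.right_inverse minus_equality smult_zero_left a_comm)

lemma add_neg_smult: "x \<in> carrier A \<Longrightarrow> x \<oplus> (-1) \<odot> x = \<zero>"
  by (simp add: minus_eq_smult[symmetric] r_neg)

lemma diff_eq_smult: "\<lbrakk>x \<in> carrier A; y \<in> carrier A\<rbrakk> \<Longrightarrow> x \<ominus> y = x \<oplus> (-1) \<odot> y"
  by (simp add: a_minus_def minus_eq_smult)

lemma mult_zero_left [simp]: "x \<in> carrier A \<Longrightarrow> \<zero> \<otimes> x = \<zero>"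
  by (metis smult_mult_left smult_zero_left mult_closed zero_closed)

lemma mult_zero_right [simp]: "x \<in> carrier A \<Longrightarrow> x \<otimes> \<zero> = \<zero>"
  by (metis smult_mult_right smult_zero_left mult_closed zero_closed)

lemma adj_zero [simp]: "adj A \<zero> = \<zero>"
  by (metis adj_smult complex_cnj_zero smult_zero_left adj_closed zero_closed)

lemma nrm_zero [simp]: "nrm A \<zero> = 0"
  by (simp add: nrm_eq_0)

lemmas algebra_closed = a_closed minus_closed mult_closed smult_closed adj_closed zero_closed

lemma diff_add_diff:
  assumes "x \<in> carrier A" "y \<in> carrier A" "z \<in> carrier A"
  shows "(x \<ominus> y) \<oplus> (y \<ominus> z) = x \<ominus> z"
  using assms by (simp add: a_minus_def a_assoc r_neg1)

lemma mult_diff_right: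
  "\<lbrakk>x \<in> carrier A; y \<in> carrier A; z \<in> carrier A\<rbrakk> \<Longrightarrow> z \<otimes> (x \<ominus> y) = z \<otimes> x \<ominus> z \<otimes> y"
  by (simp add: diff_eq_smult distrib_left algebra_closed smult_mult_right)

lemma mult_diff_left:
  "\<lbrakk>x \<in> carrier A; y \<in> carrier A; z \<in> carrier A\<rbrakk> \<Longrightarrow> (x \<ominus> y) \<otimes> z = x \<otimes> z \<ominus> y \<otimes> z"
  by (simp add: diff_eq_smult distrib_right algebra_closed smult_mult_left)

lemma adj_diff: "\<lbrakk>x \<in> carrier A; y \<in> carrier A\<rbrakk> \<Longrightarrow> adj A (x \<ominus> y) = adj A x \<ominus> adj A y"
  by (simp add: diff_eq_smult adj_add adj_smult algebra_closed)

lemma diff_eq_zero_iff: "\<lbrakk>x \<in> carrier A; y \<in> carrier A\<rbrakk> \<Longrightarrow> x \<ominus> y = \<zero> \<longleftrightarrow> x = y"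
  by (metis a_minus_def a_inv_closed minus_equality minus_minus r_neg)

lemma add_diff_cancel: "\<lbrakk>x \<in> carrier A; y \<in> carrier A\<rbrakk> \<Longrightarrow> (x \<oplus> y) \<ominus> x = y"
  by (simp add: a_minus_def a_comm[of x y] a_assoc r_neg r_zero)

lemma nrm_diff_commute:
  assumes "x \<in> carrier A" "y \<in> carrier A"
  shows "nrm A (x \<ominus> y) = nrm A (y \<ominus> x)"
proof -
  have "y \<ominus> x = (-1) \<odot> (x \<ominus> y)"
    using assms by (simp add: diff_eq_smult smult_add_right smult_smult[symmetric] algebra_closed
        smult_one a_comm)
  then show ?thesis using assms by (simp add: nrm_smult algebra_closed)
qed

lemma nrm_diff_triangle:
  "\<lbrakk>x \<in> carrier A; y \<in> carrier A\<rbrakk> \<Longrightarrow> nrm A (x \<ominus> y) \<le> nrm A x + nrm A y"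
  using nrm_triangle[of x "(-1) \<odot> y"] by (simp add: diff_eq_smult algebra_closed nrm_smult)

lemma nrm_adj:
  assumes "x \<in> carrier A"
  shows "nrm A (adj A x) = nrm A x"
proof -
  have le: "nrm A y \<le> nrm A (adj A y)" if y: "y \<in> carrier A" for y
  proof (cases "nrm A y = 0")
    case False
    with nrm_nonneg[OF y] have pos: "nrm A y > 0" by simp
    have "nrm A y * nrm A y = nrm A (adj A y \<otimes> y)"
      by (simp add: cstar_identity y power2_eq_square)
    also have "\<dots> \<le> nrm A (adj A y) * nrm A y" by (simp add: nrm_mult y algebra_closed)
    finally show ?thesis using pos by simp
  qed (use nrm_nonneg adj_closed y in auto)
  show ?thesis using le[OF assms] le[OF adj_closed[OF assms]] adj_adj[OF assms] by simp
qed

lemma cdist_eq: "\<lbrakk>x \<in> carrier A; y \<in> carrier A\<rbrakk> \<Longrightarrow> cdist A x y = nrm A (x \<ominus> y)"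
  by (simp add: cdist_def)

lemma Metric_space_cdist: "Metric_space (carrier A) (cdist A)"
proof
  fix x y z
  show "0 \<le> cdist A x y" by (simp add: cdist_def nrm_nonneg algebra_closed)
  show "cdist A x y = cdist A y x" by (simp add: cdist_def nrm_diff_commute)
  assume x: "x \<in> carrier A" and y: "y \<in> carrier A"
  show "cdist A x y = 0 \<longleftrightarrow> x = y"
    using x y by (simp add: cdist_eq nrm_eq_0 algebra_closed diff_eq_zero_iff)
  assume z: "z \<in> carrier A"
  show "cdist A x z \<le> cdist A x y + cdist A y z"
    using x y z nrm_triangle[of "x \<ominus> y" "y \<ominus> z"]
    by (simp add: cdist_eq diff_add_diff algebra_closed)
qed

sublocale metric: Metric_space "carrier A" "cdist A"
  by (rule Metric_space_cdist)

lemma zero_diff: "x \<in> carrier A \<Longrightarrow> \<zero> \<ominus> x = (-1) \<odot> x"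
  by (simp add: diff_eq_smult algebra_closed l_zero)

lemma cdist_zero_left: "x \<in> carrier A \<Longrightarrow> cdist A \<zero> x = nrm A x"
  by (simp add: cdist_eq zero_diff nrm_smult)

lemma closedin_iff_approx:
  "closedin (ctopology A) S \<longleftrightarrow>
     S \<subseteq> carrier A \<and> (\<forall>l\<in>carrier A. (\<forall>e>0. \<exists>x\<in>S. nrm A (l \<ominus> x) < e) \<longrightarrow> l \<in> S)"
proof -
  have "disjnt S (metric.mball l r) \<longleftrightarrow> \<not> (\<exists>x\<in>S. nrm A (l \<ominus> x) < r)"
    if "l \<in> carrier A" "S \<subseteq> carrier A" for l r
    using that by (auto simp: disjnt_def metric.mball_def cdist_eq subset_iff)
  then show ?thesis
    unfolding metric.closedin_metric by (auto simp: subset_iff) (metis)+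
qed

lemma selfadjoint_closed: "closedin (ctopology A) {x \<in> carrier A. adj A x = x}"
  unfolding closedin_iff_approx
proof (intro conjI ballI impI)
  fix l assume l: "l \<in> carrier A"
    and approx: "\<forall>e>0. \<exists>x\<in>{x \<in> carrier A. adj A x = x}. nrm A (l \<ominus> x) < e"
  have "nrm A (adj A l \<ominus> l) \<le> 0 + e" if e: "e > 0" for e
  proof -
    obtain x where x: "x \<in> carrier A" "adj A x = x" and lx: "nrm A (l \<ominus> x) < e / 2"
      using approx e by (metis (mono_tags, lifting) half_gt_zero mem_Collect_eq)
    have "adj A l \<ominus> l = (adj A (l \<ominus> x)) \<oplus> (x \<ominus> l)"
      using l x by (simp add: adj_diff diff_add_diff algebra_closed)
    then have "nrm A (adj A l \<ominus> l) \<le> nrm A (l \<ominus> x) + nrm A (x \<ominus> l)"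
      using l x nrm_triangle[of "adj A (l \<ominus> x)" "x \<ominus> l"] by (simp add: nrm_adj algebra_closed)
    then show ?thesis using lx nrm_diff_commute[OF l x(1)] by simp
  qed
  then have "nrm A (adj A l \<ominus> l) \<le> 0" by (rule field_le_epsilon)
  then have "nrm A (adj A l \<ominus> l) = 0"
    using nrm_nonneg[of "adj A l \<ominus> l"] l by (simp add: algebra_closed)
  then show "l \<in> {x \<in> carrier A. adj A x = x}"
    using l by (simp add: nrm_eq_0 diff_eq_zero_iff algebra_closed)
qed auto

text \<open>
  In a unital algebra the conclusion reads \<open>(1 - y)\<^sup>2 = 1 - x\<close>; this form of the square root makes sense without a unit.
\<close>
lemma selfadjoint_quadratic_solution:
  assumes x: "x \<in> carrier A" "adj A x = x" "nrm A x \<le> 1"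
  obtains y where "y \<in> carrier A" "adj A y = y" "(1/2) \<odot> (x \<oplus> y \<otimes> y) = y"
proof -
  define S where "S a = (1/2) \<odot> (x \<oplus> a \<otimes> a)" for a
  have S: "S a \<in> carrier A" if "a \<in> carrier A" for a
    using that x by (simp add: S_def algebra_closed)
  have bound: "cdist A \<zero> (S a) \<le> (1 + (cdist A \<zero> a)\<^sup>2) / 2" if a: "a \<in> carrier A" for a
    using a x nrm_triangle[of x "a \<otimes> a"] nrm_mult[of a a]
    by (simp add: S_def cdist_zero_left algebra_closed nrm_smult power2_eq_square)
  have lip: "cdist A (S a) (S b) \<le> (cdist A \<zero> a + cdist A \<zero> b) / 2 * cdist A a b"
    if a: "a \<in> carrier A" and b: "b \<in> carrier A" for a b
  proof -
    have "S a \<ominus> S b = (1/2) \<odot> (a \<otimes> a \<ominus> b \<otimes> b)"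
    proof -
      have "(1/2) \<odot> (a \<otimes> a \<ominus> b \<otimes> b)
          = ((1/2) \<odot> x \<oplus> (-1/2) \<odot> x) \<oplus> ((1/2) \<odot> (a \<otimes> a) \<oplus> (-1/2) \<odot> (b \<otimes> b))"
        using a b x by (simp add: diff_eq_smult smult_add_right smult_smult[symmetric]
            smult_add_left[symmetric] algebra_closed l_zero)
      then show ?thesis
        using a b x by (simp add: S_def diff_eq_smult smult_add_right smult_smult[symmetric]
            algebra_closed a_ac)
    qed
    also have "a \<otimes> a \<ominus> b \<otimes> b = a \<otimes> (a \<ominus> b) \<oplus> (a \<ominus> b) \<otimes> b"
      using a b by (simp add: mult_diff_left mult_diff_right diff_add_diff algebra_closed)
    finally have "nrm A (S a \<ominus> S b) = nrm A (a \<otimes> (a \<ominus> b) \<oplus> (a \<ominus> b) \<otimes> b) / 2"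
      using a b by (simp add: nrm_smult algebra_closed)
    also have "\<dots> \<le> (nrm A a * nrm A (a \<ominus> b) + nrm A (a \<ominus> b) * nrm A b) / 2"
      using a b nrm_triangle[of "a \<otimes> (a \<ominus> b)" "(a \<ominus> b) \<otimes> b"]
        nrm_mult[of a "a \<ominus> b"] nrm_mult[of "a \<ominus> b" b] by (simp add: algebra_closed)
    finally show ?thesis
      using a b by (simp add: cdist_zero_left cdist_eq[of a b] cdist_eq[OF S S] algebra_simps)
  qed
  obtain y where y: "y \<in> carrier A" "S y = y"
    and inv: "\<And>C. \<lbrakk>closedin (ctopology A) C; \<zero> \<in> C; \<And>a. a \<in> C \<Longrightarrow> S a \<in> C\<rbrakk> \<Longrightarrow> y \<in> C"
    using metric.quadratic_iteration_fixed_point[of \<zero> S] complete zero_closed S bound lip by blast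
  have "y \<in> {x \<in> carrier A. adj A x = x}"
    by (rule inv[OF selfadjoint_closed])
       (use x in \<open>auto simp: S_def algebra_closed adj_add adj_smult adj_mult\<close>)
  with y show thesis using that by (simp add: S_def)
qed

section \<open>Extreme points and orthogonality of projections\<close>
lemma unit_line_mult:
  assumes q: "q \<in> carrier A" "q \<otimes> q = q" and a: "a \<in> carrier A" "q \<otimes> a = a" "a \<otimes> q = a"
  shows "(q \<oplus> c \<odot> a) \<otimes> (q \<oplus> d \<odot> a) = q \<oplus> (c + d) \<odot> a \<oplus> (c * d) \<odot> (a \<otimes> a)"
proof -
  have "(q \<oplus> c \<odot> a) \<otimes> (q \<oplus> d \<odot> a) = q \<oplus> (c \<odot> a \<oplus> d \<odot> a) \<oplus> (c * d) \<odot> (a \<otimes> a)"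
    using q a by (simp add: distrib_left distrib_right algebra_closed smult_mult_left
        smult_mult_right smult_smult[symmetric] smult_add_right mult.commute a_ac)
  then show ?thesis using a by (simp add: smult_add_left[symmetric])
qed

text \<open>
  If the disc of radius \<open>r\<close> on the line \<open>w \<mapsto> q + w a\<close> lies in the unit ball, so does the disc of
  radius \<open>\<surd>2 r\<close>. For given \<open>w\<close> take \<open>c = w(1 + \<i>)/2\<close> and \<open>d = w(1 - \<i>)/2\<close>: then \<open>c\<^sup>2 + d\<^sup>2 = 0\<close>
  and \<open>c + d = w\<close>, so \<open>q + w a\<close> is the average of the squares of \<open>q + c a\<close> and \<open>q + d a\<close>.
\<close>
lemma unit_line_scale_sqrt2:
  assumes q: "q \<in> carrier A" "q \<otimes> q = q" and a: "a \<in> carrier A" "q \<otimes> a = a" "a \<otimes> q = a"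
    and r: "\<And>w. cmod w \<le> r \<Longrightarrow> nrm A (q \<oplus> w \<odot> a) \<le> 1"
    and w: "cmod w \<le> sqrt 2 * r"
  shows "nrm A (q \<oplus> w \<odot> a) \<le> 1"
proof -
  have sq: "(q \<oplus> c \<odot> a) \<otimes> (q \<oplus> c \<odot> a) = q \<oplus> (2 * c) \<odot> a \<oplus> (c * c) \<odot> (a \<otimes> a)" for c
    using unit_line_mult[OF q a, of c c] by simp
  have sq_le: "nrm A (q \<oplus> (2 * c) \<odot> a \<oplus> (c * c) \<odot> (a \<otimes> a)) \<le> 1" if c: "cmod c \<le> r" for c
  proof -
    have "nrm A (q \<oplus> c \<odot> a) \<le> 1" "nrm A (q \<oplus> c \<odot> a) \<ge> 0"
      using r[OF c] q a by (auto simp: nrm_nonneg algebra_closed)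
    then have "nrm A (q \<oplus> c \<odot> a) * nrm A (q \<oplus> c \<odot> a) \<le> 1"
      by (simp add: mult_le_one)
    then show ?thesis
      unfolding sq[symmetric] using nrm_mult[of "q \<oplus> c \<odot> a" "q \<oplus> c \<odot> a"] q a
      by (simp add: algebra_closed)
  qed
  define c where "c = w * (1 + \<i>) / 2"
  define d where "d = w * (1 - \<i>) / 2"
  have "cmod (1 + \<i>) = sqrt 2" "cmod (1 - \<i>) = sqrt 2" by (simp_all add: cmod_def)
  then have cd: "cmod c = cmod w / sqrt 2" "cmod d = cmod w / sqrt 2"
    unfolding c_def d_def norm_mult norm_divide by (simp_all add: nonzero_eq_divide_eq)
  have "cmod w / sqrt 2 \<le> r" using w by (simp add: divide_le_eq mult.commute)
  then have cd_le: "cmod c \<le> r" "cmod d \<le> r" using cd by auto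
  have cd_sum: "c + d = w" "c * c + d * d = 0"
    by (simp_all add: c_def d_def field_simps)
  have "(1/2) \<odot> ((q \<oplus> (2 * c) \<odot> a \<oplus> (c * c) \<odot> (a \<otimes> a)) \<oplus> (q \<oplus> (2 * d) \<odot> a \<oplus> (d * d) \<odot> (a \<otimes> a)))
      = ((1/2) \<odot> q \<oplus> (1/2) \<odot> q) \<oplus> (c \<odot> a \<oplus> d \<odot> a)
          \<oplus> (1/2) \<odot> ((c * c) \<odot> (a \<otimes> a) \<oplus> (d * d) \<odot> (a \<otimes> a))"
    using q a by (simp add: smult_add_right smult_smult[symmetric] algebra_closed a_ac)
  also have "\<dots> = q \<oplus> w \<odot> a"
    using q a by (simp add: smult_add_left[symmetric] algebra_closed smult_one cd_sum r_zero)
  finally have eq: "(1/2) \<odot> ((q \<oplus> (2 * c) \<odot> a \<oplus> (c * c) \<odot> (a \<otimes> a))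
      \<oplus> (q \<oplus> (2 * d) \<odot> a \<oplus> (d * d) \<odot> (a \<otimes> a))) = q \<oplus> w \<odot> a" .
  have "nrm A (q \<oplus> w \<odot> a) =
      nrm A ((q \<oplus> (2 * c) \<odot> a \<oplus> (c * c) \<odot> (a \<otimes> a)) \<oplus> (q \<oplus> (2 * d) \<odot> a \<oplus> (d * d) \<odot> (a \<otimes> a))) / 2"
    unfolding eq[symmetric] by (subst nrm_smult) (use q a in \<open>auto simp: algebra_closed\<close>)
  also have "\<dots> \<le> 1"
    using nrm_triangle[of "q \<oplus> (2 * c) \<odot> a \<oplus> (c * c) \<odot> (a \<otimes> a)" "q \<oplus> (2 * d) \<odot> a \<oplus> (d * d) \<odot> (a \<otimes> a)"]
      sq_le[OF cd_le(1)] sq_le[OF cd_le(2)] q a by (simp add: algebra_closed)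
  finally show ?thesis .
qed

lemma projection_nrm_le_1:
  assumes "q \<in> carrier A" "q \<otimes> q = q" "adj A q = q"
  shows "nrm A q \<le> 1"
proof -
  have "nrm A q * nrm A q = nrm A q"
    using cstar_identity[OF assms(1)] assms by (simp add: power2_eq_square)
  then show ?thesis by (metis mult_cancel_right1 linear zero_le_one)
qed

text \<open>
  The unit of a C*-algebra is an extreme point of its unit ball; \<open>q\<close> plays the unit of a corner. From the
  two hypotheses on \<open>q \<plusminus> a\<close> one gets \<open>q + w a\<close> in the unit ball for all small complex \<open>w\<close>, and
  repeated enlargement of this disc by the factor \<open>\<surd>2\<close> leaves room only for \<open>a = 0\<close>.
\<close>
lemma projection_extreme:
  assumes q: "q \<in> carrier A" "q \<otimes> q = q" "adj A q = q"
    and a: "a \<in> carrier A" "q \<otimes> a = a" "a \<otimes> q = a" "adj A a = a"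
    and plus: "nrm A (q \<oplus> a) \<le> 1" and minus: "nrm A (q \<ominus> a) \<le> 1"
  shows "a = \<zero>"
proof -
  let ?N = "\<lambda>c. nrm A (q \<oplus> c \<odot> a)"
  note mult = unit_line_mult[OF q(1,2) a(1-3)]
  have avg: "nrm A ((1/2) \<odot> x \<oplus> (1/2) \<odot> y) \<le> 1"
    if "x \<in> carrier A" "y \<in> carrier A" "nrm A x \<le> 1" "nrm A y \<le> 1" for x y
    using that nrm_triangle[of "(1/2) \<odot> x" "(1/2) \<odot> y"] by (simp add: algebra_closed nrm_smult)
  have conv: "?N ((c + d) / 2) \<le> 1" if "?N c \<le> 1" "?N d \<le> 1" for c d
  proof -
    have "(1/2) \<odot> (q \<oplus> c \<odot> a) \<oplus> (1/2) \<odot> (q \<oplus> d \<odot> a)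
        = ((1/2) \<odot> q \<oplus> (1/2) \<odot> q) \<oplus> ((c / 2) \<odot> a \<oplus> (d / 2) \<odot> a)"
      using q a by (simp add: smult_add_right smult_smult[symmetric] algebra_closed a_ac)
    also have "\<dots> = q \<oplus> ((c + d) / 2) \<odot> a"
      using q a by (simp add: smult_one smult_add_left[symmetric] add_divide_distrib)
    finally show ?thesis
      using avg[of "q \<oplus> c \<odot> a" "q \<oplus> d \<odot> a"] that q a by (simp add: algebra_closed)
  qed
  have N1: "?N 1 \<le> 1" and Nm1: "?N (-1) \<le> 1" and N0: "?N 0 \<le> 1"
    using plus minus q a projection_nrm_le_1[OF q] by (simp_all add: smult_one diff_eq_smult r_zero)
  have sq1: "nrm A (q \<oplus> (c + c) \<odot> a \<oplus> (c * c) \<odot> (a \<otimes> a)) \<le> 1" if c: "?N c \<le> 1" for c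
  proof -
    have "?N c * ?N c \<le> 1"
      using c q a by (simp add: mult_le_one nrm_nonneg algebra_closed)
    then show ?thesis
      unfolding mult[symmetric] using nrm_mult[of "q \<oplus> c \<odot> a" "q \<oplus> c \<odot> a"] q a
      by (simp add: algebra_closed)
  qed
  have qaa: "nrm A (q \<oplus> a \<otimes> a) \<le> 1"
  proof -
    have "(1/2) \<odot> (q \<oplus> (1 + 1) \<odot> a \<oplus> (1 * 1) \<odot> (a \<otimes> a))
            \<oplus> (1/2) \<odot> (q \<oplus> ((-1) + (-1)) \<odot> a \<oplus> ((-1) * (-1)) \<odot> (a \<otimes> a))
        = ((1/2) \<odot> q \<oplus> (1/2) \<odot> q) \<oplus> (1 \<odot> a \<oplus> (-1) \<odot> a) \<oplus> ((1/2) \<odot> (a \<otimes> a) \<oplus> (1/2) \<odot> (a \<otimes> a))"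
      using q a by (simp add: smult_add_right smult_smult[symmetric] algebra_closed a_ac)
    also have "\<dots> = q \<oplus> a \<otimes> a"
      using q a by (simp add: smult_one add_neg_smult smult_add_left[symmetric] algebra_closed r_zero)
    finally show ?thesis
      using avg[OF _ _ sq1[OF N1] sq1[OF Nm1]] q a by (simp add: algebra_closed)
  qed
  \<comment> \<open>For imaginary \<open>c\<close> the C*-identity reduces the claim to \<open>q + a\<^sup>2\<close>, the average of \<open>(q + a)\<^sup>2\<close> and \<open>(q - a)\<^sup>2\<close>.\<close>
  have Ni: "?N c \<le> 1" if c: "c = \<i> \<or> c = - \<i>" for c
  proof -
    have "adj A (q \<oplus> c \<odot> a) \<otimes> (q \<oplus> c \<odot> a) = (q \<oplus> (-c) \<odot> a) \<otimes> (q \<oplus> c \<odot> a)"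
      using q a c by (auto simp: adj_add adj_smult algebra_closed)
    also have "\<dots> = q \<oplus> a \<otimes> a"
      unfolding mult using q a c by (auto simp: smult_one algebra_closed r_zero)
    finally have "(?N c)\<^sup>2 \<le> 1"
      using qaa cstar_identity[of "q \<oplus> c \<odot> a"] q a by (simp add: algebra_closed)
    then show ?thesis by (simp add: abs_square_le_1)
  qed
  have segment: "?N (complex_of_real t * c) \<le> 1"
    if c: "?N c \<le> 1" "?N (-c) \<le> 1" and t: "\<bar>t\<bar> \<le> 1" for t c
  proof -
    have "q \<oplus> (of_real t * c) \<odot> a
        = of_real ((1 + t) / 2) \<odot> (q \<oplus> c \<odot> a) \<oplus> of_real ((1 - t) / 2) \<odot> (q \<oplus> (- c) \<odot> a)"
    proof -
      have comb: "\<alpha> \<odot> (q \<oplus> c \<odot> a) \<oplus> \<beta> \<odot> (q \<oplus> (- c) \<odot> a)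
          = (\<alpha> + \<beta>) \<odot> q \<oplus> (\<alpha> * c + \<beta> * (- c)) \<odot> a" for \<alpha> \<beta>
      proof -
        have "\<alpha> \<odot> (q \<oplus> c \<odot> a) \<oplus> \<beta> \<odot> (q \<oplus> (- c) \<odot> a)
            = (\<alpha> \<odot> q \<oplus> \<beta> \<odot> q) \<oplus> ((\<alpha> * c) \<odot> a \<oplus> (\<beta> * (- c)) \<odot> a)"
          using q a by (simp add: smult_add_right smult_smult[symmetric] algebra_closed a_ac)
        then show ?thesis using q a by (simp only: smult_add_left)
      qed
      have "of_real ((1 + t) / 2) \<odot> (q \<oplus> c \<odot> a) \<oplus> of_real ((1 - t) / 2) \<odot> (q \<oplus> (- c) \<odot> a)
          = (of_real ((1 + t) / 2) + of_real ((1 - t) / 2)) \<odot> q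
            \<oplus> (of_real ((1 + t) / 2) * c + of_real ((1 - t) / 2) * (- c)) \<odot> a"
        by (rule comb)
      also have "of_real ((1 + t) / 2) + of_real ((1 - t) / 2) = (1 :: complex)"
        by (simp add: field_simps)
      also have "of_real ((1 + t) / 2) * c + of_real ((1 - t) / 2) * (- c) = of_real t * c"
        by (simp add: field_simps)
      finally show ?thesis using q by (simp add: smult_one)
    qed
    then have "?N (of_real t * c) \<le> cmod (of_real ((1 + t) / 2)) * ?N c
        + cmod (of_real ((1 - t) / 2)) * ?N (-c)"
      using nrm_triangle[of "of_real ((1 + t) / 2) \<odot> (q \<oplus> c \<odot> a)" "of_real ((1 - t) / 2) \<odot> (q \<oplus> (- c) \<odot> a)"]
        q a by (simp add: algebra_closed nrm_smult del: of_real_add of_real_diff of_real_divide)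
    also have "\<dots> \<le> (1 + t) / 2 * 1 + (1 - t) / 2 * 1"
      unfolding norm_of_real using c t by (intro add_mono mult_mono) (auto simp: nrm_nonneg q a algebra_closed)
    finally show ?thesis by (simp add: field_simps)
  qed
  \<comment> \<open>A point of the disc of radius \<open>1/2\<close> is the midpoint of a real and an imaginary point of the unit disc.\<close>
  have base: "?N w \<le> 1" if w: "cmod w \<le> 1/2" for w
  proof -
    have "?N (of_real (2 * Re w) * 1) \<le> 1"
      using N1 Nm1 abs_Re_le_cmod[of w] w by (intro segment) auto
    moreover have "?N (of_real (2 * Im w) * \<i>) \<le> 1"
      using Ni abs_Im_le_cmod[of w] w by (intro segment) auto
    moreover have "(of_real (2 * Re w) * 1 + of_real (2 * Im w) * \<i>) / 2 = w"
      by (simp add: complex_eq_iff)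
    ultimately show ?thesis using conv by metis
  qed
  have scaled: "cmod w \<le> sqrt 2 ^ n / 2 \<Longrightarrow> ?N w \<le> 1" for w n
  proof (induction n arbitrary: w)
    case 0 then show ?case using base by simp
  next
    case (Suc n)
    show ?case
      by (rule unit_line_scale_sqrt2[where r = "sqrt 2 ^ n / 2"]) (use q a Suc in auto)
  qed
  show "a = \<zero>"
  proof (rule ccontr)
    assume "a \<noteq> \<zero>"
    then have pos: "nrm A a > 0" using nrm_nonneg[of a] nrm_eq_0[of a] a by auto
    obtain n where n: "4 / nrm A a < sqrt 2 ^ n"
      using real_arch_pow[of "sqrt 2" "4 / nrm A a"] by auto
    define w where "w = complex_of_real (sqrt 2 ^ n / 2)"
    have cw: "cmod w = sqrt 2 ^ n / 2" by (simp add: w_def norm_power norm_divide)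
    have "w \<odot> a = (q \<oplus> w \<odot> a) \<ominus> q"
      using q a by (simp add: add_diff_cancel algebra_closed)
    then have "cmod w * nrm A a \<le> 2"
      using nrm_diff_triangle[of "q \<oplus> w \<odot> a" q] scaled[of w n] cw projection_nrm_le_1[OF q] q a
      by (simp add: nrm_smult[symmetric] algebra_closed)
    moreover have "cmod w * nrm A a > 2" using n pos by (simp add: cw field_simps)
    ultimately show False by simp
  qed
qed

lemma mult_finsum:
  assumes "finite F" "x \<in> carrier A" "g \<in> F \<rightarrow> carrier A"
  shows "x \<otimes> finsum A g F = (\<Oplus>i\<in>F. x \<otimes> g i)"
  using assms(1,3)
proof (induction F rule: finite_induct)
  case (insert j F)
  then have "g j \<in> carrier A" "g \<in> F \<rightarrow> carrier A" by auto
  with insert assms(2) show ?case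
    by (simp add: finsum_insert distrib_left algebra_closed Pi_iff)
qed (simp add: assms)

lemma finsum_mult:
  assumes "finite F" "x \<in> carrier A" "g \<in> F \<rightarrow> carrier A"
  shows "finsum A g F \<otimes> x = (\<Oplus>i\<in>F. g i \<otimes> x)"
  using assms(1,3)
proof (induction F rule: finite_induct)
  case (insert j F)
  then have "g j \<in> carrier A" "g \<in> F \<rightarrow> carrier A" by auto
  with insert assms(2) show ?case
    by (simp add: finsum_insert distrib_right algebra_closed Pi_iff)
qed (simp add: assms)

text \<open>
  Compress by \<open>q = e\<^sub>i\<close>: the elements \<open>y\<^sub>j = q e\<^sub>j q\<close> with \<open>j \<noteq> i\<close> add up to zero. Each of them satisfies
  \<open>\<parallel>q - y\<^sub>j\<parallel> \<le> 1\<close>, a substitute for positivity. As \<open>y\<^sub>k\<close> is minus the sum of the others, \<open>q - y\<^sub>k/N\<close> and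
  \<open>q + y\<^sub>k/N\<close> are averages of \<open>N\<close> such elements and copies of \<open>q\<close>, for a suitable number \<open>N\<close> of terms, and so lie in
  the unit ball. By extremality \<open>y\<^sub>k = (e\<^sub>k q)\<^sup>* (e\<^sub>k q)\<close> is zero.
\<close>
lemma orthogonal_summands:
  assumes F: "finite F" "i \<in> F" "k \<in> F" "i \<noteq> k"
    and e: "\<And>j. j \<in> F \<Longrightarrow> e j \<in> carrier A" "\<And>j. j \<in> F \<Longrightarrow> e j \<otimes> e j = e j"
      "\<And>j. j \<in> F \<Longrightarrow> adj A (e j) = e j"
    and p: "p = finsum A e F" "p \<otimes> p = p" "adj A p = p" "\<And>j. j \<in> F \<Longrightarrow> p \<otimes> e j = e j"
  shows "e k \<otimes> e i = \<zero>"
proof -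
  define q where "q = e i"
  have q: "q \<in> carrier A" "q \<otimes> q = q" "adj A q = q" using e F by (auto simp: q_def)
  have pc: "p \<in> carrier A" using e by (auto simp: p(1))
  have ep: "e j \<otimes> p = e j" if "j \<in> F" for j
    using adj_mult[OF pc e(1)[OF that]] p(3,4) e(3) that by simp
  define y where "y j = q \<otimes> e j \<otimes> q" for j
  have yc: "y j \<in> carrier A" if "j \<in> F" for j using that q e by (simp add: y_def algebra_closed)
  have y_adj: "adj A (y j) = y j" if "j \<in> F" for j
    using that q e by (simp add: y_def adj_mult algebra_closed mult_assoc)
  have qy: "q \<otimes> y j = y j" "y j \<otimes> q = y j" if "j \<in> F" for j
    using that q e by (simp_all add: y_def algebra_closed mult_assoc)
      (simp_all add: mult_assoc[symmetric] algebra_closed)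
  have gap: "nrm A (q \<ominus> y j) \<le> 1" if j: "j \<in> F" for j
  proof -
    have ej: "e j \<in> carrier A" using e j by simp
    have proj: "nrm A (p \<ominus> e j) \<le> 1"
    proof (rule projection_nrm_le_1)
      show "(p \<ominus> e j) \<otimes> (p \<ominus> e j) = p \<ominus> e j"
        using pc ej j by (simp add: mult_diff_left mult_diff_right algebra_closed p(2,4) ep e(2))
          (simp add: a_minus_def minus_zero r_neg r_zero)
    qed (use pc ej j p e in \<open>simp_all add: algebra_closed adj_diff\<close>)
    have "q \<ominus> y j = q \<otimes> (p \<ominus> e j) \<otimes> q"
      using q pc ej F by (simp add: mult_diff_left mult_diff_right algebra_closed y_def q_def ep e(2))
    then have "nrm A (q \<ominus> y j) \<le> nrm A q * nrm A (p \<ominus> e j) * nrm A q"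
      using nrm_mult[of "q \<otimes> (p \<ominus> e j)" q] nrm_mult[of q "p \<ominus> e j"] q pc ej
      by (simp add: algebra_closed) (meson mult_right_mono nrm_nonneg order_trans)
    also have "\<dots> \<le> 1"
      using proj projection_nrm_le_1[OF q] q pc ej
      by (intro mult_le_one mult_nonneg_nonneg) (auto simp: nrm_nonneg algebra_closed)
    finally show ?thesis .
  qed
  have gaps: "nrm A (of_nat (card G) \<odot> q \<ominus> finsum A y G) \<le> card G" if "G \<subseteq> F" for G
    using finite_subset[OF that F(1)] that
  proof (induction G rule: finite_induct)
    case empty then show ?case using q by (simp add: diff_eq_smult r_zero)
  next
    case (insert a G)
    have c: "y a \<in> carrier A" "y \<in> G \<rightarrow> carrier A" using insert yc by auto
    have "of_nat (card (insert a G)) \<odot> q \<ominus> finsum A y (insert a G)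
        = (q \<ominus> y a) \<oplus> (of_nat (card G) \<odot> q \<ominus> finsum A y G)"
      using insert c q
      by (simp add: finsum_insert diff_eq_smult smult_add_left smult_add_right smult_one
          algebra_closed a_ac)
    also have "nrm A \<dots> \<le> nrm A (q \<ominus> y a) + nrm A (of_nat (card G) \<odot> q \<ominus> finsum A y G)"
      using c q by (intro nrm_triangle) (auto simp: algebra_closed)
    also have "\<dots> \<le> 1 + card G" using insert gap[of a] by auto
    finally show ?case using insert by simp
  qed
  define G where "G = F - {i, k}"
  have FG: "F = insert i (insert k G)" and G: "finite G" "i \<notin> insert k G" "k \<notin> G" "G \<subseteq> F"
    using F by (auto simp: G_def)
  define Y where "Y = finsum A y G"
  have yG: "y \<in> G \<rightarrow> carrier A" using yc G(4) by auto
  then have Yc: "Y \<in> carrier A" by (simp add: Y_def)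
  have yk: "y k \<in> carrier A" using yc F by simp
  have "finsum A y F = q \<otimes> p \<otimes> q"
  proof -
    have "q \<otimes> p \<otimes> q = (\<Oplus>j\<in>F. q \<otimes> e j) \<otimes> q"
      unfolding p(1) using mult_finsum[OF F(1) q(1), of e] e by (simp add: Pi_iff)
    also have "\<dots> = finsum A y F"
      unfolding y_def using q e by (intro finsum_mult F) (auto simp: algebra_closed)
    finally show ?thesis by simp
  qed
  also have "\<dots> = q" using ep[OF F(2)] q by (simp add: q_def[symmetric])
  finally have "q = y i \<oplus> (y k \<oplus> Y)"
    unfolding Y_def using FG G yG yc F by (simp add: finsum_insert Pi_iff)
  also have "y i = q" using q by (simp add: y_def q_def[symmetric])
  finally have "q \<oplus> \<zero> = q \<oplus> (y k \<oplus> Y)" using q by (simp add: r_zero)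
  then have sum0: "y k \<oplus> Y = \<zero>" using q yk Yc by (metis a_closed add_diff_cancel zero_closed)
  \<comment> \<open>Scaling by the number of terms turns the estimates for sums into estimates for averages.\<close>
  define N :: real where "N = 1 + card G"
  have N: "N > 0" by (simp add: N_def)
  define g where "g = of_nat (card G) \<odot> q"
  have gc: "g \<in> carrier A" "nrm A g \<le> card G"
    using q projection_nrm_le_1[OF q] by (auto simp: g_def algebra_closed nrm_smult mult_left_le)
  have Nq: "q = complex_of_real (1 / N) \<odot> (q \<oplus> g)"
  proof -
    have "q \<oplus> g = complex_of_real N \<odot> q"
      using q by (simp add: g_def N_def smult_add_left smult_one)
    then show ?thesis using q N by (simp add: smult_smult[symmetric] smult_one del: of_real_divide)
      (simp add: smult_one)
  qed
  have Ysum: "y k = (-1) \<odot> Y"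
    using minus_unique[of "y k" Y "\<ominus> Y"] sum0 yk Yc
    by (metis minus_eq_smult minus_equality)
  define a where "a = complex_of_real (1 / N) \<odot> y k"
  have ac: "a \<in> carrier A" using yk by (simp add: a_def algebra_closed)
  have "a = \<zero>"
  proof (rule projection_extreme[OF q ac])
    show "q \<otimes> a = a" "a \<otimes> q = a"
      using q yk qy F by (simp_all add: a_def smult_mult_left smult_mult_right)
    show "adj A a = a" using yk y_adj F by (simp add: a_def adj_smult)
    have "q \<oplus> a = complex_of_real (1 / N) \<odot> (q \<oplus> g) \<oplus> complex_of_real (1 / N) \<odot> y k"
      unfolding a_def by (simp only: Nq[symmetric])
    also have "\<dots> = complex_of_real (1 / N) \<odot> (q \<oplus> (g \<ominus> Y))"
      using q gc Yc by (simp add: Ysum diff_eq_smult smult_add_right algebra_closed a_ac)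
    finally have "nrm A (q \<oplus> a) = 1 / N * nrm A (q \<oplus> (g \<ominus> Y))"
      using q gc Yc N by (simp add: nrm_smult algebra_closed norm_divide)
    also have "\<dots> \<le> 1 / N * (1 + card G)"
      using nrm_triangle[of q "g \<ominus> Y"] q gc(1) Yc projection_nrm_le_1[OF q] gaps[OF G(4)] N
      unfolding g_def[symmetric] Y_def[symmetric] by (intro mult_left_mono) (auto simp: algebra_closed)
    finally show "nrm A (q \<oplus> a) \<le> 1" using N by (simp add: N_def)
    have "q \<ominus> a = complex_of_real (1 / N) \<odot> (q \<oplus> g) \<ominus> complex_of_real (1 / N) \<odot> y k"
      unfolding a_def by (simp only: Nq[symmetric])
    also have "\<dots> = complex_of_real (1 / N) \<odot> ((q \<ominus> y k) \<oplus> g)"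
      using q gc yk by (simp add: diff_eq_smult smult_add_right algebra_closed a_ac
          smult_smult[symmetric] mult.commute)
    finally have "nrm A (q \<ominus> a) = 1 / N * nrm A ((q \<ominus> y k) \<oplus> g)"
      using q gc yk N by (simp add: nrm_smult algebra_closed norm_divide)
    also have "\<dots> \<le> 1 / N * (1 + card G)"
      using nrm_triangle[of "q \<ominus> y k" g] q gc yk gap[OF F(3)] N
      by (intro mult_left_mono) (auto simp: algebra_closed)
    finally show "nrm A (q \<ominus> a) \<le> 1" using N by (simp add: N_def)
  qed
  then have "complex_of_real N \<odot> a = \<zero>" by simp
  then have "y k = \<zero>"
    using N yk by (simp add: a_def smult_smult[symmetric] smult_one)
  moreover have "y k = adj A (e k \<otimes> q) \<otimes> (e k \<otimes> q)"
    using F q e(1,3)[OF F(3)] by (simp add: y_def adj_mult mult_assoc algebra_closed)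
      (simp add: mult_assoc[symmetric] algebra_closed e(2))
  ultimately have "(nrm A (e k \<otimes> q))\<^sup>2 = 0"
    using cstar_identity[of "e k \<otimes> q"] q e F by (simp add: algebra_closed)
  then show ?thesis using nrm_eq_0[of "e k \<otimes> e i"] e F by (simp add: q_def algebra_closed)
qed

end

section \<open>Closed ideals and quotients\<close>

context cstar_algebra
begin

lemma closed_ideal_carrier: "closed_ideal A (carrier A)"
  by (simp add: closed_ideal_def algebra_closed closedin_iff_approx)

lemma closed_ideal_generated:
  assumes "X \<subseteq> carrier A"
  shows "closed_ideal A (ideal_generated A X)"
proof -
  have "closedin (ctopology A) (\<Inter> {I. closed_ideal A I \<and> X \<subseteq> I})"
    using assms closed_ideal_carrier by (intro closedin_Inter) (auto simp: closed_ideal_def)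
  then show ?thesis
    unfolding ideal_generated_def closed_ideal_def by auto
qed

lemma subset_ideal_generated: "X \<subseteq> ideal_generated A X"
  by (auto simp: ideal_generated_def)

lemma ideal_generated_subset: "\<lbrakk>closed_ideal A I; X \<subseteq> I\<rbrakk> \<Longrightarrow> ideal_generated A X \<subseteq> I"
  by (auto simp: ideal_generated_def)

lemma closed_ideal_subset: "closed_ideal A I \<Longrightarrow> I \<subseteq> carrier A"
  by (simp add: closed_ideal_def closedin_iff_approx)

text \<open>
  Since taking adjoints is an isometric anti-automorphism, \<open>{x. x\<^sup>* \<in> I}\<close> is a closed ideal, and it contains
  \<open>X\<close> as soon as \<open>I\<close> contains the adjoints of \<open>X\<close>.
\<close>
lemma ideal_generated_adj:
  assumes X: "X \<subseteq> carrier A" and adjX: "\<And>x. x \<in> X \<Longrightarrow> adj A x \<in> ideal_generated A X"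
    and x: "x \<in> ideal_generated A X"
  shows "adj A x \<in> ideal_generated A X"
proof -
  let ?I = "ideal_generated A X"
  let ?J = "{x \<in> carrier A. adj A x \<in> ?I}"
  have I: "closed_ideal A ?I" using X by (rule closed_ideal_generated)
  have Ic: "closedin (ctopology A) ?I" using I by (simp add: closed_ideal_def)
  have "closedin (ctopology A) ?J"
    unfolding closedin_iff_approx
  proof (intro conjI ballI impI)
    fix l assume l: "l \<in> carrier A" and approx: "\<forall>e>0. \<exists>x\<in>?J. nrm A (l \<ominus> x) < e"
    have "\<exists>z\<in>?I. nrm A (adj A l \<ominus> z) < e" if e: "e > 0" for e
    proof -
      obtain x where x: "x \<in> carrier A" "adj A x \<in> ?I" "nrm A (l \<ominus> x) < e" using approx e by blast
      then have "nrm A (adj A l \<ominus> adj A x) < e"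
        using l nrm_adj[of "l \<ominus> x"] by (simp add: adj_diff algebra_closed)
      then show ?thesis using x by blast
    qed
    then have "adj A l \<in> ?I" using Ic l unfolding closedin_iff_approx by (meson adj_closed)
    then show "l \<in> ?J" using l by simp
  qed auto
  then have "closed_ideal A ?J"
    using I unfolding closed_ideal_def
    by (auto simp: algebra_closed adj_add adj_smult adj_mult)
  then have "?I \<subseteq> ?J"
    by (rule ideal_generated_subset) (use X adjX in auto)
  then show ?thesis using x by auto
qed

end

text \<open>
  Closure under adjoints is what makes the set of adjoints of a coset again a single coset.
\<close>
locale selfadjoint_ideal = cstar_algebra +
  fixes I
  assumes ideal: "closed_ideal A I" and adj_in: "x \<in> I \<Longrightarrow> adj A x \<in> I"
begin

lemma I_subset: "I \<subseteq> carrier A"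
  using ideal by (rule closed_ideal_subset)

lemma I_closed:
  "\<zero> \<in> I" "\<lbrakk>x \<in> I; y \<in> I\<rbrakk> \<Longrightarrow> x \<oplus> y \<in> I" "x \<in> I \<Longrightarrow> c \<odot> x \<in> I"
  "\<lbrakk>x \<in> I; y \<in> carrier A\<rbrakk> \<Longrightarrow> x \<otimes> y \<in> I" "\<lbrakk>x \<in> I; y \<in> carrier A\<rbrakk> \<Longrightarrow> y \<otimes> x \<in> I"
  using ideal by (simp_all add: closed_ideal_def)

sublocale abelian_subgroup I A
proof (rule abelian_subgroupI3)
  show "additive_subgroup I A"
  proof
    show "I \<subseteq> carrier (add_monoid A)" using I_subset by simp
    fix x assume x: "x \<in> I"
    then have "\<ominus> x \<in> I" using I_subset by (auto simp: minus_eq_smult subset_iff I_closed)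
    then show "inv\<^bsub>add_monoid A\<^esub> x \<in> I" by (simp add: a_inv_def)
  qed (auto simp: I_closed)
qed (rule abelian_group_axioms)

lemma mem_coset_iff:
  assumes "x \<in> carrier A"
  shows "y \<in> I +> x \<longleftrightarrow> y \<in> carrier A \<and> y \<ominus> x \<in> I"
proof
  assume "y \<in> I +> x"
  then obtain h where h: "h \<in> I" "y = h \<oplus> x" by (auto simp: a_r_coset_def')
  with I_subset have "h \<in> carrier A" by auto
  then show "y \<in> carrier A \<and> y \<ominus> x \<in> I"
    using h assms add_diff_cancel[of x h] by (simp add: a_comm[of h x])
next
  assume y: "y \<in> carrier A \<and> y \<ominus> x \<in> I"
  then have "y = (y \<ominus> x) \<oplus> x" using assms by (simp add: a_minus_def a_assoc l_neg r_zero)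
  with y show "y \<in> I +> x" unfolding a_r_coset_def' by blast
qed

lemma coset_eq_iff:
  assumes "x \<in> carrier A" "y \<in> carrier A"
  shows "I +> x = I +> y \<longleftrightarrow> x \<ominus> y \<in> I"
proof
  assume "I +> x = I +> y"
  moreover have "x \<in> I +> x" using assms I_closed by (simp add: mem_coset_iff a_minus_def r_neg)
  ultimately show "x \<ominus> y \<in> I" using assms mem_coset_iff by blast
next
  assume "x \<ominus> y \<in> I"
  then have "x \<in> I +> y" using assms by (simp add: mem_coset_iff)
  then show "I +> x = I +> y" using a_repr_independence[OF _ assms(2) a_subgroup] by simp
qed

text \<open>
  The operations of the quotient are unions over representatives; for an operation compatible with \<open>I\<close> all
  members of the union coincide.
\<close>
lemma coset_Union:
  assumes x: "x \<in> carrier A" and g: "\<And>y. y \<in> carrier A \<Longrightarrow> g y \<in> carrier A"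
    and cong: "\<And>y. \<lbrakk>y \<in> carrier A; y \<ominus> x \<in> I\<rbrakk> \<Longrightarrow> g y \<ominus> g x \<in> I"
  shows "(\<Union>y\<in>I +> x. I +> g y) = I +> g x"
proof -
  have "I +> g y = I +> g x" if "y \<in> I +> x" for y
    using that x g cong by (simp add: mem_coset_iff coset_eq_iff)
  then have "(\<Union>y\<in>I +> x. I +> g y) = (\<Union>y\<in>I +> x. I +> g x)" by (rule SUP_cong[OF refl])
  moreover have "x \<in> I +> x" using x I_closed by (simp add: mem_coset_iff a_minus_def r_neg)
  ultimately show ?thesis by auto
qed

lemma quot_map_star_hom: "quot_map A I \<in> star_hom A (quotient_cstar A I)"
proof -
  have car: "carrier (quotient_cstar A I) = a_rcosets I"
    by (simp add: quotient_cstar_def FactRing_def)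
  have add: "I +> (x \<oplus> y) = (I +> x) \<oplus>\<^bsub>quotient_cstar A I\<^esub> (I +> y)"
    if "x \<in> carrier A" "y \<in> carrier A" for x y
    using that by (simp add: quotient_cstar_def FactRing_def a_rcos_sum)
  have smult: "I +> (c \<odot> x) = c \<odot>\<^bsub>quotient_cstar A I\<^esub> (I +> x)" if x: "x \<in> carrier A" for c x
  proof -
    have "c \<odot> y \<ominus> c \<odot> x = c \<odot> (y \<ominus> x)" if "y \<in> carrier A" for y
      using x that by (simp add: diff_eq_smult smult_add_right algebra_closed
          smult_smult[symmetric] mult.commute)
    then show ?thesis
      using x coset_Union[of x "\<lambda>x. c \<odot> x"]
      by (simp add: quotient_cstar_def smult_closed I_closed)
  qed
  have adj: "I +> (adj A x) = adj (quotient_cstar A I) (I +> x)" if x: "x \<in> carrier A" for x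
    using x coset_Union[of x "adj A"]
    by (simp add: quotient_cstar_def adj_closed adj_diff[symmetric] adj_in)
  have mult: "I +> (x \<otimes> y) = (I +> x) \<otimes>\<^bsub>quotient_cstar A I\<^esub> (I +> y)"
    if x: "x \<in> carrier A" and y: "y \<in> carrier A" for x y
  proof -
    have "(\<Union>b\<in>I +> y. I +> (a \<otimes> b)) = I +> (a \<otimes> y)" if "a \<in> carrier A" for a
      using that y by (intro coset_Union) (auto simp: mult_closed mult_diff_right[symmetric] I_closed)
    moreover have "(\<Union>a\<in>I +> x. I +> (a \<otimes> y)) = I +> (x \<otimes> y)"
      using x y by (intro coset_Union) (auto simp: mult_closed mult_diff_left[symmetric] I_closed)
    moreover have "I +> x \<subseteq> carrier A" using x by (auto simp: mem_coset_iff)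
    ultimately show ?thesis
      by (simp add: quotient_cstar_def FactRing_def rcoset_mult_def subset_iff)
  qed
  show ?thesis
    unfolding star_hom_def quot_map_def
    by (auto simp: car add smult mult adj intro: a_rcosetsI[OF I_subset])
qed

lemma quot_map_surj: "quot_map A I ` carrier A = carrier (quotient_cstar A I)"
  by (auto simp: quotient_cstar_def FactRing_def quot_map_def A_RCOSETS_def')

lemma star_iso_quot_map:
  assumes "\<psi> \<in> star_iso (quotient_cstar A I) B"
  defines "\<theta> \<equiv> \<lambda>x. \<psi> (quot_map A I x)"
  shows "\<theta> \<in> star_hom A B" "\<theta> ` carrier A = carrier B"
    "\<lbrakk>x \<in> carrier A; y \<in> carrier A\<rbrakk> \<Longrightarrow> \<theta> x = \<theta> y \<longleftrightarrow> x \<ominus> y \<in> I"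
proof -
  have hom: "\<psi> \<in> star_hom (quotient_cstar A I) B"
    and bij: "bij_betw \<psi> (carrier (quotient_cstar A I)) (carrier B)"
    using assms by (auto simp: star_iso_def)
  have Q: "quot_map A I x \<in> carrier (quotient_cstar A I)" if "x \<in> carrier A" for x
    using that quot_map_star_hom by (auto simp: star_hom_def)
  show "\<theta> \<in> star_hom A B"
    using hom quot_map_star_hom Q unfolding star_hom_def \<theta>_def by (auto simp: Pi_iff)
  show "\<theta> ` carrier A = carrier B"
    unfolding \<theta>_def image_image[of \<psi> "quot_map A I", symmetric]
    using bij quot_map_surj by (simp add: bij_betw_def)
  show "\<theta> x = \<theta> y \<longleftrightarrow> x \<ominus> y \<in> I" if "x \<in> carrier A" "y \<in> carrier A"
    using that bij Q[OF that(1)] Q[OF that(2)] coset_eq_iff[OF that]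
    by (auto simp: \<theta>_def bij_betw_def inj_on_eq_iff quot_map_def)
qed

end

section \<open>The pullback family and the ideals\<close>
lemma (in cstar_algebra) closed_ideal_diff_add:
  assumes I: "closed_ideal A I" and "x \<ominus> y \<in> I" "x' \<ominus> y' \<in> I"
    and "x \<in> carrier A" "y \<in> carrier A" "x' \<in> carrier A" "y' \<in> carrier A"
  shows "(x \<oplus> x') \<ominus> (y \<oplus> y') \<in> I"
proof -
  have "(x \<oplus> x') \<ominus> (y \<oplus> y') = (x \<ominus> y) \<oplus> (x' \<ominus> y')"
    using assms(4-) by (simp add: diff_eq_smult smult_add_right algebra_closed a_ac)
  then show ?thesis using assms(1-3) by (simp add: closed_ideal_def)
qed

text \<open>
  Work modulo \<open>I\<close>, where \<open>a\<^sub>\<eta>\<close> and \<open>b\<^sub>\<eta>\<close> agree but nothing is known about their adjoints yet: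
  \<open>a\<^sub>\<xi>\<^sup>* = \<Sum> a\<^sub>\<xi>\<^sup>* b\<^sub>\<eta> b\<^sub>\<eta>\<^sup>*\<close>, in which \<open>a\<^sub>\<xi>\<^sup>* b\<^sub>\<eta>\<close> may be replaced by \<open>a\<^sub>\<xi>\<^sup>* a\<^sub>\<eta>\<close>, and by orthogonality only
  \<open>a\<^sub>\<xi>\<^sup>* a\<^sub>\<xi> b\<^sub>\<xi>\<^sup>* = b\<^sub>\<xi>\<^sup>*\<close> survives.
\<close>
lemma (in cstar_algebra) adj_diff_mem_closed_ideal:
  assumes I: "closed_ideal A I" and F: "finite F" "\<xi> \<in> F"
    and a: "\<And>\<eta>. \<eta> \<in> F \<Longrightarrow> a \<eta> \<in> carrier A" and b: "\<And>\<eta>. \<eta> \<in> F \<Longrightarrow> b \<eta> \<in> carrier A"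
    and diff: "\<And>\<eta>. \<eta> \<in> F \<Longrightarrow> a \<eta> \<ominus> b \<eta> \<in> I"
    and orth: "\<And>\<eta>. \<lbrakk>\<eta> \<in> F; \<eta> \<noteq> \<xi>\<rbrakk> \<Longrightarrow> adj A (a \<xi>) \<otimes> a \<eta> = \<zero>"
    and source: "adj A (a \<xi>) \<otimes> a \<xi> \<otimes> adj A (b \<xi>) = adj A (b \<xi>)"
    and rng: "adj A (a \<xi>) \<otimes> (\<Oplus>\<eta>\<in>F. b \<eta> \<otimes> adj A (b \<eta>)) = adj A (a \<xi>)"
  shows "adj A (a \<xi>) \<ominus> adj A (b \<xi>) \<in> I"
proof -
  define x where "x = adj A (a \<xi>)"
  define y where "y = adj A (b \<xi>)"
  have xy: "x \<in> carrier A" "y \<in> carrier A" using F a b by (auto simp: x_def y_def adj_closed)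
  have step: "x \<otimes> (b \<eta> \<otimes> adj A (b \<eta>)) \<ominus> (if \<eta> = \<xi> then y else \<zero>) \<in> I" if \<eta>: "\<eta> \<in> F" for \<eta>
  proof -
    have "x \<otimes> a \<eta> \<otimes> adj A (b \<eta>) = (if \<eta> = \<xi> then y else \<zero>)"
      using orth[OF \<eta>] source b[OF \<eta>] by (auto simp: x_def y_def adj_closed)
    moreover have "x \<otimes> (b \<eta> \<otimes> adj A (b \<eta>)) \<ominus> x \<otimes> a \<eta> \<otimes> adj A (b \<eta>)
        = (-1) \<odot> (x \<otimes> (a \<eta> \<ominus> b \<eta>) \<otimes> adj A (b \<eta>))"
      using xy a[OF \<eta>] b[OF \<eta>]
      by (simp add: diff_eq_smult algebra_closed distrib_left distrib_right smult_add_right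
          smult_mult_left smult_mult_right smult_smult[symmetric] smult_one mult_assoc a_comm)
    moreover have "\<dots> \<in> I"
      using I diff[OF \<eta>] xy b[OF \<eta>] by (simp add: closed_ideal_def adj_closed)
    ultimately show ?thesis by simp
  qed
  have "x \<otimes> (\<Oplus>\<eta>\<in>G. b \<eta> \<otimes> adj A (b \<eta>)) \<ominus> (if \<xi> \<in> G then y else \<zero>) \<in> I" if "G \<subseteq> F" for G
    using finite_subset[OF that F(1)] that
  proof (induction G rule: finite_induct)
    case empty
    then show ?case using I xy by (simp add: closed_ideal_def a_minus_def r_neg)
  next
    case (insert \<eta> G)
    have c: "b \<eta> \<otimes> adj A (b \<eta>) \<in> carrier A" "(\<lambda>\<eta>. b \<eta> \<otimes> adj A (b \<eta>)) \<in> G \<rightarrow> carrier A"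
      using insert b by (auto simp: algebra_closed)
    have "(x \<otimes> (b \<eta> \<otimes> adj A (b \<eta>)) \<oplus> x \<otimes> (\<Oplus>\<eta>\<in>G. b \<eta> \<otimes> adj A (b \<eta>)))
        \<ominus> ((if \<eta> = \<xi> then y else \<zero>) \<oplus> (if \<xi> \<in> G then y else \<zero>)) \<in> I"
      using insert step[of \<eta>] c xy by (intro closed_ideal_diff_add[OF I]) (auto simp: algebra_closed)
    moreover have "(if \<eta> = \<xi> then y else \<zero>) \<oplus> (if \<xi> \<in> G then y else \<zero>) = (if \<xi> \<in> insert \<eta> G then y else \<zero>)"
      using insert xy by (auto simp: r_zero l_zero)
    ultimately show ?case
      using insert c xy by (simp add: finsum_insert distrib_left)
  qed
  from this[of F] show ?thesis using rng F by (simp add: x_def y_def)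
qed

lemma zpow_add:
  assumes "z \<in> torus"
  shows "zpow z (m + n) = zpow z m * zpow z n"
proof -
  have "cmod (z $ i) = 1" for i using assms by (simp add: torus_def)
  then have "z $ i \<noteq> 0" for i by (metis norm_zero zero_neq_one)
  then show ?thesis by (simp add: zpow_def prod.distrib[symmetric] power_int_add)
qed

lemma cmod_zpow: "z \<in> torus \<Longrightarrow> cmod (zpow z n) = 1"
  by (simp add: zpow_def torus_def norm_power_int prod_norm[symmetric])

lemma zpow_diff: "z \<in> torus \<Longrightarrow> zpow z (m - n) * zpow z n = zpow z m"
  using zpow_add[of z "m - n" n] by simp

lemma Nk_zero [simp]: "0 \<in> Nk"
  by (simp add: Nk_def)

lemma Nk_add: "\<lbrakk>m \<in> Nk; n \<in> Nk\<rbrakk> \<Longrightarrow> m + n \<in> Nk"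
  by (simp add: Nk_def)

lemma diff_of_Nk:
  obtains m n where "m \<in> Nk" "n \<in> Nk" "h = m - n"
proof
  show "(\<chi> i. max 0 (h $ i)) \<in> Nk" "(\<chi> i. max 0 (- h $ i)) \<in> Nk" by (auto simp: Nk_def)
  show "h = (\<chi> i. max 0 (h $ i)) - (\<chi> i. max 0 (- h $ i))" by (auto simp: vec_eq_iff)
qed

locale pullback_graph = P_graph "f ` Nk" \<Gamma>
  for f :: "int^'k \<Rightarrow> 'g::ab_group_add" and \<Gamma> :: "('m, 'g) graded_category" +
  assumes additive: "Modules.additive f"
    and row_finite: "row_finite_no_sources (f ` Nk) \<Gamma>"
begin

lemma f_simps: "f 0 = 0" "f (m + n) = f m + f n" "f (m - n) = f m - f n"
  using additive by (simp_all add: additive.add additive.zero additive.diff)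

lemma mor_pullback: "(\<xi>, n) \<in> mor (pullback f \<Gamma>) \<longleftrightarrow> \<xi> \<in> mor \<Gamma> \<and> n \<in> Nk \<and> deg \<Gamma> \<xi> = f n"
  by (simp add: pullback_def)

lemma src_vertex: "\<xi> \<in> mor \<Gamma> \<Longrightarrow> src \<Gamma> \<xi> \<in> vertices \<Gamma>"
  by (simp add: vertices_def src_in src_src)

lemma rng_vertex: "\<xi> \<in> mor \<Gamma> \<Longrightarrow> rng \<Gamma> \<xi> \<in> vertices \<Gamma>"
  by (simp add: vertices_def rng_in src_rng)

lemma vertices_pullback: "(v, n) \<in> vertices (pullback f \<Gamma>) \<longleftrightarrow> v \<in> vertices \<Gamma> \<and> n = 0"
proof -
  have "deg \<Gamma> v = 0" if "v \<in> mor \<Gamma>" "src \<Gamma> v = v" using that deg_vertex by (simp add: vertices_def)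
  then show ?thesis by (auto simp: vertices_def pullback_def f_simps)
qed

lemma paths_into_pullback:
  "n \<in> Nk \<Longrightarrow> paths_into (pullback f \<Gamma>) (v, 0) n = (\<lambda>\<xi>. (\<xi>, n)) ` paths_into \<Gamma> v (f n)"
  by (auto simp: paths_into_def pullback_def)

lemma finite_paths: "\<lbrakk>v \<in> vertices \<Gamma>; n \<in> Nk\<rbrakk> \<Longrightarrow> finite (paths_into \<Gamma> v (f n))"
  using row_finite by (simp add: row_finite_no_sources_def)

lemma paths_intoD:
  "\<xi> \<in> paths_into \<Gamma> v p \<Longrightarrow> \<xi> \<in> mor \<Gamma>" "\<xi> \<in> paths_into \<Gamma> v p \<Longrightarrow> deg \<Gamma> \<xi> = p"
  "\<xi> \<in> paths_into \<Gamma> v p \<Longrightarrow> rng \<Gamma> \<xi> = v"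
  by (simp_all add: paths_into_def)

lemma factorE:
  assumes "\<xi> \<in> mor \<Gamma>" "m \<in> Nk" "n \<in> Nk" "deg \<Gamma> \<xi> = f m + f n"
  obtains \<alpha> \<beta> where "\<alpha> \<in> mor \<Gamma>" "\<beta> \<in> mor \<Gamma>" "deg \<Gamma> \<alpha> = f m" "deg \<Gamma> \<beta> = f n"
    "src \<Gamma> \<alpha> = rng \<Gamma> \<beta>" "\<xi> = comp \<Gamma> \<alpha> \<beta>"
  using factorisation[of \<xi> "f m" "f n"] assms by auto

end

locale pullback_family = pullback_graph f \<Gamma> + cstar_algebra A
  for f :: "int^'k \<Rightarrow> 'g::ab_group_add" and \<Gamma> :: "('m, 'g) graded_category"
    and A :: "'a cstar" (structure) +
  fixes s :: "'m \<times> (int^'k) \<Rightarrow> 'a"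
  assumes family: "ck_family Nk (pullback f \<Gamma>) A s"
begin

lemma s_closed: "\<lbrakk>\<xi> \<in> mor \<Gamma>; n \<in> Nk; deg \<Gamma> \<xi> = f n\<rbrakk> \<Longrightarrow> s (\<xi>, n) \<in> carrier A"
  using family by (auto simp: ck_family_def mor_pullback)

lemma s_vertex:
  assumes "v \<in> vertices \<Gamma>"
  shows "s (v, 0) \<in> carrier A" "s (v, 0) \<otimes> s (v, 0) = s (v, 0)" "adj A (s (v, 0)) = s (v, 0)"
    "\<lbrakk>w \<in> vertices \<Gamma>; w \<noteq> v\<rbrakk> \<Longrightarrow> s (v, 0) \<otimes> s (w, 0) = \<zero>"
proof -
  have "(v, 0) \<in> vertices (pullback f \<Gamma>)" using assms by (simp add: vertices_pullback)
  then show "s (v, 0) \<otimes> s (v, 0) = s (v, 0)" "adj A (s (v, 0)) = s (v, 0)"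
    "\<lbrakk>w \<in> vertices \<Gamma>; w \<noteq> v\<rbrakk> \<Longrightarrow> s (v, 0) \<otimes> s (w, 0) = \<zero>"
    using family vertices_pullback[of w 0] by (auto simp: ck_family_def)
  show "s (v, 0) \<in> carrier A"
    using assms deg_vertex by (simp add: s_closed vertices_def f_simps)
qed

lemma s_mult:
  assumes "\<xi> \<in> mor \<Gamma>" "m \<in> Nk" "deg \<Gamma> \<xi> = f m" "\<eta> \<in> mor \<Gamma>" "n \<in> Nk" "deg \<Gamma> \<eta> = f n"
    and "src \<Gamma> \<xi> = rng \<Gamma> \<eta>"
  shows "s (\<xi>, m) \<otimes> s (\<eta>, n) = s (comp \<Gamma> \<xi> \<eta>, m + n)"
proof -
  have "(\<xi>, m) \<in> mor (pullback f \<Gamma>)" "(\<eta>, n) \<in> mor (pullback f \<Gamma>)"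
    "src (pullback f \<Gamma>) (\<xi>, m) = rng (pullback f \<Gamma>) (\<eta>, n)"
    and comp: "comp (pullback f \<Gamma>) (\<xi>, m) (\<eta>, n) = (comp \<Gamma> \<xi> \<eta>, m + n)"
    using assms by (auto simp: pullback_def)
  moreover have "\<forall>x\<in>mor (pullback f \<Gamma>). \<forall>y\<in>mor (pullback f \<Gamma>).
      src (pullback f \<Gamma>) x = rng (pullback f \<Gamma>) y \<longrightarrow> s x \<otimes> s y = s (comp (pullback f \<Gamma>) x y)"
    using family unfolding ck_family_def by (elim conjE) assumption
  ultimately have "s (\<xi>, m) \<otimes> s (\<eta>, n) = s (comp (pullback f \<Gamma>) (\<xi>, m) (\<eta>, n))" by blast
  then show ?thesis by (simp only: comp)
qed

lemma s_adj:
  assumes "\<xi> \<in> mor \<Gamma>" "n \<in> Nk" "deg \<Gamma> \<xi> = f n"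
  shows "adj A (s (\<xi>, n)) \<otimes> s (\<xi>, n) = s (src \<Gamma> \<xi>, 0)"
proof -
  have "(\<xi>, n) \<in> mor (pullback f \<Gamma>)" and src: "src (pullback f \<Gamma>) (\<xi>, n) = (src \<Gamma> \<xi>, 0)"
    using assms by (auto simp: pullback_def)
  moreover have "\<forall>x\<in>mor (pullback f \<Gamma>). adj A (s x) \<otimes> s x = s (src (pullback f \<Gamma>) x)"
    using family unfolding ck_family_def by (elim conjE) assumption
  ultimately show ?thesis by (simp only: src[symmetric])
qed

lemma s_rng:
  assumes "\<xi> \<in> mor \<Gamma>" "n \<in> Nk" "deg \<Gamma> \<xi> = f n"
  shows "s (rng \<Gamma> \<xi>, 0) \<otimes> s (\<xi>, n) = s (\<xi>, n)" "adj A (s (\<xi>, n)) \<otimes> s (rng \<Gamma> \<xi>, 0) = adj A (s (\<xi>, n))"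
proof -
  show *: "s (rng \<Gamma> \<xi>, 0) \<otimes> s (\<xi>, n) = s (\<xi>, n)"
    using assms s_mult[of "rng \<Gamma> \<xi>" 0 \<xi> n] rng_vertex[OF assms(1)] deg_vertex
    by (simp add: rng_in src_rng comp_rng f_simps)
  show "adj A (s (\<xi>, n)) \<otimes> s (rng \<Gamma> \<xi>, 0) = adj A (s (\<xi>, n))"
    using adj_mult[of "s (rng \<Gamma> \<xi>, 0)" "s (\<xi>, n)"] assms s_vertex[OF rng_vertex[OF assms(1)]]
    by (simp add: * s_closed)
qed

lemma s_src:
  assumes "\<xi> \<in> mor \<Gamma>" "n \<in> Nk" "deg \<Gamma> \<xi> = f n"
  shows "s (\<xi>, n) \<otimes> s (src \<Gamma> \<xi>, 0) = s (\<xi>, n)" "s (src \<Gamma> \<xi>, 0) \<otimes> adj A (s (\<xi>, n)) = adj A (s (\<xi>, n))"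
proof -
  show *: "s (\<xi>, n) \<otimes> s (src \<Gamma> \<xi>, 0) = s (\<xi>, n)"
    using assms s_mult[of \<xi> n "src \<Gamma> \<xi>" 0] src_vertex[OF assms(1)] deg_vertex
    by (simp add: src_in rng_src comp_src f_simps)
  show "s (src \<Gamma> \<xi>, 0) \<otimes> adj A (s (\<xi>, n)) = adj A (s (\<xi>, n))"
    using adj_mult[of "s (\<xi>, n)" "s (src \<Gamma> \<xi>, 0)"] assms s_vertex[OF src_vertex[OF assms(1)]]
    by (simp add: * s_closed)
qed

lemma s_sum:
  assumes "v \<in> vertices \<Gamma>" "n \<in> Nk"
  shows "s (v, 0) = (\<Oplus>\<xi>\<in>paths_into \<Gamma> v (f n). s (\<xi>, n) \<otimes> adj A (s (\<xi>, n)))"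
proof -
  have "(v, 0) \<in> vertices (pullback f \<Gamma>)" using assms by (simp add: vertices_pullback)
  then have "s (v, 0) = (\<Oplus>\<xi>\<in>(\<lambda>\<xi>. (\<xi>, n)) ` paths_into \<Gamma> v (f n). s \<xi> \<otimes> adj A (s \<xi>))"
    using family assms unfolding ck_family_def paths_into_pullback[OF assms(2), symmetric] by blast
  also have "\<dots> = (\<Oplus>\<xi>\<in>paths_into \<Gamma> v (f n). s (\<xi>, n) \<otimes> adj A (s (\<xi>, n)))"
    using assms by (intro finsum_reindex) (auto simp: inj_on_def paths_into_def s_closed algebra_closed)
  finally show ?thesis .
qed

text \<open>
  The range projections of the \<open>s\<^bsub>(\<xi>,n)\<^esub>\<close>, for \<open>\<xi>\<close> in \<open>v\<Gamma>\<^bsup>f n\<^esup>\<close>, add up to the vertex projection.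
\<close>
lemma s_orthogonal:
  assumes v: "v \<in> vertices \<Gamma>" "n \<in> Nk" and \<xi>: "\<xi> \<in> paths_into \<Gamma> v (f n)"
    and \<eta>: "\<eta> \<in> paths_into \<Gamma> v (f n)" and "\<xi> \<noteq> \<eta>"
  shows "adj A (s (\<xi>, n)) \<otimes> s (\<eta>, n) = \<zero>"
proof -
  let ?e = "\<lambda>\<xi>. s (\<xi>, n) \<otimes> adj A (s (\<xi>, n))"
  have sc: "s (\<zeta>, n) \<in> carrier A" if "\<zeta> \<in> paths_into \<Gamma> v (f n)" for \<zeta>
    using that v by (auto simp: paths_into_def s_closed)
  have sss: "s (\<zeta>, n) \<otimes> (adj A (s (\<zeta>, n)) \<otimes> s (\<zeta>, n)) = s (\<zeta>, n)"
    "(adj A (s (\<zeta>, n)) \<otimes> s (\<zeta>, n)) \<otimes> adj A (s (\<zeta>, n)) = adj A (s (\<zeta>, n))"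
    if "\<zeta> \<in> paths_into \<Gamma> v (f n)" for \<zeta>
    using that v by (auto simp: paths_into_def s_adj s_src)
  have "?e \<xi> \<otimes> ?e \<eta> = \<zero>"
  proof (rule orthogonal_summands[where F = "paths_into \<Gamma> v (f n)" and p = "s (v, 0)"])
    fix \<zeta> assume \<zeta>: "\<zeta> \<in> paths_into \<Gamma> v (f n)"
    show "?e \<zeta> \<otimes> ?e \<zeta> = ?e \<zeta>"
      using sss[OF \<zeta>] sc[OF \<zeta>] by (simp add: mult_assoc algebra_closed)
    show "s (v, 0) \<otimes> ?e \<zeta> = ?e \<zeta>"
      using \<zeta> v sc[OF \<zeta>] s_vertex[of v] s_rng(1)[of \<zeta> n]
      by (simp add: paths_into_def mult_assoc[symmetric] adj_closed)
  qed (use assms sc s_vertex s_sum finite_paths in \<open>auto simp: algebra_closed adj_mult adj_adj\<close>)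
  moreover have "adj A (s (\<xi>, n)) \<otimes> s (\<eta>, n) = adj A (s (\<xi>, n)) \<otimes> (?e \<xi> \<otimes> ?e \<eta>) \<otimes> s (\<eta>, n)"
  proof -
    have "adj A (s (\<xi>, n)) \<otimes> (?e \<xi> \<otimes> ?e \<eta>) \<otimes> s (\<eta>, n)
       = ((adj A (s (\<xi>, n)) \<otimes> s (\<xi>, n)) \<otimes> adj A (s (\<xi>, n))) \<otimes> (s (\<eta>, n) \<otimes> (adj A (s (\<eta>, n)) \<otimes> s (\<eta>, n)))"
      using sc \<xi> \<eta> by (simp add: mult_assoc algebra_closed)
    then show ?thesis by (simp add: sss \<xi> \<eta>)
  qed
  ultimately show ?thesis using sc \<xi> \<eta> by (simp add: algebra_closed)
qed

text \<open>
  The generators are differences \<open>a\<^sub>\<xi> - b\<^sub>\<xi>\<close> of two Cuntz-Krieger systems over the same finite set of paths,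
  \<open>a\<^sub>\<xi> = z\<^bsup>-m\<^esup> s\<^bsub>(\<xi>,m)\<^esub>\<close> and \<open>b\<^sub>\<xi> = z\<^bsup>-n\<^esup> s\<^bsub>(\<xi>,n)\<^esub>\<close>, and the unimodular scalars cancel in products with adjoints.
\<close>
lemma ideal_z_selfadjoint:
  assumes z: "z \<in> torus"
  shows "selfadjoint_ideal A (ideal_z f \<Gamma> A s z)"
proof -
  let ?X = "{(zpow z (- m) \<odot> s (\<xi>, m)) \<ominus> (zpow z (- n) \<odot> s (\<xi>, n)) | \<xi> m n.
        \<xi> \<in> mor \<Gamma> \<and> m \<in> Nk \<and> n \<in> Nk \<and> f m = deg \<Gamma> \<xi> \<and> f n = deg \<Gamma> \<xi>}"
  let ?I = "ideal_generated A ?X"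
  have X: "?X \<subseteq> carrier A" by (auto simp: s_closed algebra_closed)
  have I: "closed_ideal A ?I" using X by (rule closed_ideal_generated)
  have "adj A x \<in> ?I" if "x \<in> ?X" for x
  proof -
    from that obtain \<xi> m n where \<xi>: "\<xi> \<in> mor \<Gamma>" "m \<in> Nk" "n \<in> Nk" "f m = deg \<Gamma> \<xi>" "f n = deg \<Gamma> \<xi>"
      and x: "x = (zpow z (- m) \<odot> s (\<xi>, m)) \<ominus> (zpow z (- n) \<odot> s (\<xi>, n))" by auto
    define a where "a \<eta> = zpow z (- m) \<odot> s (\<eta>, m)" for \<eta>
    define b where "b \<eta> = zpow z (- n) \<odot> s (\<eta>, n)" for \<eta>
    let ?v = "rng \<Gamma> \<xi>" and ?F = "paths_into \<Gamma> (rng \<Gamma> \<xi>) (deg \<Gamma> \<xi>)"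
    have unit: "zpow z (- k) * cnj (zpow z (- k)) = 1" "cnj (zpow z (- k)) * zpow z (- k) = 1" for k
      using cmod_zpow[OF z, of "- k"] complex_norm_square[of "zpow z (- k)"]
      by (simp_all add: mult.commute)
    have cl: "s (\<eta>, m) \<in> carrier A" "s (\<eta>, n) \<in> carrier A" if "\<eta> \<in> ?F" for \<eta>
      using that \<xi> by (auto simp: paths_into_def s_closed)
    have aa: "adj A (a \<xi>) \<otimes> a \<eta> = adj A (s (\<xi>, m)) \<otimes> s (\<eta>, m)" if "\<eta> \<in> ?F" for \<eta>
      using cl[OF that] cl[of \<xi>] \<xi> unit
      by (simp add: a_def adj_smult smult_mult_left smult_mult_right algebra_closed
          smult_smult[symmetric] smult_one paths_into_def)
    have bb: "b \<eta> \<otimes> adj A (b \<eta>) = s (\<eta>, n) \<otimes> adj A (s (\<eta>, n))" if "\<eta> \<in> ?F" for \<eta>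
      using cl[OF that] unit
      by (simp add: b_def adj_smult smult_mult_left smult_mult_right algebra_closed
          smult_smult[symmetric] smult_one)
    have v: "?v \<in> vertices \<Gamma>" and \<xi>F: "\<xi> \<in> ?F" using \<xi> by (auto simp: rng_vertex paths_into_def)
    have "adj A (a \<xi>) \<ominus> adj A (b \<xi>) \<in> ?I"
    proof (rule adj_diff_mem_closed_ideal[OF I, where F = ?F])
      show "finite ?F" using finite_paths[OF v \<xi>(2)] \<xi> by simp
      fix \<eta> assume \<eta>: "\<eta> \<in> ?F"
      show "a \<eta> \<in> carrier A" "b \<eta> \<in> carrier A" using cl[OF \<eta>] by (auto simp: a_def b_def smult_closed)
      have "a \<eta> \<ominus> b \<eta> \<in> ?X" using \<eta> \<xi> unfolding a_def b_def
        by (intro CollectI exI[of _ \<eta>] exI[of _ m] exI[of _ n]) (simp add: paths_into_def)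
      then show "a \<eta> \<ominus> b \<eta> \<in> ?I" by (rule subsetD[OF subset_ideal_generated])
      show "adj A (a \<xi>) \<otimes> a \<eta> = \<zero>" if "\<eta> \<noteq> \<xi>"
        using aa[OF \<eta>] s_orthogonal[OF v \<xi>(2), unfolded \<xi>(4), OF \<xi>F \<eta> that[symmetric]] by simp
    next
      show "\<xi> \<in> ?F" by (rule \<xi>F)
      show "adj A (a \<xi>) \<otimes> a \<xi> \<otimes> adj A (b \<xi>) = adj A (b \<xi>)"
        using \<xi> cl[OF \<xi>F] aa[OF \<xi>F] s_vertex[OF src_vertex[OF \<xi>(1)]]
        by (simp add: b_def s_adj s_src adj_smult smult_mult_right adj_closed)
      have "(\<Oplus>\<eta>\<in>?F. b \<eta> \<otimes> adj A (b \<eta>)) = (\<Oplus>\<eta>\<in>?F. s (\<eta>, n) \<otimes> adj A (s (\<eta>, n)))"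
        using bb cl by (intro finsum_cong') (auto simp: algebra_closed)
      also have "\<dots> = s (?v, 0)" using s_sum[OF v \<xi>(3)] \<xi> by simp
      finally show "adj A (a \<xi>) \<otimes> (\<Oplus>\<eta>\<in>?F. b \<eta> \<otimes> adj A (b \<eta>)) = adj A (a \<xi>)"
        using \<xi> cl[OF \<xi>F] s_vertex[OF v]
        by (simp add: a_def adj_smult smult_mult_left adj_closed s_rng)
    qed
    then show ?thesis using cl[OF \<xi>F] by (simp add: x a_def b_def adj_diff smult_closed)
  qed
  then have "adj A x \<in> ?I" if "x \<in> ?I" for x
    by (rule ideal_generated_adj[OF X _ that])
  then show ?thesis
    unfolding ideal_z_def by unfold_locales (use I in assumption)+
qed

end

section \<open>Representations\<close>
instance complex_hilbert \<subseteq> banach ..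

lemma cscale_zero [simp]: "cscale c (0 :: 'h::complex_hilbert) = 0"
  using cscale_add_right[of c 0 "0::'h"] by simp

lemma cscale_one [simp]: "cscale 1 (v :: 'h::complex_hilbert) = v"
  using cscale_of_real[of 1 v] by simp

lemma cscale_minus_one: "cscale (-1) (v :: 'h::complex_hilbert) = - v"
  using cscale_of_real[of "-1" v] by simp

lemma cscale_diff_right: "cscale c (v - w :: 'h::complex_hilbert) = cscale c v - cscale c w"
  by (metis add_diff_cancel cscale_add_right diff_add_cancel)

lemma cinner_cscale_right: "cinner v (cscale c w :: 'h::complex_hilbert) = cnj c * cinner v w"
  by (metis cinner_commute cinner_cscale_left complex_cnj_mult)

lemma norm_cscale [simp]: "norm (cscale c (v :: 'h::complex_hilbert)) = cmod c * norm v"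
proof -
  have "(norm (cscale c v))\<^sup>2 = Re (cinner (cscale c v) (cscale c v))"
    by (simp add: power2_norm_eq_inner Re_cinner)
  also have "cinner (cscale c v) (cscale c v) = complex_of_real ((cmod c)\<^sup>2) * cinner v v"
    unfolding complex_norm_square
    by (simp add: cinner_cscale_left cinner_cscale_right mult_ac)
  also have "Re \<dots> = (cmod c)\<^sup>2 * (norm v)\<^sup>2"
    by (simp only: times_complex.sel Re_complex_of_real Im_complex_of_real mult_zero_left diff_0_right Re_cinner power2_norm_eq_inner)
  finally show ?thesis
    by (simp add: power_mult_distrib[symmetric] power2_eq_iff_nonneg)
qed

lemma cscale_cancel:
  assumes "cscale a v = cscale b (v :: 'h::complex_hilbert)" "v \<noteq> 0"
  shows "a = b"
proof -
  have "cscale a v = cscale b v + cscale (a - b) v" by (simp add: cscale_add_left[symmetric])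
  then have "cscale (a - b) v = 0" using assms(1) by simp
  then have "cmod (a - b) * norm v = 0" by (simp flip: norm_cscale)
  with assms(2) show ?thesis by simp
qed

lemma bounded_linear_cscale: "bounded_linear (cscale c :: 'h::complex_hilbert \<Rightarrow> 'h)"
proof
  fix r :: real and v :: 'h
  show "cscale c (r *\<^sub>R v) = r *\<^sub>R cscale c v"
    by (simp add: cscale_of_real[symmetric] cscale_cscale mult.commute)
  show "\<exists>K. \<forall>v::'h. norm (cscale c v) \<le> norm v * K"
    by (rule exI[of _ "cmod c"]) simp
qed (simp add: cscale_add_right)

locale star_representation = cstar_algebra A for A (structure) +
  fixes \<rho> :: "_ \<Rightarrow> ('h::complex_hilbert \<Rightarrow>\<^sub>L 'h)"
  assumes representation: "representation A \<rho>"
begin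

lemma rep_add: "\<lbrakk>x \<in> carrier A; y \<in> carrier A\<rbrakk> \<Longrightarrow> \<rho> (x \<oplus> y) = \<rho> x + \<rho> y"
  and rep_cscale: "x \<in> carrier A \<Longrightarrow> \<rho> x (cscale c v) = cscale c (\<rho> x v)"
  and rep_smult: "x \<in> carrier A \<Longrightarrow> \<rho> (c \<odot> x) v = cscale c (\<rho> x v)"
  and rep_mult: "\<lbrakk>x \<in> carrier A; y \<in> carrier A\<rbrakk> \<Longrightarrow> \<rho> (x \<otimes> y) = \<rho> x o\<^sub>L \<rho> y"
  using representation by (simp_all add: representation_def)

lemma rep_adj: "x \<in> carrier A \<Longrightarrow> inner (\<rho> x v) w = inner v (\<rho> (adj A x) w)"
  using representation by (simp add: representation_def Re_cinner[symmetric])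

lemma rep_zero [simp]: "\<rho> \<zero> = 0"
  using rep_add[of \<zero> \<zero>] by (simp add: l_zero)

lemma rep_diff: "\<lbrakk>x \<in> carrier A; y \<in> carrier A\<rbrakk> \<Longrightarrow> \<rho> (x \<ominus> y) = \<rho> x - \<rho> y"
  by (rule blinfun_eqI)
    (simp add: diff_eq_smult rep_add rep_smult smult_closed blinfun.add_left blinfun.diff_left
      cscale_minus_one)

lemma rep_finsum:
  assumes "g \<in> F \<rightarrow> carrier A"
  shows "\<rho> (finsum A g F) = (\<Sum>i\<in>F. \<rho> (g i))"
proof (cases "finite F")
  case True
  then show ?thesis using assms
  proof (induction F rule: finite_induct)
    case (insert j F)
    then have "g j \<in> carrier A" "g \<in> F \<rightarrow> carrier A" by auto
    with insert show ?case by (simp add: finsum_insert rep_add)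
  qed simp
qed (simp add: finsum_infinite)

text \<open>
  For \<open>x = a\<^sup>*a\<close> write \<open>x = 2 y - y\<^sup>2\<close> with \<open>y\<close> self-adjoint. Then \<open>\<langle>\<rho>(x) v, v\<rangle> = \<parallel>v\<parallel>\<^sup>2 - \<parallel>v - \<rho>(y) v\<parallel>\<^sup>2\<close>,
  and the left-hand side is \<open>\<parallel>\<rho>(a) v\<parallel>\<^sup>2\<close>.
\<close>
lemma rep_contractive_unit:
  assumes a: "a \<in> carrier A" "nrm A a \<le> 1"
  shows "norm (\<rho> a v) \<le> norm v"
proof -
  define x where "x = adj A a \<otimes> a"
  have x: "x \<in> carrier A" "adj A x = x" using a by (auto simp: x_def algebra_closed adj_mult adj_adj)
  have "nrm A x \<le> 1" using a by (simp add: x_def cstar_identity power_le_one nrm_nonneg)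
  then obtain y where y: "y \<in> carrier A" "adj A y = y" "(1/2) \<odot> (x \<oplus> y \<otimes> y) = y"
    using selfadjoint_quadratic_solution[OF x] by blast
  have "2 \<odot> y = 2 \<odot> ((1/2) \<odot> (x \<oplus> y \<otimes> y))" by (simp only: y(3))
  also have "\<dots> = x \<oplus> y \<otimes> y"
    using x y(1,2) by (simp add: smult_smult[symmetric] algebra_closed smult_one)
  finally have "2 \<odot> y = x \<oplus> y \<otimes> y" .
  then have "\<rho> (2 \<odot> y) v = \<rho> x v + \<rho> y (\<rho> y v)"
    using x y by (simp add: rep_add rep_mult algebra_closed blinfun.add_left)
  moreover have "\<rho> (2 \<odot> y) v = 2 *\<^sub>R \<rho> y v"
    using rep_smult[OF y(1), of 2 v] cscale_of_real[of 2 "\<rho> y v"] by simp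
  ultimately have "2 * inner (\<rho> y v) v = inner (\<rho> x v) v + inner (\<rho> y (\<rho> y v)) v"
    by (metis inner_add_left inner_scaleR_left)
  also have "inner (\<rho> y (\<rho> y v)) v = (norm (\<rho> y v))\<^sup>2"
    using y by (simp add: rep_adj power2_norm_eq_inner)
  also have "inner (\<rho> x v) v = (norm (\<rho> a v))\<^sup>2"
    using a rep_adj[of "adj A a" "\<rho> a v" v]
    by (simp add: x_def rep_mult algebra_closed adj_adj power2_norm_eq_inner)
  finally have "(norm (\<rho> a v))\<^sup>2 = 2 * inner (\<rho> y v) v - (norm (\<rho> y v))\<^sup>2" by simp
  moreover have "0 \<le> (norm (\<rho> y v - v))\<^sup>2" by simp
  then have "2 * inner (\<rho> y v) v - (norm (\<rho> y v))\<^sup>2 \<le> (norm v)\<^sup>2"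
    by (simp add: power2_norm_eq_inner algebra_simps inner_commute)
  ultimately show ?thesis by (simp add: power2_le_imp_le)
qed

lemma rep_contractive:
  assumes x: "x \<in> carrier A"
  shows "norm (\<rho> x) \<le> nrm A x"
proof (cases "nrm A x = 0")
  case True
  then show ?thesis using x by (simp add: nrm_eq_0)
next
  case False
  then have pos: "nrm A x > 0" using nrm_nonneg[OF x] by simp
  show ?thesis
  proof (rule norm_blinfun_bound)
    fix v
    define a where "a = complex_of_real (1 / nrm A x) \<odot> x"
    have "nrm A a \<le> 1" using x pos by (simp add: a_def nrm_smult norm_divide)
    then have "norm (\<rho> a v) \<le> norm v"
      using x by (intro rep_contractive_unit) (auto simp: a_def smult_closed)
    then show "norm (\<rho> x v) \<le> nrm A x * norm v"
      using x pos by (simp add: a_def rep_smult norm_divide divide_le_eq mult.commute)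
  qed (use pos in simp)
qed

lemma closedin_rep_vimage:
  assumes "closed K"
  shows "closedin (ctopology A) {x \<in> carrier A. \<rho> x \<in> K}"
    and "closedin (ctopology A) {x \<in> carrier A. \<rho> (adj A x) \<in> K}"
proof -
  have lim: "\<rho> (g l) \<in> K"
    if l: "l \<in> carrier A" and g: "\<And>x. x \<in> carrier A \<Longrightarrow> g x \<in> carrier A"
      "\<And>x. x \<in> carrier A \<Longrightarrow> nrm A (g l \<ominus> g x) = nrm A (l \<ominus> x)"
      and approx: "\<forall>e>0. \<exists>x\<in>{x \<in> carrier A. \<rho> (g x) \<in> K}. nrm A (l \<ominus> x) < e" for g l
  proof -
    have "\<exists>T\<in>K. dist T (\<rho> (g l)) < e" if e: "e > 0" for e
    proof -
      obtain x where x: "x \<in> carrier A" "\<rho> (g x) \<in> K" "nrm A (l \<ominus> x) < e"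
        using approx[rule_format, OF e] by blast
      then have "dist (\<rho> (g x)) (\<rho> (g l)) < e"
        using rep_contractive[of "g l \<ominus> g x"] g l
        by (simp add: rep_diff dist_norm norm_minus_commute algebra_closed)
      then show ?thesis using x by blast
    qed
    then show ?thesis using closed_approachable[OF assms] by blast
  qed
  show "closedin (ctopology A) {x \<in> carrier A. \<rho> x \<in> K}"
    unfolding closedin_iff_approx using lim[of _ "\<lambda>x. x"] by auto
  show "closedin (ctopology A) {x \<in> carrier A. \<rho> (adj A x) \<in> K}"
    unfolding closedin_iff_approx using lim[of _ "adj A"]
    by (auto simp: adj_closed adj_diff[symmetric] nrm_adj minus_closed)
qed

lemma rep_kernel_closed_ideal: "closed_ideal A {x \<in> carrier A. \<rho> x = 0}"
proof -
  have "closedin (ctopology A) {x \<in> carrier A. \<rho> x \<in> {0}}"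
    by (rule closedin_rep_vimage) simp
  moreover have "\<rho> (c \<odot> x) = 0" if "x \<in> carrier A" "\<rho> x = 0" for c x
    using that by (intro blinfun_eqI) (simp add: rep_smult)
  ultimately show ?thesis
    by (simp add: closed_ideal_def algebra_closed rep_add rep_mult)
qed

text \<open>
  Induction over a generating set: by continuity of \<open>\<rho>\<close>, a closed algebra of operators that contains the images of
  the generators and of their adjoints contains the image of everything.
\<close>
lemma rep_generated:
  assumes gen: "generates_cstar A X" and K: "closed K" "0 \<in> K"
    and add: "\<And>S T. \<lbrakk>S \<in> K; T \<in> K\<rbrakk> \<Longrightarrow> S + T \<in> K"
    and comp: "\<And>S T. \<lbrakk>S \<in> K; T \<in> K\<rbrakk> \<Longrightarrow> S o\<^sub>L T \<in> K"
    and scale: "\<And>c S T. \<lbrakk>S \<in> K; \<And>v. blinfun_apply T v = cscale c (S v)\<rbrakk> \<Longrightarrow> T \<in> K"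
    and X: "\<And>x. x \<in> X \<Longrightarrow> \<rho> x \<in> K" "\<And>x. x \<in> X \<Longrightarrow> \<rho> (adj A x) \<in> K"
    and x: "x \<in> carrier A"
  shows "\<rho> x \<in> K"
proof -
  let ?S = "{x \<in> carrier A. \<rho> x \<in> K} \<inter> {x \<in> carrier A. \<rho> (adj A x) \<in> K}"
  have "\<rho> (c \<odot> x) \<in> K" if "x \<in> carrier A" "\<rho> x \<in> K" for c x
    by (rule scale[OF that(2), of _ c]) (simp add: rep_smult that)
  then have "closed_star_subalgebra A ?S"
    unfolding closed_star_subalgebra_def
    using closedin_rep_vimage[OF K(1)] K(2)
    by (auto simp: algebra_closed adj_add adj_mult adj_smult adj_adj rep_add rep_mult
        intro: add comp)
  moreover have "X \<subseteq> ?S" using gen X by (auto simp: generates_cstar_def)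
  ultimately have "?S = carrier A" using gen by (auto simp: generates_cstar_def)
  then show ?thesis using x by blast
qed

lemma rep_adj_eq_0:
  assumes "x \<in> carrier A" "\<rho> x = 0"
  shows "\<rho> (adj A x) = 0"
proof (rule blinfun_eqI)
  fix v
  have "inner (\<rho> (adj A x) v) (\<rho> (adj A x) v) = 0"
    using assms rep_adj[of "adj A x" v] by (simp add: adj_closed adj_adj)
  then show "\<rho> (adj A x) v = blinfun_apply 0 v" by simp
qed

lemma rep_source_eq_0:
  assumes "x \<in> carrier A" "\<rho> (adj A x \<otimes> x) = 0"
  shows "\<rho> x = 0"
proof (rule blinfun_eqI)
  fix v
  have "\<rho> (adj A x) (\<rho> x v) = 0"
    using assms by (metis rep_mult adj_closed blinfun_apply_blinfun_compose zero_blinfun.rep_eq)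
  then have "inner (\<rho> x v) (\<rho> x v) = 0"
    using assms rep_adj[of x v] by simp
  then show "\<rho> x v = blinfun_apply 0 v" by simp
qed

text \<open>
  If all vertex projections were killed, so would be every \<open>t\<^sub>\<xi>\<close>, because \<open>t\<^sub>\<xi>\<^sup>* t\<^sub>\<xi>\<close> is a vertex projection.
\<close>
lemma rep_nonzero_vertex:
  assumes family: "ck_family Q \<Lambda> A t" and gen: "generates_cstar A (t ` mor \<Lambda>)"
    and src: "\<And>\<xi>. \<xi> \<in> mor \<Lambda> \<Longrightarrow> src \<Lambda> \<xi> \<in> vertices \<Lambda>"
    and nonzero: "x \<in> carrier A" "\<rho> x \<noteq> 0"
  shows "\<exists>v\<in>vertices \<Lambda>. \<rho> (t v) \<noteq> 0"
proof (rule ccontr)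
  assume none: "\<not> ?thesis"
  have t0: "\<rho> (t \<xi>) = 0" if "\<xi> \<in> mor \<Lambda>" for \<xi>
  proof (rule rep_source_eq_0)
    show "t \<xi> \<in> carrier A" using family that by (simp add: ck_family_def)
    have "adj A (t \<xi>) \<otimes> t \<xi> = t (src \<Lambda> \<xi>)" using family that by (simp add: ck_family_def)
    then show "\<rho> (adj A (t \<xi>) \<otimes> t \<xi>) = 0" using none src[OF that] by simp
  qed
  have tc: "t \<xi> \<in> carrier A" if "\<xi> \<in> mor \<Lambda>" for \<xi> using family that by (simp add: ck_family_def)
  have "\<rho> x \<in> {0}"
    by (rule rep_generated[OF gen])
       (use tc t0 rep_adj_eq_0 nonzero in \<open>auto intro!: blinfun_eqI\<close>)
  then show False using nonzero by simp
qed

lemma rep_nonzero_path: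
  assumes family: "ck_family Q \<Lambda> A t" and v: "v \<in> vertices \<Lambda>" "\<rho> (t v) \<noteq> 0" and p: "p \<in> Q"
  shows "\<exists>\<xi>\<in>paths_into \<Lambda> v p. \<rho> (t \<xi>) \<noteq> 0"
proof (rule ccontr)
  assume none: "\<not> ?thesis"
  have c: "t \<xi> \<in> carrier A" if "\<xi> \<in> paths_into \<Lambda> v p" for \<xi>
    using family that by (auto simp: ck_family_def paths_into_def)
  have "t v = (\<Oplus>\<xi>\<in>paths_into \<Lambda> v p. t \<xi> \<otimes> adj A (t \<xi>))"
    using family v p unfolding ck_family_def by blast
  then have "\<rho> (t v) = (\<Sum>\<xi>\<in>paths_into \<Lambda> v p. \<rho> (t \<xi> \<otimes> adj A (t \<xi>)))"
    using c by (simp add: rep_finsum algebra_closed)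
  also have "\<dots> = 0" using none c by (intro sum.neutral) (auto simp: rep_mult adj_closed)
  finally show False using v by simp
qed

end

text \<open>
  Since \<open>\<theta>\<close> is surjective, \<open>\<pi> \<circ> \<theta>\<close> and \<open>\<pi>\<close> have the same operators, hence the same invariant subspaces.
\<close>
lemma irreducible_rep_comp_star_hom:
  fixes A (structure)
  assumes A: "cstar_algebra A" and \<theta>: "\<theta> \<in> star_hom A B" "\<theta> ` carrier A = carrier B"
    and \<pi>: "irreducible_rep B \<pi>"
  shows "irreducible_rep A (restrict (\<lambda>x. \<pi> (\<theta> x)) (carrier A))"
proof -
  interpret cstar_algebra A by (rule A)
  have mem: "\<theta> x \<in> carrier B" if "x \<in> carrier A" for x using that \<theta>(2) by blast
  have "representation A (restrict (\<lambda>x. \<pi> (\<theta> x)) (carrier A))"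
    using \<pi> \<theta>(1) mem
    unfolding irreducible_rep_def representation_def star_hom_def
    by (simp add: algebra_closed)
  moreover have "\<exists>x\<in>carrier A. restrict (\<lambda>x. \<pi> (\<theta> x)) (carrier A) x \<noteq> 0"
    using \<pi> \<theta>(2) unfolding irreducible_rep_def by (metis (no_types, lifting) imageE restrict_apply')
  moreover have "W = {0} \<or> W = UNIV"
    if W: "closed W" "subspace W" "\<And>c v. v \<in> W \<Longrightarrow> cscale c v \<in> W"
      and inv: "\<And>x v. \<lbrakk>x \<in> carrier A; v \<in> W\<rbrakk> \<Longrightarrow> restrict (\<lambda>x. \<pi> (\<theta> x)) (carrier A) x v \<in> W" for W
  proof -
    have "\<pi> y v \<in> W" if y: "y \<in> carrier B" and v: "v \<in> W" for y v
    proof -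
      from y \<theta>(2) obtain x where "x \<in> carrier A" "y = \<theta> x" by blast
      with inv[OF this(1) v] show ?thesis by simp
    qed
    then show ?thesis using \<pi> W unfolding irreducible_rep_def by blast
  qed
  ultimately show ?thesis unfolding irreducible_rep_def by blast
qed

text \<open>
  The representation \<open>\<pi>\<close> is \<open>\<rho>\<close> evaluated at any preimage under \<open>\<theta>\<close>.
\<close>
lemma irreducible_rep_factor:
  fixes A (structure)
  assumes A: "cstar_algebra A" and \<theta>: "\<theta> \<in> star_hom A B" "\<theta> ` carrier A = carrier B"
    and \<rho>: "irreducible_rep A \<rho>"
    and ker: "\<And>x y. \<lbrakk>x \<in> carrier A; y \<in> carrier A; \<theta> x = \<theta> y\<rbrakk> \<Longrightarrow> \<rho> x = \<rho> y"
  shows "\<exists>\<pi>. irreducible_rep B \<pi> \<and> restrict (\<lambda>x. \<pi> (\<theta> x)) (carrier A) = \<rho>"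
proof -
  interpret cstar_algebra A by (rule A)
  have rep: "representation A \<rho>" using \<rho> by (simp add: irreducible_rep_def)
  define \<pi> where "\<pi> = restrict (\<lambda>y. \<rho> (inv_into (carrier A) \<theta> y)) (carrier B)"
  have \<pi>\<theta>: "\<pi> (\<theta> x) = \<rho> x" if x: "x \<in> carrier A" for x
  proof -
    have "\<theta> x \<in> \<theta> ` carrier A" using x by blast
    then show ?thesis
      using x \<theta>(2) ker[of "inv_into (carrier A) \<theta> (\<theta> x)" x] inv_into_into[of "\<theta> x" \<theta> "carrier A"]
      by (simp add: \<pi>_def f_inv_into_f)
  qed
  have ball: "(\<forall>y\<in>carrier B. Q y) \<longleftrightarrow> (\<forall>x\<in>carrier A. Q (\<theta> x))" for Q
    unfolding \<theta>(2)[symmetric] by blast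
  have bex: "(\<exists>y\<in>carrier B. Q y) \<longleftrightarrow> (\<exists>x\<in>carrier A. Q (\<theta> x))" for Q
    unfolding \<theta>(2)[symmetric] by blast
  have hom: "\<theta> x \<oplus>\<^bsub>B\<^esub> \<theta> y = \<theta> (x \<oplus> y)" "\<theta> x \<otimes>\<^bsub>B\<^esub> \<theta> y = \<theta> (x \<otimes> y)"
    "c \<odot>\<^bsub>B\<^esub> \<theta> x = \<theta> (c \<odot> x)" "adj B (\<theta> x) = \<theta> (adj A x)"
    if "x \<in> carrier A" "y \<in> carrier A" for x y c
    using that \<theta>(1) by (auto simp: star_hom_def)
  have "representation B \<pi>"
    unfolding representation_def ball
  proof (intro conjI ballI allI)
    show "\<pi> \<in> extensional (carrier B)" by (simp add: \<pi>_def)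
  qed (use rep in \<open>simp_all add: hom \<pi>\<theta> algebra_closed representation_def\<close>)
  then have "irreducible_rep B \<pi>"
    using \<rho> unfolding irreducible_rep_def ball bex by (simp add: \<pi>\<theta>)
  moreover have "restrict (\<lambda>x. \<pi> (\<theta> x)) (carrier A) = \<rho>"
    using rep by (auto simp: representation_def \<pi>\<theta> restrict_def extensional_def)
  ultimately show ?thesis by blast
qed

section \<open>Schur's lemma in a corner\<close>
lemma blinfun_commute_iff: "S o\<^sub>L T = T o\<^sub>L S \<longleftrightarrow> (\<forall>v. S (T v) = T (S v))"
proof
  assume "S o\<^sub>L T = T o\<^sub>L S"
  then have "(S o\<^sub>L T) v = (T o\<^sub>L S) v" for v by simp
  then show "\<forall>v. S (T v) = T (S v)" by simp
qed (auto intro: blinfun_eqI)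

text \<open>
  The absolute value of a symmetric contraction \<open>R\<close>: with \<open>y\<close> the limit of the iteration for \<open>x = 1 - R\<^sup>2\<close>, the
  operator \<open>1 - y\<close> is a square root of \<open>R\<^sup>2\<close>, positive because \<open>\<parallel>y\<parallel> \<le> 1\<close>, and it commutes
  with whatever commutes with \<open>R\<close> since all iterates do.
\<close>
lemma symmetric_abs:
  fixes R :: "'h::{real_inner, banach} \<Rightarrow>\<^sub>L 'h"
  assumes sym: "\<And>v w. inner (R v) w = inner v (R w)" and norm: "norm R \<le> 1"
  obtains Q :: "'h \<Rightarrow>\<^sub>L 'h" where
    "\<And>v w. inner (Q v) w = inner v (Q w)" "\<And>v. 0 \<le> inner (Q v) v" "\<And>v. Q (Q v) = R (R v)"
    "\<And>T. T o\<^sub>L R = R o\<^sub>L T \<Longrightarrow> T o\<^sub>L Q = Q o\<^sub>L T"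
proof -
  define X where "X = id_blinfun - (R o\<^sub>L R)"
  have X: "X v = v - R (R v)" for v by (simp add: X_def blinfun.diff_left)
  have normR: "norm (R v) \<le> norm v" for v
    using norm_blinfun[of R v] mult_right_mono[OF norm norm_ge_zero[of v]] by simp
  have normX: "norm X \<le> 1"
  proof (rule norm_blinfun_bound)
    fix v
    have "(norm (X v))\<^sup>2 = (norm v)\<^sup>2 - 2 * inner (R (R v)) v + (norm (R (R v)))\<^sup>2"
      by (simp add: X power2_norm_eq_inner inner_diff_left inner_diff_right inner_commute)
    also have "inner (R (R v)) v = (norm (R v))\<^sup>2" by (simp add: sym power2_norm_eq_inner)
    also have "(norm (R (R v)))\<^sup>2 \<le> (norm (R v))\<^sup>2" using normR[of "R v"] by (intro power_mono) auto
    finally have "(norm (X v))\<^sup>2 \<le> (norm v)\<^sup>2"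
      using zero_le_power2[of "norm (R v)"] by linarith
    then have "norm (X v) \<le> norm v" by (rule power2_le_imp_le) simp
    then show "norm (X v) \<le> 1 * norm v" by simp
  qed simp
  define S where "S Y = (1/2) *\<^sub>R (X + (Y o\<^sub>L Y))" for Y
  have bound: "dist 0 (S Y) \<le> (1 + (dist 0 Y)\<^sup>2) / 2" for Y
  proof -
    have "norm (S Y) = norm (X + (Y o\<^sub>L Y)) / 2" by (simp add: S_def)
    moreover have "norm (X + (Y o\<^sub>L Y)) \<le> norm X + norm (Y o\<^sub>L Y)" by (rule norm_triangle_ineq)
    moreover have "norm (Y o\<^sub>L Y) \<le> (norm Y)\<^sup>2"
      using norm_blinfun_compose[of Y Y] by (simp only: power2_eq_square)
    ultimately show ?thesis using normX by simp
  qed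
  have lip: "dist (S Y) (S Z) \<le> (dist 0 Y + dist 0 Z) / 2 * dist Y Z" for Y Z
  proof -
    have "S Y - S Z = (1/2) *\<^sub>R ((Y o\<^sub>L (Y - Z)) + ((Y - Z) o\<^sub>L Z))"
      by (rule blinfun_eqI) (simp add: S_def blinfun.bilinear_simps algebra_simps)
    then have "dist (S Y) (S Z) = norm ((Y o\<^sub>L (Y - Z)) + ((Y - Z) o\<^sub>L Z)) / 2"
      by (simp add: dist_norm)
    also have "\<dots> \<le> (norm Y * norm (Y - Z) + norm (Y - Z) * norm Z) / 2"
      using norm_triangle_ineq[of "Y o\<^sub>L (Y - Z)" "(Y - Z) o\<^sub>L Z"]
        norm_blinfun_compose[of Y "Y - Z"] norm_blinfun_compose[of "Y - Z" Z] by simp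
    finally show ?thesis by (simp add: dist_norm algebra_simps)
  qed
  obtain Y where Y: "S Y = Y"
    and inv: "\<And>C. \<lbrakk>closed C; 0 \<in> C; \<And>Z. Z \<in> C \<Longrightarrow> S Z \<in> C\<rbrakk> \<Longrightarrow> Y \<in> C"
    using Met_TC.quadratic_iteration_fixed_point[of 0 S] bound lip
    by (auto simp: complete_UNIV)
  have normY: "norm Y \<le> 1"
  proof -
    have "Y \<in> cball 0 1"
    proof (rule inv)
      show "S Z \<in> cball 0 1" if Z: "Z \<in> cball 0 1" for Z
      proof -
        have "(norm Z)\<^sup>2 \<le> 1" using Z by (simp add: power_le_one)
        then show ?thesis using bound[of Z] by simp
      qed
    qed auto
    then show ?thesis by simp
  qed
  have symY: "inner (Y v) w = inner v (Y w)" for v w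
  proof -
    let ?K = "{Z :: 'h \<Rightarrow>\<^sub>L 'h. \<forall>v w. inner (Z v) w = inner v (Z w)}"
    have "Y \<in> ?K"
    proof (rule inv)
      show "closed ?K"
        by (intro closed_Collect_all closed_Collect_eq continuous_intros)
      show "S Z \<in> ?K" if "Z \<in> ?K" for Z
        using that by (simp add: S_def X blinfun.bilinear_simps inner_add_left inner_add_right
            inner_diff_left inner_diff_right sym)
    qed simp
    then show ?thesis by blast
  qed
  have commY: "T o\<^sub>L Y = Y o\<^sub>L T" if T: "T o\<^sub>L R = R o\<^sub>L T" for T
  proof -
    have TR: "T (R v) = R (T v)" for v using T by (simp add: blinfun_commute_iff)
    have "Y \<in> {Z. T o\<^sub>L Z = Z o\<^sub>L T}"
    proof (rule inv)
      show "closed {Z. T o\<^sub>L Z = Z o\<^sub>L T}"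
        by (intro closed_Collect_eq continuous_intros)
      show "S Z \<in> {Z. T o\<^sub>L Z = Z o\<^sub>L T}" if "Z \<in> {Z. T o\<^sub>L Z = Z o\<^sub>L T}" for Z
        using that by (simp add: blinfun_commute_iff S_def X blinfun.bilinear_simps TR)
    qed simp
    then show ?thesis by simp
  qed
  define Q where "Q = id_blinfun - Y"
  have Q: "Q v = v - Y v" for v by (simp add: Q_def blinfun.diff_left)
  have YY: "Y (Y v) = 2 *\<^sub>R Y v - v + R (R v)" for v
  proof -
    have "2 *\<^sub>R Y v = 2 *\<^sub>R S Y v" by (simp add: Y)
    also have "\<dots> = X v + Y (Y v)"
      by (simp add: S_def blinfun.bilinear_simps scaleR_add_right[symmetric])
    finally show ?thesis by (simp add: X algebra_simps)
  qed
  show thesis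
  proof (rule that[of Q])
    fix v w
    show "inner (Q v) w = inner v (Q w)" by (simp add: Q inner_diff_left inner_diff_right symY)
    have "inner (Y v) v \<le> norm (Y v) * norm v" by (rule norm_cauchy_schwarz)
    also have "\<dots> \<le> norm v * norm v"
      using norm_blinfun[of Y v] mult_right_mono[OF normY norm_ge_zero[of v]]
      by (intro mult_right_mono) auto
    finally show "0 \<le> inner (Q v) v"
      by (simp add: Q inner_diff_left power2_norm_eq_inner[symmetric] power2_eq_square)
    show "Q (Q v) = R (R v)"
      by (simp add: Q blinfun.diff_right YY algebra_simps scaleR_2)
  next
    fix T assume "T o\<^sub>L R = R o\<^sub>L T"
    then have "T o\<^sub>L Y = Y o\<^sub>L T" by (rule commY)
    then show "T o\<^sub>L Q = Q o\<^sub>L T"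
      by (simp add: blinfun_commute_iff Q blinfun.diff_right)
  qed
qed

locale irreducible_representation = cstar_algebra A for A (structure) +
  fixes \<rho> :: "_ \<Rightarrow> ('h::complex_hilbert \<Rightarrow>\<^sub>L 'h)"
  assumes irreducible: "irreducible_rep A \<rho>"

sublocale irreducible_representation \<subseteq> star_representation
  by unfold_locales (use irreducible in \<open>simp add: irreducible_rep_def\<close>)

context irreducible_representation
begin

text \<open>
  The vectors \<open>w\<close> with \<open>X \<rho>(a) w = 0\<close> for all \<open>a\<close> form a closed invariant subspace containing the range of \<open>Y\<close>. By
  irreducibility it is zero, and then \<open>Y = 0\<close>, or everything, and then \<open>X = X \<rho>(p) = 0\<close>.
\<close>
lemma irreducible_prime:
  fixes X Y :: "'h \<Rightarrow>\<^sub>L 'h"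
  assumes p: "p \<in> carrier A" "\<And>v. X (\<rho> p v) = X v"
    and linear: "\<And>c v. X (cscale c v) = cscale c (X v)"
    and XY: "\<And>a v. a \<in> carrier A \<Longrightarrow> X (\<rho> a (Y v)) = 0"
  shows "X = 0 \<or> Y = 0"
proof -
  let ?W = "{w. \<forall>a\<in>carrier A. X (\<rho> a w) = 0}"
  have "?W = (\<Inter>a\<in>carrier A. {w. X (\<rho> a w) = 0})" by auto
  moreover have "closed (\<Inter>a\<in>carrier A. {w. X (\<rho> a w) = 0})"
    by (intro closed_INT ballI closed_Collect_eq continuous_intros)
  ultimately have "closed ?W" by simp
  moreover have "subspace ?W"
    by (rule subspaceI) (auto simp: blinfun.bilinear_simps)
  moreover have "\<forall>c. \<forall>w\<in>?W. cscale c w \<in> ?W" by (simp add: rep_cscale linear)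
  moreover have "\<forall>x\<in>carrier A. \<forall>w\<in>?W. \<rho> x w \<in> ?W"
  proof (intro ballI CollectI)
    fix x w a assume "x \<in> carrier A" "w \<in> ?W" "a \<in> carrier A"
    then have "X (\<rho> (a \<otimes> x) w) = 0" by (simp add: mult_closed)
    then show "X (\<rho> a (\<rho> x w)) = 0"
      using \<open>a \<in> carrier A\<close> \<open>x \<in> carrier A\<close> by (simp add: rep_mult)
  qed
  ultimately have "?W = {0} \<or> ?W = UNIV"
    using irreducible unfolding irreducible_rep_def by blast
  then show ?thesis
  proof
    assume "?W = {0}"
    moreover have "Y v \<in> ?W" for v using XY by simp
    ultimately have "Y v = 0" for v by blast
    then have "Y = 0" by (intro blinfun_eqI) simp
    then show ?thesis ..
  next
    assume "?W = UNIV"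
    then have "X (\<rho> p w) = 0" for w using p(1) by blast
    then have "X = 0" using p(2) by (intro blinfun_eqI) simp
    then show ?thesis ..
  qed
qed

text \<open>
  Let \<open>Q\<close> be the absolute value of a rescaled \<open>R\<close>, cut down to the corner. Then \<open>(Q - R)(Q + R) = 0\<close>, and as both factors
  commute with the corner of the algebra, one of them vanishes: the rescaled \<open>R\<close> is \<open>Q\<close> or \<open>-Q\<close>.
\<close>
lemma corner_central_sign:
  fixes R :: "'h \<Rightarrow>\<^sub>L 'h"
  assumes p: "p \<in> carrier A" "p \<otimes> p = p" "adj A p = p"
    and sym: "\<And>v w. inner (R v) w = inner v (R w)"
    and linear: "\<And>c v. R (cscale c v) = cscale c (R v)"
    and corner: "\<And>v. R (\<rho> p v) = R v" "\<And>v. \<rho> p (R v) = R v"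
    and central: "\<And>a v. a \<in> carrier A \<Longrightarrow> R (\<rho> a (\<rho> p v)) = \<rho> p (\<rho> a (R v))"
  shows "(\<forall>v. 0 \<le> inner (R v) v) \<or> (\<forall>v. inner (R v) v \<le> 0)"
proof -
  define t where "t = 1 / (norm R + 1)"
  have t: "t > 0" unfolding t_def by (intro divide_pos_pos add_nonneg_pos) auto
  define R' where "R' = t *\<^sub>R R"
  have R': "R' v = t *\<^sub>R R v" for v by (simp add: R'_def blinfun.scaleR_left)
  have "norm R' = norm R / (norm R + 1)" by (simp add: R'_def t_def)
  also have "\<dots> \<le> 1" using t by (simp add: t_def divide_le_eq_1_pos)
  finally have "norm R' \<le> 1" .
  moreover have "inner (R' v) w = inner v (R' w)" for v w by (simp add: R' sym)
  ultimately obtain Q :: "'h \<Rightarrow>\<^sub>L 'h" where Q: "\<And>v w. inner (Q v) w = inner v (Q w)" "\<And>v. 0 \<le> inner (Q v) v"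
      "\<And>v. Q (Q v) = R' (R' v)" "\<And>T :: 'h \<Rightarrow>\<^sub>L 'h. T o\<^sub>L R' = R' o\<^sub>L T \<Longrightarrow> T o\<^sub>L Q = Q o\<^sub>L T"
    using symmetric_abs[of R'] by blast
  have comm: "T (Q v) = Q (T v)" if "\<And>v. T (R' v) = R' (T v)"
    for T :: "'h \<Rightarrow>\<^sub>L 'h" and v
  proof -
    have "T o\<^sub>L R' = R' o\<^sub>L T" by (rule blinfun_eqI) (simp add: that)
    then have "T o\<^sub>L Q = Q o\<^sub>L T" by (rule Q(4))
    then show ?thesis by (simp add: blinfun_commute_iff)
  qed
  let ?E = "\<rho> p"
  have EE: "?E (?E v) = ?E v" for v
    using rep_mult[OF p(1) p(1)] p(2) by (metis blinfun_apply_blinfun_compose)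
  have R'E: "R' (?E v) = R' v" "?E (R' v) = R' v" for v
    by (simp_all add: R' corner blinfun.scaleR_right)
  have QE: "?E (Q v) = Q (?E v)" for v by (rule comm) (simp add: R'E)
  have QR: "R' (Q v) = Q (R' v)" for v by (rule comm) simp
  have linR': "R' (cscale c v) = cscale c (R' v)" for c v
    by (simp add: R' linear cscale_of_real[symmetric] cscale_cscale mult.commute)
  have linQ: "Q (cscale c v) = cscale c (Q v)" for c v
    using comm[of "Blinfun (cscale c)" v]
    by (simp add: bounded_linear_Blinfun_apply bounded_linear_cscale linR')
  have QT: "?E (\<rho> a (?E (Q v))) = Q (?E (\<rho> a (?E v)))"
    and RT: "?E (\<rho> a (?E (R' v))) = R' (?E (\<rho> a (?E v)))" if a: "a \<in> carrier A" for a v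
  proof -
    have T: "?E (\<rho> a (?E (R' v))) = R' (?E (\<rho> a (?E v)))" for v
      using central[OF a, of v] by (simp add: R' corner blinfun.scaleR_right)
    then show "?E (\<rho> a (?E (R' v))) = R' (?E (\<rho> a (?E v)))" .
    show "?E (\<rho> a (?E (Q v))) = Q (?E (\<rho> a (?E v)))"
      using comm[of "?E o\<^sub>L \<rho> a o\<^sub>L ?E" v] T by simp
  qed
  have "(Q - R') o\<^sub>L ?E = 0 \<or> (Q + R') o\<^sub>L ?E = 0"
  proof (rule irreducible_prime[OF p(1)])
    show "((Q - R') o\<^sub>L ?E) (?E v) = ((Q - R') o\<^sub>L ?E) v" for v by (simp add: EE)
    show "((Q - R') o\<^sub>L ?E) (cscale c v) = cscale c (((Q - R') o\<^sub>L ?E) v)" for c v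
      by (simp add: blinfun.diff_left rep_cscale p linQ linR' cscale_diff_right)
    fix a v assume a: "a \<in> carrier A"
    have "((Q + R') o\<^sub>L ?E) v = ?E (Q v + R' v)"
      by (simp add: blinfun.add_left blinfun.add_right QE R'E)
    then have "((Q - R') o\<^sub>L ?E) (\<rho> a (((Q + R') o\<^sub>L ?E) v)) =
        Q (?E (\<rho> a (?E (Q v + R' v)))) - R' (?E (\<rho> a (?E (Q v + R' v))))"
      by (simp add: blinfun.diff_left)
    also have "\<dots> = ?E (\<rho> a (?E (Q (Q v + R' v) - R' (Q v + R' v))))"
      by (simp add: QT[OF a, symmetric] RT[OF a, symmetric] blinfun.diff_right)
    also have "Q (Q v + R' v) - R' (Q v + R' v) = 0"
      by (simp add: blinfun.add_right Q(3) QR)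
    finally show "((Q - R') o\<^sub>L ?E) (\<rho> a (((Q + R') o\<^sub>L ?E) v)) = 0" by simp
  qed
  moreover have pos: "0 \<le> inner (Q (?E v)) v" for v
  proof -
    have "inner (Q (?E v)) v = inner (?E (Q (?E v))) v" by (simp add: QE EE)
    also have "\<dots> = inner (Q (?E v)) (?E v)" using rep_adj[OF p(1)] p(3) by simp
    finally show ?thesis using Q(2)[of "?E v"] by simp
  qed
  moreover have "0 \<le> inner (R v) v" if "(Q - R') o\<^sub>L ?E = 0" for v
  proof -
    have "Q (?E v) - R' v = ((Q - R') o\<^sub>L ?E) v" by (simp add: blinfun.diff_left R'E)
    then have "Q (?E v) = t *\<^sub>R R v" by (simp add: that R')
    then show ?thesis using pos[of v] t by (simp add: zero_le_mult_iff)
  qed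
  moreover have "inner (R v) v \<le> 0" if "(Q + R') o\<^sub>L ?E = 0" for v
  proof -
    have "Q (?E v) + R' v = ((Q + R') o\<^sub>L ?E) v" by (simp add: blinfun.add_left R'E)
    then have "Q (?E v) = - (t *\<^sub>R R v)" by (simp add: that R' add_eq_0_iff2)
    then show ?thesis using pos[of v] t by (simp add: mult_le_0_iff)
  qed
  ultimately show ?thesis by blast
qed

text \<open>
  The dichotomy applies to \<open>R - r E\<close> for every real \<open>r\<close>, where \<open>E = \<rho>(p)\<close>. The reals \<open>r\<close> with \<open>R - r E \<ge> 0\<close> have
  a supremum \<open>t\<close>, and \<open>R - t E\<close> is then both nonnegative and nonpositive.
\<close>
lemma corner_central_scalar:
  fixes R :: "'h \<Rightarrow>\<^sub>L 'h"
  assumes p: "p \<in> carrier A" "p \<otimes> p = p" "adj A p = p"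
    and sym: "\<And>v w. inner (R v) w = inner v (R w)"
    and linear: "\<And>c v. R (cscale c v) = cscale c (R v)"
    and corner: "\<And>v. R (\<rho> p v) = R v" "\<And>v. \<rho> p (R v) = R v"
    and central: "\<And>a v. a \<in> carrier A \<Longrightarrow> R (\<rho> a (\<rho> p v)) = \<rho> p (\<rho> a (R v))"
  shows "\<exists>t. \<forall>v. R v = t *\<^sub>R \<rho> p v"
proof (cases "\<exists>v. \<rho> p v \<noteq> 0")
  case False
  have "R v = 0 *\<^sub>R \<rho> p v" for v using False corner(2)[of v] by simp
  then show ?thesis by blast
next
  case True
  then obtain v0 where v0: "\<rho> p v0 \<noteq> 0" by blast
  let ?E = "\<rho> p"
  have EE: "?E (?E v) = ?E v" for v
    using rep_mult[OF p(1) p(1)] p(2) by (metis blinfun_apply_blinfun_compose)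
  have symE: "inner (?E v) w = inner v (?E w)" for v w
    using rep_adj[OF p(1)] p(3) by simp
  have innerE: "inner (?E v) v = (norm (?E v))\<^sup>2" for v
    using symE[of "?E v" v] by (simp add: EE power2_norm_eq_inner)
  define L where "L = {r. \<forall>v. r * (norm (?E v))\<^sup>2 \<le> inner (R v) v}"
  have dichotomy: "r \<in> L \<or> (\<forall>v. inner (R v) v \<le> r * (norm (?E v))\<^sup>2)" for r
  proof -
    have form: "inner ((R - r *\<^sub>R ?E) v) v = inner (R v) v - r * (norm (?E v))\<^sup>2" for v
      by (simp add: blinfun.bilinear_simps inner_diff_left innerE)
    have "(\<forall>v. 0 \<le> inner ((R - r *\<^sub>R ?E) v) v) \<or> (\<forall>v. inner ((R - r *\<^sub>R ?E) v) v \<le> 0)"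
    proof (rule corner_central_sign[OF p])
      show "inner ((R - r *\<^sub>R ?E) v) w = inner v ((R - r *\<^sub>R ?E) w)" for v w
        by (simp add: blinfun.bilinear_simps inner_diff_left inner_diff_right sym symE)
      show "(R - r *\<^sub>R ?E) (cscale c v) = cscale c ((R - r *\<^sub>R ?E) v)" for c v
        by (simp add: blinfun.bilinear_simps linear rep_cscale p cscale_diff_right
            cscale_of_real[symmetric] cscale_cscale mult.commute)
    qed (simp_all add: blinfun.bilinear_simps corner EE central)
    then show ?thesis by (simp add: form L_def)
  qed
  have "- norm R \<in> L"
    unfolding L_def
  proof (intro CollectI allI)
    fix v
    have "inner (R v) v = inner (R (?E v)) (?E v)" using corner symE by metis
    moreover have "\<bar>inner (R (?E v)) (?E v)\<bar> \<le> norm R * norm (?E v) * norm (?E v)"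
      by (meson Cauchy_Schwarz_ineq2 mult_right_mono norm_blinfun norm_ge_zero order_trans)
    ultimately show "- norm R * (norm (?E v))\<^sup>2 \<le> inner (R v) v"
      by (simp add: power2_eq_square mult.assoc)
  qed
  then have ne: "L \<noteq> {}" by blast
  have upper: "r \<le> inner (R v) v / (norm (?E v))\<^sup>2" if "r \<in> L" "?E v \<noteq> 0" for r v
    using that by (simp add: L_def le_divide_eq)
  have bdd: "bdd_above L" using upper[OF _ v0] by (auto simp: bdd_above_def)
  define t where "t = Sup L"
  have form0: "inner (R v) v = t * (norm (?E v))\<^sup>2" for v
  proof (cases "?E v = 0")
    case True
    have "inner (R v) v = inner (R v) (?E v)" using corner symE by metis
    with True show ?thesis by simp
  next
    case False
    then have pos: "(norm (?E v))\<^sup>2 > 0" by simp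
    have "t \<le> inner (R v) v / (norm (?E v))\<^sup>2"
      unfolding t_def using ne upper False by (intro cSup_least) auto
    moreover have "inner (R v) v / (norm (?E v))\<^sup>2 \<le> t + e" if "e > 0" for e
    proof -
      have "t + e \<notin> L" using that cSup_upper[OF _ bdd, of "t + e"] by (auto simp: t_def)
      then have "inner (R v) v \<le> (t + e) * (norm (?E v))\<^sup>2" using dichotomy by blast
      then show ?thesis using pos by (simp add: divide_le_eq)
    qed
    then have "inner (R v) v / (norm (?E v))\<^sup>2 \<le> t" by (rule field_le_epsilon)
    ultimately show ?thesis using pos by (simp add: field_simps)
  qed
  define D where "D = R - t *\<^sub>R ?E"
  have symD: "inner (D v) w = inner v (D w)" for v w
    by (simp add: D_def blinfun.bilinear_simps inner_diff_left inner_diff_right sym symE)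
  have formD: "inner (D v) v = 0" for v
    by (simp add: D_def blinfun.bilinear_simps inner_diff_left form0 innerE)
  have "D v = 0" for v
  proof -
    have "inner (D v + D (D v)) (v + D v) = 0" using formD[of "v + D v"] by (simp add: blinfun.add_right)
    then have "inner (D v) (D v) + inner (D (D v)) v = 0"
      by (simp add: inner_add_left inner_add_right formD)
    then show ?thesis using symD[of "D v" v] by simp
  qed
  then have "R v = t *\<^sub>R ?E v" for v by (simp add: D_def blinfun.bilinear_simps)
  then show ?thesis by blast
qed

end

section \<open>The central multipliers and their character\<close>
locale irreducible_pullback = pullback_family f \<Gamma> A s + irreducible_representation A \<rho>
  for f :: "int^'k \<Rightarrow> 'g::ab_group_add" and \<Gamma> :: "('m, 'g) graded_category"
    and A :: "'a cstar" (structure) and s and \<rho> :: "'a \<Rightarrow> ('h::complex_hilbert \<Rightarrow>\<^sub>L 'h)" +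
  assumes generates: "generates_cstar A (s ` mor (pullback f \<Gamma>))"
begin

abbreviation S :: "'m \<Rightarrow> int^'k \<Rightarrow> 'h \<Rightarrow>\<^sub>L 'h" where "S \<xi> n \<equiv> \<rho> (s (\<xi>, n))"
abbreviation S' :: "'m \<Rightarrow> int^'k \<Rightarrow> 'h \<Rightarrow>\<^sub>L 'h" where "S' \<xi> n \<equiv> \<rho> (adj A (s (\<xi>, n)))"
abbreviation E :: "'m \<Rightarrow> 'h \<Rightarrow>\<^sub>L 'h" where "E v \<equiv> \<rho> (s (v, 0))"

lemma rep_mult_apply:
  "\<lbrakk>x \<in> carrier A; y \<in> carrier A; z \<in> carrier A; x \<otimes> y = z\<rbrakk> \<Longrightarrow> \<rho> x (\<rho> y \<eta>) = \<rho> z \<eta>"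
  using rep_mult[of x y] by auto

lemma E_E:
  assumes "v \<in> vertices \<Gamma>" "w \<in> vertices \<Gamma>"
  shows "E v (E w \<eta>) = (if v = w then E v \<eta> else 0)"
proof -
  have "E v (E w \<eta>) = \<rho> (s (v, 0) \<otimes> s (w, 0)) \<eta>"
    using rep_mult[OF s_vertex(1)[OF assms(1)] s_vertex(1)[OF assms(2)]] by simp
  then show ?thesis
    using s_vertex(2)[OF assms(1)] s_vertex(4)[OF assms] by (cases "v = w") auto
qed

lemma S_linear:
  assumes "\<xi> \<in> mor \<Gamma>" "n \<in> Nk" "deg \<Gamma> \<xi> = f n"
  shows "S \<xi> n (cscale c \<eta>) = cscale c (S \<xi> n \<eta>)" "S' \<xi> n (cscale c \<eta>) = cscale c (S' \<xi> n \<eta>)"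
  using assms by (simp_all add: rep_cscale s_closed adj_closed)

lemma E_S:
  assumes \<xi>: "\<xi> \<in> mor \<Gamma>" "n \<in> Nk" "deg \<Gamma> \<xi> = f n" and w: "w \<in> vertices \<Gamma>"
  shows "E w (S \<xi> n \<eta>) = (if w = rng \<Gamma> \<xi> then S \<xi> n \<eta> else 0)"
    and "S' \<xi> n (E w \<eta>) = (if w = rng \<Gamma> \<xi> then S' \<xi> n \<eta> else 0)"
    and "E w (S' \<xi> n \<eta>) = (if w = src \<Gamma> \<xi> then S' \<xi> n \<eta> else 0)"
    and "S \<xi> n (E w \<eta>) = (if w = src \<Gamma> \<xi> then S \<xi> n \<eta> else 0)"
proof -
  note c = s_closed[OF \<xi>] adj_closed[OF s_closed[OF \<xi>]]
    s_vertex(1)[OF rng_vertex[OF \<xi>(1)]] s_vertex(1)[OF src_vertex[OF \<xi>(1)]]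
  have 1: "E (rng \<Gamma> \<xi>) (S \<xi> n \<zeta>) = S \<xi> n \<zeta>" "S' \<xi> n (E (rng \<Gamma> \<xi>) \<zeta>) = S' \<xi> n \<zeta>"
    "E (src \<Gamma> \<xi>) (S' \<xi> n \<zeta>) = S' \<xi> n \<zeta>" "S \<xi> n (E (src \<Gamma> \<xi>) \<zeta>) = S \<xi> n \<zeta>" for \<zeta>
    using rep_mult_apply[OF c(3) c(1) c(1)] rep_mult_apply[OF c(2) c(3) c(2)]
      rep_mult_apply[OF c(4) c(2) c(2)] rep_mult_apply[OF c(1) c(4) c(1)] s_rng[OF \<xi>] s_src[OF \<xi>]
    by auto
  note EE = E_E[OF w rng_vertex[OF \<xi>(1)]] E_E[OF w src_vertex[OF \<xi>(1)]]
    E_E[OF rng_vertex[OF \<xi>(1)] w] E_E[OF src_vertex[OF \<xi>(1)] w]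
  show "E w (S \<xi> n \<eta>) = (if w = rng \<Gamma> \<xi> then S \<xi> n \<eta> else 0)"
    using EE(1)[of "S \<xi> n \<eta>"] 1(1)[of \<eta>] by auto
  show "E w (S' \<xi> n \<eta>) = (if w = src \<Gamma> \<xi> then S' \<xi> n \<eta> else 0)"
    using EE(2)[of "S' \<xi> n \<eta>"] 1(3)[of \<eta>] by auto
  show "S' \<xi> n (E w \<eta>) = (if w = rng \<Gamma> \<xi> then S' \<xi> n \<eta> else 0)"
    using EE(3)[of \<eta>] 1(2)[of "E w \<eta>"] 1(2)[of \<eta>] by (auto split: if_splits simp: blinfun.zero_right)
  show "S \<xi> n (E w \<eta>) = (if w = src \<Gamma> \<xi> then S \<xi> n \<eta> else 0)"
    using EE(4)[of \<eta>] 1(4)[of "E w \<eta>"] 1(4)[of \<eta>] by (auto split: if_splits simp: blinfun.zero_right)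
qed

lemma S_inner:
  assumes "\<xi> \<in> mor \<Gamma>" "n \<in> Nk" "deg \<Gamma> \<xi> = f n"
  shows "inner (S \<xi> n \<eta>) \<zeta> = inner \<eta> (S' \<xi> n \<zeta>)" "inner (S' \<xi> n \<eta>) \<zeta> = inner \<eta> (S \<xi> n \<zeta>)"
  using rep_adj[OF s_closed[OF assms]] rep_adj[OF adj_closed[OF s_closed[OF assms]]]
    adj_adj[OF s_closed[OF assms]] by auto

lemma S_comp:
  assumes "\<xi> \<in> mor \<Gamma>" "m \<in> Nk" "deg \<Gamma> \<xi> = f m" "\<eta> \<in> mor \<Gamma>" "n \<in> Nk" "deg \<Gamma> \<eta> = f n"
    and "src \<Gamma> \<xi> = rng \<Gamma> \<eta>"
  shows "S \<xi> m (S \<eta> n \<zeta>) = S (comp \<Gamma> \<xi> \<eta>) (m + n) \<zeta>"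
  by (rule rep_mult_apply)
    (use assms in \<open>auto simp: s_closed s_mult comp_in Nk_add deg_comp f_simps\<close>)

lemma S'_S:
  assumes v: "v \<in> vertices \<Gamma>" "n \<in> Nk" and \<xi>: "\<xi> \<in> paths_into \<Gamma> v (f n)"
    and \<eta>: "\<eta> \<in> paths_into \<Gamma> v (f n)"
  shows "S' \<xi> n (S \<eta> n \<zeta>) = (if \<xi> = \<eta> then E (src \<Gamma> \<eta>) \<zeta> else 0)"
proof -
  have c: "s (\<xi>, n) \<in> carrier A" "s (\<eta>, n) \<in> carrier A"
    using v \<xi> \<eta> by (auto simp: paths_into_def s_closed)
  have "S' \<xi> n (S \<eta> n \<zeta>) = \<rho> (adj A (s (\<xi>, n)) \<otimes> s (\<eta>, n)) \<zeta>"
    using c by (simp add: rep_mult adj_closed)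
  then show ?thesis
    using s_orthogonal[OF v \<xi> \<eta>] s_adj[of \<eta> n] v \<eta> by (auto simp: paths_into_def)
qed

lemma E_sum:
  assumes "v \<in> vertices \<Gamma>" "n \<in> Nk"
  shows "E v \<eta> = (\<Sum>\<xi>\<in>paths_into \<Gamma> v (f n). S \<xi> n (S' \<xi> n \<eta>))"
proof -
  have c: "s (\<xi>, n) \<in> carrier A" if "\<xi> \<in> paths_into \<Gamma> v (f n)" for \<xi>
    using that assms by (auto simp: paths_into_def s_closed)
  then have "E v = (\<Sum>\<xi>\<in>paths_into \<Gamma> v (f n). \<rho> (s (\<xi>, n) \<otimes> adj A (s (\<xi>, n))))"
    by (subst s_sum[OF assms]) (auto intro!: rep_finsum simp: algebra_closed)
  also have "\<dots> = (\<Sum>\<xi>\<in>paths_into \<Gamma> v (f n). S \<xi> n o\<^sub>L S' \<xi> n)"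
    using c by (intro sum.cong refl) (simp add: rep_mult adj_closed)
  finally show ?thesis by (simp add: blinfun.sum_left)
qed

text \<open>
  The image under \<open>\<rho>\<close> of the \<open>v\<close>-component of the multiplier attached to the pair \<open>(m, n)\<close> with \<open>f m = f n\<close>.
\<close>
definition U :: "int^'k \<Rightarrow> int^'k \<Rightarrow> 'm \<Rightarrow> 'h \<Rightarrow>\<^sub>L 'h" where
  "U m n v = (\<Sum>\<xi>\<in>paths_into \<Gamma> v (f n). S \<xi> m o\<^sub>L S' \<xi> n)"

context
  fixes m n :: "int^'k"
  assumes mn: "m \<in> Nk" "n \<in> Nk" "f m = f n"
begin

lemma U_apply: "U m n v \<eta> = (\<Sum>\<xi>\<in>paths_into \<Gamma> v (f n). S \<xi> m (S' \<xi> n \<eta>))"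
  by (simp add: U_def blinfun.sum_left)

lemma paths_degree:
  assumes "\<xi> \<in> paths_into \<Gamma> v (f n)"
  shows "\<xi> \<in> mor \<Gamma>" "deg \<Gamma> \<xi> = f m" "deg \<Gamma> \<xi> = f n" "rng \<Gamma> \<xi> = v"
  using assms mn by (auto simp: paths_into_def)

lemma U_linear: "U m n v (cscale c \<eta>) = cscale c (U m n v \<eta>)"
proof -
  have "cscale c (U m n v \<eta>) = (\<Sum>\<xi>\<in>paths_into \<Gamma> v (f n). cscale c (S \<xi> m (S' \<xi> n \<eta>)))"
    unfolding U_apply by (rule linear_sum[OF bounded_linear.linear[OF bounded_linear_cscale]])
  then show ?thesis
    unfolding U_apply using mn by (auto intro!: sum.cong simp: S_linear paths_degree)
qed

lemma E_U:
  assumes "v \<in> vertices \<Gamma>" "w \<in> vertices \<Gamma>"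
  shows "E w (U m n v \<eta>) = (if w = v then U m n v \<eta> else 0)"
proof -
  have "E w (S \<xi> m \<zeta>) = (if w = v then S \<xi> m \<zeta> else 0)" if "\<xi> \<in> paths_into \<Gamma> v (f n)" for \<xi> \<zeta>
    using E_S(1)[of \<xi> m w \<zeta>] paths_degree[OF that] mn assms by simp
  then show ?thesis unfolding U_apply by (simp add: blinfun.sum_right)
qed

lemma U_E:
  assumes "v \<in> vertices \<Gamma>" "w \<in> vertices \<Gamma>"
  shows "U m n v (E w \<eta>) = (if w = v then U m n v \<eta> else 0)"
proof -
  have "S' \<xi> n (E w \<zeta>) = (if w = v then S' \<xi> n \<zeta> else 0)" if "\<xi> \<in> paths_into \<Gamma> v (f n)" for \<xi> \<zeta>
    using E_S(2)[of \<xi> n w \<zeta>] paths_degree[OF that] mn assms by simp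
  then show ?thesis unfolding U_apply by (simp add: blinfun.zero_right)
qed

lemma U_S:
  assumes v: "v \<in> vertices \<Gamma>" and \<xi>: "\<xi> \<in> paths_into \<Gamma> v (f n)"
  shows "U m n v (S \<xi> n \<eta>) = S \<xi> m \<eta>"
proof -
  have "U m n v (S \<xi> n \<eta>) = (\<Sum>\<zeta>\<in>paths_into \<Gamma> v (f n). if \<zeta> = \<xi> then S \<xi> m (E (src \<Gamma> \<xi>) \<eta>) else 0)"
    unfolding U_apply by (intro sum.cong refl) (simp add: S'_S[OF v mn(2) _ \<xi>] blinfun.zero_right)
  also have "\<dots> = S \<xi> m (E (src \<Gamma> \<xi>) \<eta>)"
    using \<xi> finite_paths[OF v mn(2)] by simp
  also have "\<dots> = S \<xi> m \<eta>"
    using E_S(4)[of \<xi> m "src \<Gamma> \<xi>" \<eta>] paths_degree[OF \<xi>] mn src_vertex by simp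
  finally show ?thesis .
qed

text \<open>
  Expand \<open>s\<^bsub>(\<kappa>,l)\<^esub> = \<Sum> s\<^bsub>(\<kappa>\<mu>,l+n)\<^esub> s\<^bsub>(\<mu>,n)\<^esub>\<^sup>*\<close> over the paths \<open>\<mu>\<close> of degree \<open>f n\<close> with range the source of \<open>\<kappa>\<close>,
  and factor each \<open>\<kappa>\<mu>\<close> as \<open>\<alpha>\<beta>\<close> with \<open>\<alpha>\<close> of degree \<open>f n = f m\<close>. The multiplier turns the \<open>n\<close> of \<open>\<alpha>\<close> into
  an \<open>m\<close>; reading the result again as a path \<open>\<kappa>\<mu>\<close> moves this change to \<open>\<mu>\<close>.
\<close>
lemma U_intertwines:
  assumes l: "\<kappa> \<in> mor \<Gamma>" "l \<in> Nk" "deg \<Gamma> \<kappa> = f l"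
  shows "U m n (rng \<Gamma> \<kappa>) (S \<kappa> l \<eta>) = S \<kappa> l (U m n (src \<Gamma> \<kappa>) \<eta>)"
proof -
  let ?F = "paths_into \<Gamma> (src \<Gamma> \<kappa>) (f n)"
  have one: "U m n (rng \<Gamma> \<kappa>) (S \<kappa> l (S \<mu> n \<zeta>)) = S \<kappa> l (S \<mu> m \<zeta>)" if \<mu>: "\<mu> \<in> ?F" for \<mu> \<zeta>
  proof -
    note \<mu>' = paths_degree[OF \<mu>]
    let ?\<xi> = "comp \<Gamma> \<kappa> \<mu>"
    have \<xi>: "?\<xi> \<in> mor \<Gamma>" "deg \<Gamma> ?\<xi> = f n + f l"
      using comp_in[OF l(1) \<mu>'(1)] deg_comp[OF l(1) \<mu>'(1)] l(3) \<mu>'(3,4) by (simp_all add: add.commute)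
    then obtain \<alpha> \<beta> where ab: "\<alpha> \<in> mor \<Gamma>" "\<beta> \<in> mor \<Gamma>" "deg \<Gamma> \<alpha> = f n" "deg \<Gamma> \<beta> = f l"
        "src \<Gamma> \<alpha> = rng \<Gamma> \<beta>" "?\<xi> = comp \<Gamma> \<alpha> \<beta>"
      using factorE[of ?\<xi> n l] mn l by blast
    have "rng \<Gamma> \<alpha> = rng \<Gamma> ?\<xi>" using rng_comp[of \<alpha> \<beta>] ab by simp
    also have "\<dots> = rng \<Gamma> \<kappa>" using rng_comp[of \<kappa> \<mu>] l \<mu>' by simp
    finally have \<alpha>: "\<alpha> \<in> paths_into \<Gamma> (rng \<Gamma> \<kappa>) (f n)"
      using ab by (simp add: paths_into_def)
    have "S \<kappa> l (S \<mu> n \<zeta>) = S ?\<xi> (l + n) \<zeta>" using S_comp[of \<kappa> l \<mu> n \<zeta>] l \<mu>' mn by simp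
    also have "\<dots> = S \<alpha> n (S \<beta> l \<zeta>)" using S_comp[of \<alpha> n \<beta> l \<zeta>] ab l mn by (simp add: add.commute)
    finally have "U m n (rng \<Gamma> \<kappa>) (S \<kappa> l (S \<mu> n \<zeta>)) = S \<alpha> m (S \<beta> l \<zeta>)"
      using U_S[OF rng_vertex[OF l(1)] \<alpha>] by simp
    also have "\<dots> = S ?\<xi> (l + m) \<zeta>" using S_comp[of \<alpha> m \<beta> l \<zeta>] ab l mn by (simp add: add.commute)
    also have "\<dots> = S \<kappa> l (S \<mu> m \<zeta>)" using S_comp[of \<kappa> l \<mu> m \<zeta>] l \<mu>' mn by simp
    finally show ?thesis .
  qed
  have "S \<kappa> l \<eta> = S \<kappa> l (E (src \<Gamma> \<kappa>) \<eta>)"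
    using E_S(4)[OF l src_vertex[OF l(1)], of \<eta>] by simp
  also have "\<dots> = (\<Sum>\<mu>\<in>?F. S \<kappa> l (S \<mu> n (S' \<mu> n \<eta>)))"
    using E_sum[OF src_vertex[OF l(1)] mn(2)] by (simp add: blinfun.sum_right)
  finally have "U m n (rng \<Gamma> \<kappa>) (S \<kappa> l \<eta>) = (\<Sum>\<mu>\<in>?F. S \<kappa> l (S \<mu> m (S' \<mu> n \<eta>)))"
    by (simp add: blinfun.sum_right one)
  then show ?thesis by (simp add: U_apply blinfun.sum_right)
qed

end

lemma U_adj:
  assumes mn: "m \<in> Nk" "n \<in> Nk" "f m = f n"
  shows "inner (U m n v \<eta>) \<zeta> = inner \<eta> (U n m v \<zeta>)"
proof -
  have "inner (S \<xi> m (S' \<xi> n \<eta>)) \<zeta> = inner \<eta> (S \<xi> n (S' \<xi> m \<zeta>))"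
    if "\<xi> \<in> paths_into \<Gamma> v (f n)" for \<xi>
    using paths_degree[OF mn that] mn by (simp add: S_inner)
  then show ?thesis
    using U_apply[OF mn, of v \<eta>] U_apply[OF mn(2,1) mn(3)[symmetric], of v \<zeta>] mn
    by (simp add: inner_sum_left inner_sum_right)
qed

lemma U_intertwines_adj:
  assumes mn: "m \<in> Nk" "n \<in> Nk" "f m = f n" and l: "\<kappa> \<in> mor \<Gamma>" "l \<in> Nk" "deg \<Gamma> \<kappa> = f l"
  shows "U m n (src \<Gamma> \<kappa>) (S' \<kappa> l \<eta>) = S' \<kappa> l (U m n (rng \<Gamma> \<kappa>) \<eta>)"
proof -
  have nm: "n \<in> Nk" "m \<in> Nk" "f n = f m" using mn by auto
  have "inner (U m n (src \<Gamma> \<kappa>) (S' \<kappa> l \<eta>)) \<zeta> = inner (S' \<kappa> l (U m n (rng \<Gamma> \<kappa>) \<eta>)) \<zeta>" for \<zeta>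
    using U_intertwines[OF nm l, of \<zeta>] by (simp add: U_adj[OF mn] S_inner[OF l])
  then have "inner (U m n (src \<Gamma> \<kappa>) (S' \<kappa> l \<eta>) - S' \<kappa> l (U m n (rng \<Gamma> \<kappa>) \<eta>)) \<zeta> = 0" for \<zeta>
    by (simp add: inner_diff_left)
  then show ?thesis by (metis inner_eq_zero_iff eq_iff_diff_eq_0)
qed

text \<open>
  There may be infinitely many vertices, so the whole multiplier is handled through its graph: \<open>(\<eta>, \<zeta>)\<close> is in it when
  the \<open>w\<close>-component of \<open>\<zeta>\<close> is \<open>U\<^sub>w \<eta>\<close> for every vertex \<open>w\<close>. The operators that map this graph into itself form a
  closed algebra, which contains the generators and their adjoints by the intertwining relations.
\<close>
lemma U_central:
  assumes mn: "m \<in> Nk" "n \<in> Nk" "f m = f n" and v: "v \<in> vertices \<Gamma>" and w: "w \<in> vertices \<Gamma>"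
    and x: "x \<in> carrier A"
  shows "U m n w (\<rho> x (E v \<eta>)) = E w (\<rho> x (U m n v \<eta>))"
proof -
  define G where "G \<eta> \<zeta> \<longleftrightarrow> (\<forall>w\<in>vertices \<Gamma>. U m n w \<eta> = E w \<zeta>)" for \<eta> \<zeta> :: 'h
  define graph where "graph = {(\<eta>, \<zeta>). G \<eta> \<zeta>}"
  let ?K = "{T :: 'h \<Rightarrow>\<^sub>L 'h. \<forall>z\<in>graph. G (T (fst z)) (T (snd z))}"
  have "\<rho> x \<in> ?K"
  proof (rule rep_generated[OF generates _ _ _ _ _ _ _ x])
    have "?K = (\<Inter>z\<in>graph. \<Inter>w\<in>vertices \<Gamma>. {T :: 'h \<Rightarrow>\<^sub>L 'h. U m n w (T (fst z)) = E w (T (snd z))})"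
      by (auto simp: G_def)
    moreover have "closed \<dots>"
      by (intro closed_INT ballI closed_Collect_eq continuous_intros)
    ultimately show "closed ?K" by simp
    show "0 \<in> ?K" by (simp add: G_def blinfun.zero_right)
    show "T1 + T2 \<in> ?K" if "T1 \<in> ?K" "T2 \<in> ?K" for T1 T2
      using that by (simp add: G_def blinfun.add_left blinfun.add_right)
    show "T1 o\<^sub>L T2 \<in> ?K" if "T1 \<in> ?K" "T2 \<in> ?K" for T1 T2
      using that by (auto simp: graph_def)
    show "T2 \<in> ?K" if "T1 \<in> ?K" "\<And>v. blinfun_apply T2 v = cscale c (T1 v)" for c T1 T2
      using that by (simp add: G_def U_linear[OF mn] rep_cscale s_vertex)
  next
    fix y assume "y \<in> s ` mor (pullback f \<Gamma>)"
    then obtain \<kappa> l where y: "y = s (\<kappa>, l)" and l: "\<kappa> \<in> mor \<Gamma>" "l \<in> Nk" "deg \<Gamma> \<kappa> = f l"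
      by (auto simp: mor_pullback)
    have "U m n w (S \<kappa> l \<eta>) = E w (S \<kappa> l \<zeta>)" if G: "G \<eta> \<zeta>" and w: "w \<in> vertices \<Gamma>" for \<eta> \<zeta> w
    proof (cases "w = rng \<Gamma> \<kappa>")
      case True
      have "U m n (src \<Gamma> \<kappa>) \<eta> = E (src \<Gamma> \<kappa>) \<zeta>" using G src_vertex[OF l(1)] by (simp add: G_def)
      then show ?thesis
        using True U_intertwines[OF mn l, of \<eta>] E_S(1)[OF l w, of \<zeta>]
          E_S(4)[OF l src_vertex[OF l(1)], of \<zeta>] by simp
    next
      case False
      then show ?thesis
        using U_E[OF mn w w, of "S \<kappa> l \<eta>"] E_S(1)[OF l w] by (simp add: blinfun.zero_right)
    qed
    then show "\<rho> y \<in> ?K" by (simp add: y graph_def G_def)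
    have "U m n w (S' \<kappa> l \<eta>) = E w (S' \<kappa> l \<zeta>)" if G: "G \<eta> \<zeta>" and w: "w \<in> vertices \<Gamma>" for \<eta> \<zeta> w
    proof (cases "w = src \<Gamma> \<kappa>")
      case True
      have "U m n (rng \<Gamma> \<kappa>) \<eta> = E (rng \<Gamma> \<kappa>) \<zeta>" using G rng_vertex[OF l(1)] by (simp add: G_def)
      then show ?thesis
        using True U_intertwines_adj[OF mn l, of \<eta>] E_S(3)[OF l w, of \<zeta>]
          E_S(2)[OF l rng_vertex[OF l(1)], of \<zeta>] by simp
    next
      case False
      then show ?thesis
        using U_E[OF mn w w, of "S' \<kappa> l \<eta>"] E_S(3)[OF l w] by (simp add: blinfun.zero_right)
    qed
    then show "\<rho> (adj A y) \<in> ?K" by (simp add: y graph_def G_def)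
  qed
  moreover have "(E v \<eta>, U m n v \<eta>) \<in> graph"
    using U_E[OF mn _ v] E_U[OF mn v] by (simp add: graph_def G_def)
  ultimately have "G (\<rho> x (E v \<eta>)) (\<rho> x (U m n v \<eta>))" by fastforce
  then show ?thesis using w by (simp add: G_def)
qed

text \<open>
  Schur's lemma for the self-adjoint operators \<open>U + U\<^sup>*\<close> and \<open>\<i>(U - U\<^sup>*)\<close>, where \<open>U\<^sup>*\<close> belongs to the pair \<open>(n, m)\<close>.
\<close>
lemma U_scalar:
  assumes mn: "m \<in> Nk" "n \<in> Nk" "f m = f n" and v: "v \<in> vertices \<Gamma>"
  shows "\<exists>c. \<forall>\<eta>. U m n v \<eta> = cscale c (E v \<eta>)"
proof -
  have nm: "n \<in> Nk" "m \<in> Nk" "f n = f m" using mn by auto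
  define J where "J = Blinfun (cscale \<i> :: 'h \<Rightarrow> 'h)"
  have J: "J \<eta> = cscale \<i> \<eta>" for \<eta> by (simp add: J_def bounded_linear_Blinfun_apply bounded_linear_cscale)
  define R where "R = U m n v + U n m v"
  define R' where "R' = J o\<^sub>L (U m n v - U n m v)"
  have R: "R \<eta> = U m n v \<eta> + U n m v \<eta>" "R' \<eta> = cscale \<i> (U m n v \<eta> - U n m v \<eta>)" for \<eta>
    by (simp_all add: R_def R'_def J blinfun.add_left blinfun.diff_left)
  have innerJ: "inner (cscale \<i> \<eta>) \<zeta> = - inner \<eta> (cscale \<i> \<zeta>)" for \<eta> \<zeta> :: 'h
    by (simp add: Re_cinner[symmetric] cinner_cscale_left cinner_cscale_right)
  have linU: "U m n v (cscale c \<eta>) = cscale c (U m n v \<eta>)" "U n m v (cscale c \<eta>) = cscale c (U n m v \<eta>)"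
    for c \<eta> using U_linear[OF mn] U_linear[OF nm] by auto
  have cs: "cscale a (cscale b \<eta>) = cscale b (cscale a \<eta>)" for a b and \<eta> :: 'h
    by (simp add: cscale_cscale mult.commute)
  note corner = U_E[OF mn v v] U_E[OF nm v v] E_U[OF mn v v] E_U[OF nm v v]
  note central = U_central[OF mn v v] U_central[OF nm v v]
  note sv = s_vertex[OF v]
  have "\<exists>t. \<forall>\<eta>. R \<eta> = t *\<^sub>R E v \<eta>"
  proof (rule corner_central_scalar[OF sv(1-3), of R])
    show "inner (R \<eta>) \<zeta> = inner \<eta> (R \<zeta>)" for \<eta> \<zeta>
      by (simp add: R inner_add_left inner_add_right U_adj[OF mn] U_adj[OF nm])
  qed (simp_all add: R linU cscale_add_right corner central blinfun.add_right)
  then obtain t where t: "\<And>\<eta>. R \<eta> = t *\<^sub>R E v \<eta>" by blast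
  have "\<exists>t'. \<forall>\<eta>. R' \<eta> = t' *\<^sub>R E v \<eta>"
  proof (rule corner_central_scalar[OF sv(1-3), of R'])
    show "inner (R' \<eta>) \<zeta> = inner \<eta> (R' \<zeta>)" for \<eta> \<zeta>
      by (simp add: R innerJ inner_diff_left inner_diff_right U_adj[OF mn] U_adj[OF nm] linU
          cscale_diff_right)
    show "R' (cscale c \<eta>) = cscale c (R' \<eta>)" for c \<eta>
      by (simp add: R linU cscale_diff_right cs)
  qed (simp_all add: R corner central blinfun.diff_right rep_cscale sv)
  then obtain t' where t': "\<And>\<eta>. R' \<eta> = t' *\<^sub>R E v \<eta>" by blast
  have "U m n v \<eta> = cscale (complex_of_real (t / 2) - \<i> * complex_of_real (t' / 2)) (E v \<eta>)" for \<eta>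
  proof -
    have "cscale (- \<i>) (R' \<eta>) = U m n v \<eta> - U n m v \<eta>"
      by (simp add: R cscale_cscale)
    then have "2 *\<^sub>R U m n v \<eta> = R \<eta> + cscale (- \<i>) (R' \<eta>)"
      by (simp add: R scaleR_2)
    also have "\<dots> = cscale (complex_of_real t + (- \<i>) * complex_of_real t') (E v \<eta>)"
      by (simp only: t t' cscale_add_left cscale_cscale[symmetric] cscale_of_real)
    finally have "cscale (complex_of_real (1/2)) (2 *\<^sub>R U m n v \<eta>)
        = cscale (complex_of_real (1/2) * (complex_of_real t + (- \<i>) * complex_of_real t')) (E v \<eta>)"
      by (simp add: cscale_cscale)
    moreover have "complex_of_real (1/2) * (complex_of_real t + (- \<i>) * complex_of_real t')
        = complex_of_real (t / 2) - \<i> * complex_of_real (t' / 2)" by (simp add: field_simps)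
    ultimately show ?thesis by (simp only: cscale_of_real) simp
  qed
  then show ?thesis by blast
qed

lemma nonzero_vertex: "\<exists>v\<in>vertices \<Gamma>. E v \<noteq> 0"
proof -
  obtain x where "x \<in> carrier A" "\<rho> x \<noteq> 0" using irreducible by (auto simp: irreducible_rep_def)
  then have "\<exists>v\<in>vertices (pullback f \<Gamma>). \<rho> (s v) \<noteq> 0"
  proof (rule rep_nonzero_vertex[OF family generates, rotated])
    fix \<xi> assume "\<xi> \<in> mor (pullback f \<Gamma>)"
    then show "src (pullback f \<Gamma>) \<xi> \<in> vertices (pullback f \<Gamma>)"
      using vertices_pullback src_vertex by (auto simp: pullback_def)
  qed
  then show ?thesis using vertices_pullback by fastforce
qed

lemma nonzero_path:
  assumes n: "n \<in> Nk"
  obtains \<xi> \<eta> where "\<xi> \<in> mor \<Gamma>" "deg \<Gamma> \<xi> = f n" "S \<xi> n \<eta> \<noteq> 0"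
proof -
  obtain v where v: "v \<in> vertices \<Gamma>" "E v \<noteq> 0" using nonzero_vertex by blast
  then have "\<exists>x\<in>paths_into (pullback f \<Gamma>) (v, 0) n. \<rho> (s x) \<noteq> 0"
    using vertices_pullback n by (intro rep_nonzero_path[OF family]) auto
  then obtain \<xi> where \<xi>: "\<xi> \<in> paths_into \<Gamma> v (f n)" "S \<xi> n \<noteq> 0"
    using paths_into_pullback[OF n] by auto
  then obtain \<eta> where "S \<xi> n \<eta> \<noteq> 0" by (metis blinfun_eqI zero_blinfun.rep_eq)
  with \<xi> show thesis using that by (auto simp: paths_into_def)
qed

text \<open>
  The scalar at one vertex \<open>v\<close> with nonzero projection serves all vertices \<open>w\<close>: the defect \<open>U\<^sub>w - c E\<^sub>w\<close> annihilates
  \<open>\<rho>(a) E\<^sub>v\<close> for all \<open>a\<close>, since centrality moves it to the defect at \<open>v\<close>.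
\<close>
lemma same_degree_scalar:
  assumes mn: "m \<in> Nk" "n \<in> Nk" "f m = f n"
  shows "\<exists>c. \<forall>\<xi>\<in>mor \<Gamma>. deg \<Gamma> \<xi> = f n \<longrightarrow> (\<forall>\<eta>. S \<xi> m \<eta> = cscale c (S \<xi> n \<eta>))"
proof -
  obtain v where v: "v \<in> vertices \<Gamma>" "E v \<noteq> 0" using nonzero_vertex by blast
  obtain c where c: "\<And>\<eta>. U m n v \<eta> = cscale c (E v \<eta>)" using U_scalar[OF mn v(1)] by blast
  define C where "C = Blinfun (cscale c :: 'h \<Rightarrow> 'h)"
  have C: "C \<eta> = cscale c \<eta>" for \<eta> by (simp add: C_def bounded_linear_Blinfun_apply bounded_linear_cscale)
  have Uw: "U m n w \<eta> = cscale c (E w \<eta>)" if w: "w \<in> vertices \<Gamma>" for w \<eta>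
  proof -
    let ?X = "U m n w - (C o\<^sub>L E w)"
    have X: "?X \<eta> = U m n w \<eta> - cscale c (E w \<eta>)" for \<eta> by (simp add: blinfun.diff_left C)
    have "?X = 0 \<or> E v = 0"
    proof (rule irreducible_prime[OF s_vertex(1)[OF w]])
      show "?X (E w \<eta>) = ?X \<eta>" for \<eta> unfolding X by (simp add: U_E[OF mn w w] E_E w)
      show "?X (cscale b \<eta>) = cscale b (?X \<eta>)" for b \<eta>
        unfolding X by (simp add: U_linear[OF mn] rep_cscale s_vertex w cscale_diff_right
            cscale_cscale mult.commute)
      show "?X (\<rho> a (E v \<eta>)) = 0" if a: "a \<in> carrier A" for a \<eta>
        unfolding X by (simp add: U_central[OF mn v(1) w a] c rep_cscale a s_vertex w)
    qed
    then have "?X \<eta> = 0" using v(2) by simp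
    then show ?thesis unfolding X by simp
  qed
  have "S \<xi> m \<eta> = cscale c (S \<xi> n \<eta>)" if \<xi>: "\<xi> \<in> mor \<Gamma>" "deg \<Gamma> \<xi> = f n" for \<xi> \<eta>
  proof -
    have "\<xi> \<in> paths_into \<Gamma> (rng \<Gamma> \<xi>) (f n)" using \<xi> by (simp add: paths_into_def)
    then show ?thesis
      using U_S[OF mn rng_vertex[OF \<xi>(1)], of \<xi> \<eta>] Uw[OF rng_vertex[OF \<xi>(1)], of "S \<xi> n \<eta>"]
        E_S(1)[OF \<xi>(1) mn(2) \<xi>(2) rng_vertex[OF \<xi>(1)], of \<eta>] by simp
  qed
  then show ?thesis by blast
qed

lemma norm_S:
  assumes \<xi>: "\<xi> \<in> mor \<Gamma>" "n \<in> Nk" "deg \<Gamma> \<xi> = f n"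
  shows "(norm (S \<xi> n \<eta>))\<^sup>2 = inner \<eta> (E (src \<Gamma> \<xi>) \<eta>)"
proof -
  have "S' \<xi> n (S \<xi> n \<eta>) = E (src \<Gamma> \<xi>) \<eta>"
    by (rule rep_mult_apply) (use \<xi> in \<open>auto simp: s_closed adj_closed s_adj s_vertex src_vertex\<close>)
  then show ?thesis by (simp add: power2_norm_eq_inner S_inner[OF \<xi>])
qed

text \<open>
  The scalar depends only on \<open>m - n\<close>: if \<open>m - n = m\<^sub>0 - n\<^sub>0\<close>, a path of degree \<open>f (n\<^sub>0 + n)\<close> splits into pieces of degrees \<open>f n\<^sub>0\<close>
  and \<open>f n\<close>, and raising \<open>n\<^sub>0\<close> to \<open>m\<^sub>0\<close> in the first or \<open>n\<close> to \<open>m\<close> in the second gives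
  the same element. It has modulus one because \<open>s\<^bsub>(\<xi>,m)\<^esub>\<close> and \<open>s\<^bsub>(\<xi>,n)\<^esub>\<close> have the same source projection.
\<close>
lemma kernel_scalar:
  assumes h: "f h = 0"
  shows "\<exists>c. cmod c = 1 \<and> (\<forall>m\<in>Nk. \<forall>n\<in>Nk. m - n = h \<longrightarrow>
    (\<forall>\<xi>\<in>mor \<Gamma>. deg \<Gamma> \<xi> = f n \<longrightarrow> (\<forall>\<eta>. S \<xi> m \<eta> = cscale c (S \<xi> n \<eta>))))"
proof -
  obtain m0 n0 where 0: "m0 \<in> Nk" "n0 \<in> Nk" "h = m0 - n0" by (rule diff_of_Nk)
  then have f0: "f m0 = f n0" using h by (simp add: f_simps)
  obtain c where c: "\<And>\<xi> \<eta>. \<lbrakk>\<xi> \<in> mor \<Gamma>; deg \<Gamma> \<xi> = f n0\<rbrakk> \<Longrightarrow> S \<xi> m0 \<eta> = cscale c (S \<xi> n0 \<eta>)"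
    using same_degree_scalar[OF 0(1,2) f0] by blast
  have "cmod c = 1"
  proof -
    obtain \<xi> \<eta> where \<xi>: "\<xi> \<in> mor \<Gamma>" "deg \<Gamma> \<xi> = f n0" "S \<xi> n0 \<eta> \<noteq> 0" using nonzero_path[OF 0(2)] .
    have "(norm (S \<xi> m0 \<eta>))\<^sup>2 = (norm (S \<xi> n0 \<eta>))\<^sup>2"
      using \<xi> 0 f0 by (simp add: norm_S)
    then have "cmod c * norm (S \<xi> n0 \<eta>) = norm (S \<xi> n0 \<eta>)" using c[OF \<xi>(1,2), of \<eta>] by simp
    then show ?thesis using \<xi>(3) by simp
  qed
  moreover have "S \<xi> m \<eta> = cscale c (S \<xi> n \<eta>)"
    if mn: "m \<in> Nk" "n \<in> Nk" "m - n = h" and \<xi>: "\<xi> \<in> mor \<Gamma>" "deg \<Gamma> \<xi> = f n" for m n \<xi> \<eta>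
  proof -
    have fmn: "f m = f n" using f_simps(3)[of m n] mn(3) h by simp
    obtain d where d: "\<And>\<xi> \<eta>. \<lbrakk>\<xi> \<in> mor \<Gamma>; deg \<Gamma> \<xi> = f n\<rbrakk> \<Longrightarrow> S \<xi> m \<eta> = cscale d (S \<xi> n \<eta>)"
      using same_degree_scalar[OF mn(1,2) fmn] by blast
    obtain \<zeta> \<theta> where \<zeta>: "\<zeta> \<in> mor \<Gamma>" "deg \<Gamma> \<zeta> = f (n0 + n)" "S \<zeta> (n0 + n) \<theta> \<noteq> 0"
      using nonzero_path[OF Nk_add[OF 0(2) mn(2)]] .
    obtain \<alpha> \<beta> where ab: "\<alpha> \<in> mor \<Gamma>" "\<beta> \<in> mor \<Gamma>" "deg \<Gamma> \<alpha> = f n0" "deg \<Gamma> \<beta> = f n"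
        "src \<Gamma> \<alpha> = rng \<Gamma> \<beta>" "\<zeta> = comp \<Gamma> \<alpha> \<beta>"
      using factorE[OF \<zeta>(1) 0(2) mn(2)] \<zeta>(2) by (auto simp: f_simps)
    have SS: "S \<zeta> (a + b) \<theta> = S \<alpha> a (S \<beta> b \<theta>)" if "a \<in> Nk" "b \<in> Nk" "f a = f n0" "f b = f n" for a b
      using S_comp[of \<alpha> a \<beta> b \<theta>] ab that by simp
    have "cscale c (S \<zeta> (n0 + n) \<theta>) = S \<zeta> (m0 + n) \<theta>"
      using SS[OF 0(2) mn(2)] SS[OF 0(1) mn(2) f0] c[OF ab(1,3)] by simp
    also have "m0 + n = n0 + m" using mn(3) 0(3) by (simp add: algebra_simps)
    also have "S \<zeta> (n0 + m) \<theta> = cscale d (S \<zeta> (n0 + n) \<theta>)"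
      using SS[OF 0(2) mn(2)] SS[OF 0(2) mn(1) _ fmn] d[OF ab(2,4)] S_linear(1)[OF ab(1) 0(2) ab(3)]
      by simp
    finally have "c = d" using \<zeta>(3) by (rule cscale_cancel)
    then show ?thesis using d[OF \<xi>] by simp
  qed
  ultimately show ?thesis by blast
qed

lemma exists_character:
  obtains \<gamma> where "\<gamma> \<in> characters {h. f h = 0}"
    "\<And>m n \<xi> \<eta>. \<lbrakk>m \<in> Nk; n \<in> Nk; f m = f n; \<xi> \<in> mor \<Gamma>; deg \<Gamma> \<xi> = f n\<rbrakk>
      \<Longrightarrow> S \<xi> m \<eta> = cscale (\<gamma> (m - n)) (S \<xi> n \<eta>)"
proof -
  define Q where "Q h c \<longleftrightarrow> cmod c = 1 \<and> (\<forall>m\<in>Nk. \<forall>n\<in>Nk. m - n = h \<longrightarrow>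
    (\<forall>\<xi>\<in>mor \<Gamma>. deg \<Gamma> \<xi> = f n \<longrightarrow> (\<forall>\<eta>. S \<xi> m \<eta> = cscale c (S \<xi> n \<eta>))))" for h c
  define C where "C h = (SOME c. Q h c)" for h
  have Q: "Q h (C h)" if "f h = 0" for h
    unfolding C_def using kernel_scalar[OF that] unfolding Q_def[symmetric] by (rule someI_ex)
  have C: "cmod (C h) = 1" if "f h = 0" for h using Q[OF that] by (simp add: Q_def)
  have CS': "S \<xi> m \<eta> = cscale (C (m - n)) (S \<xi> n \<eta>)"
    if "m \<in> Nk" "n \<in> Nk" "f m = f n" "\<xi> \<in> mor \<Gamma>" "deg \<Gamma> \<xi> = f n" for m n \<xi> \<eta>
  proof -
    have "Q (m - n) (C (m - n))" using that(3) by (intro Q) (simp add: f_simps)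
    then show ?thesis using that by (simp add: Q_def)
  qed
  have mult: "C (g + h) = C g * C h" if g: "f g = 0" and h: "f h = 0" for g h
  proof -
    obtain m1 n1 where 1: "m1 \<in> Nk" "n1 \<in> Nk" "g = m1 - n1" by (rule diff_of_Nk)
    obtain m2 n2 where 2: "m2 \<in> Nk" "n2 \<in> Nk" "h = m2 - n2" by (rule diff_of_Nk)
    have f12: "f m1 = f n1" "f m2 = f n2" using 1 2 g h by (auto simp: f_simps)
    obtain \<xi> \<eta> where \<xi>: "\<xi> \<in> mor \<Gamma>" "deg \<Gamma> \<xi> = f (n1 + n2)" "S \<xi> (n1 + n2) \<eta> \<noteq> 0"
      using nonzero_path[OF Nk_add[OF 1(2) 2(2)]] .
    have deg: "deg \<Gamma> \<xi> = f n1 + f n2" using \<xi> by (simp add: f_simps)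
    \<comment> \<open>Both elements of \<open>H\<close> are realised on one path: \<open>g + h\<close> takes \<open>n1 + n2\<close> to \<open>m1 + m2\<close>, passing through \<open>n1 + m2\<close>.\<close>
    have gh: "m1 + m2 - (n1 + n2) = g + h" unfolding 1(3) 2(3) by (simp only: add_diff_add)
    have "S \<xi> (m1 + m2) \<eta> = cscale (C (m1 + m2 - (n1 + n2))) (S \<xi> (n1 + n2) \<eta>)"
      by (rule CS') (use 1 2 f12 \<xi>(1) deg in \<open>auto simp: Nk_add f_simps\<close>)
    then have "cscale (C (g + h)) (S \<xi> (n1 + n2) \<eta>) = S \<xi> (m1 + m2) \<eta>"
      unfolding gh by (rule sym)
    also have "\<dots> = cscale (C g) (S \<xi> (n1 + m2) \<eta>)"
      using CS'[of "m1 + m2" "n1 + m2" \<xi> \<eta>] 1 2 f12 \<xi>(1) deg by (simp add: Nk_add f_simps)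
    also have "S \<xi> (n1 + m2) \<eta> = cscale (C h) (S \<xi> (n1 + n2) \<eta>)"
      using CS'[of "n1 + m2" "n1 + n2" \<xi> \<eta>] 1 2 f12 \<xi>(1) deg by (simp add: Nk_add f_simps)
    finally have "cscale (C (g + h)) (S \<xi> (n1 + n2) \<eta>) = cscale (C g * C h) (S \<xi> (n1 + n2) \<eta>)"
      by (simp only: cscale_cscale)
    then show ?thesis using \<xi>(3) by (rule cscale_cancel)
  qed
  show thesis
  proof (rule that[of "restrict C {h. f h = 0}"])
    show "restrict C {h. f h = 0} \<in> characters {h. f h = 0}"
      using C mult by (auto simp: characters_def f_simps)
    show "S \<xi> m \<eta> = cscale (restrict C {h. f h = 0} (m - n)) (S \<xi> n \<eta>)"
      if "m \<in> Nk" "n \<in> Nk" "f m = f n" "\<xi> \<in> mor \<Gamma>" "deg \<Gamma> \<xi> = f n" for m n \<xi> \<eta>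
      unfolding CS'[OF that] using that(3) by (simp add: f_simps)
  qed
qed

end

section \<open>The bijection\<close>

text \<open>
  For such \<open>z\<close> the relation \<open>\<rho>(s\<^bsub>(\<xi>,m)\<^esub>) = z\<^bsup>m-n\<^esup> \<rho>(s\<^bsub>(\<xi>,n)\<^esub>)\<close> says that the kernel of \<open>\<rho>\<close>, a closed ideal,
  contains the generators of \<open>I\<^sub>z\<close>.
\<close>
lemma (in irreducible_pullback) kernel_contains_ideal_z:
  obtains \<gamma> where "\<gamma> \<in> characters {h. f h = 0}"
    "\<And>z x. \<lbrakk>z \<in> torus; \<And>h. f h = 0 \<Longrightarrow> zpow z h = \<gamma> h; x \<in> ideal_z f \<Gamma> A s z\<rbrakk> \<Longrightarrow> \<rho> x = 0"
proof -
  obtain \<gamma> where \<gamma>: "\<gamma> \<in> characters {h. f h = 0}"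
    and S\<gamma>: "\<And>m n \<xi> \<eta>. \<lbrakk>m \<in> Nk; n \<in> Nk; f m = f n; \<xi> \<in> mor \<Gamma>; deg \<Gamma> \<xi> = f n\<rbrakk>
      \<Longrightarrow> S \<xi> m \<eta> = cscale (\<gamma> (m - n)) (S \<xi> n \<eta>)"
    using exists_character by blast
  have "\<rho> x = 0"
    if z: "z \<in> torus" "\<And>h. f h = 0 \<Longrightarrow> zpow z h = \<gamma> h" and x: "x \<in> ideal_z f \<Gamma> A s z" for z x
  proof -
    have "ideal_z f \<Gamma> A s z \<subseteq> {x \<in> carrier A. \<rho> x = 0}"
      unfolding ideal_z_def
    proof (rule ideal_generated_subset[OF rep_kernel_closed_ideal], rule subsetI)
      fix y assume "y \<in> {(zpow z (- m) \<odot> s (\<xi>, m)) \<ominus> (zpow z (- n) \<odot> s (\<xi>, n)) | \<xi> m n.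
        \<xi> \<in> mor \<Gamma> \<and> m \<in> Nk \<and> n \<in> Nk \<and> f m = deg \<Gamma> \<xi> \<and> f n = deg \<Gamma> \<xi>}"
      then obtain \<xi> m n where \<xi>: "\<xi> \<in> mor \<Gamma>" "m \<in> Nk" "n \<in> Nk" "f m = deg \<Gamma> \<xi>" "f n = deg \<Gamma> \<xi>"
        and y: "y = (zpow z (- m) \<odot> s (\<xi>, m)) \<ominus> (zpow z (- n) \<odot> s (\<xi>, n))" by blast
      have c: "s (\<xi>, m) \<in> carrier A" "s (\<xi>, n) \<in> carrier A" using \<xi> by (simp_all add: s_closed)
      have "zpow z (m - n) = \<gamma> (m - n)" using \<xi> by (intro z(2)) (simp add: f_simps)
      then have zz: "zpow z (- m) * \<gamma> (m - n) = zpow z (- n)"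
        using zpow_add[OF z(1), of "- m" "m - n"] by simp
      have "zpow z (- m) \<odot> s (\<xi>, m) \<in> carrier A" "zpow z (- n) \<odot> s (\<xi>, n) \<in> carrier A"
        using c by (simp_all add: smult_closed)
      moreover have "\<rho> (zpow z (- m) \<odot> s (\<xi>, m)) = \<rho> (zpow z (- n) \<odot> s (\<xi>, n))"
      proof (rule blinfun_eqI)
        fix \<eta>
        have "S \<xi> m \<eta> = cscale (\<gamma> (m - n)) (S \<xi> n \<eta>)" using \<xi> by (intro S\<gamma>) auto
        then show "\<rho> (zpow z (- m) \<odot> s (\<xi>, m)) \<eta> = \<rho> (zpow z (- n) \<odot> s (\<xi>, n)) \<eta>"
          using c by (simp add: rep_smult cscale_cscale zz)
      qed
      ultimately show "y \<in> {x \<in> carrier A. \<rho> x = 0}" unfolding y by (simp add: rep_diff minus_closed)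
    qed
    then show ?thesis using x by blast
  qed
  with \<gamma> show thesis using that by blast
qed

theorem theorem3p5:
  fixes f :: "int^'k \<Rightarrow> 'g::ab_group_add"
    and P :: "'g set"
    and H :: "(int^'k) set"
    and \<Gamma> :: "('m, 'g) graded_category"
    and A :: "'a cstar" and s :: "'m \<times> (int^'k) \<Rightarrow> 'a"
    and B :: "'b cstar" and t :: "'m \<Rightarrow> 'b"
    and q :: "complex^'k \<Rightarrow> 'a \<Rightarrow> 'a set"
    and \<psi> :: "complex^'k \<Rightarrow> 'a set \<Rightarrow> 'b"
    and pull :: "complex^'k \<Rightarrow> ('b \<Rightarrow> ('h::complex_hilbert \<Rightarrow>\<^sub>L 'h)) \<Rightarrow> ('a \<Rightarrow> ('h \<Rightarrow>\<^sub>L 'h))"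
  assumes G: "finitely_generated_group TYPE('g)"
    and f: "Modules.additive f"
    and P: "P = f ` Nk"
    and H: "H = {h. f h = 0}"
    and graph: "P_graph P \<Gamma>" "row_finite_no_sources P \<Gamma>"
    and A: "universal_ck_algebra Nk (pullback f \<Gamma>) A s"
    and B: "universal_ck_algebra P \<Gamma> B t"
    and q: "\<And>z. z \<in> torus \<Longrightarrow> q z = quot_map A (ideal_z f \<Gamma> A s z)"
    and \<psi>_iso: "\<And>z. z \<in> torus \<Longrightarrow> \<psi> z \<in> star_iso (quotient_cstar A (ideal_z f \<Gamma> A s z)) B"
    and \<psi>_gen: "\<And>z \<xi> n. \<lbrakk>z \<in> torus; (\<xi>, n) \<in> mor (pullback f \<Gamma>)\<rbrakk>
                  \<Longrightarrow> \<psi> z (q z (s (\<xi>, n))) = zpow z n \<odot>\<^bsub>B\<^esub> t \<xi>"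
    and pull: "\<And>z \<pi>. pull z \<pi> = restrict (\<pi> \<circ> \<psi> z \<circ> q z) (carrier A)"
  shows "(\<forall>z\<in>torus. \<forall>\<pi>\<in>Irr B. pull z \<pi> \<in> Irr A) \<and>
         (\<forall>zz :: (int^'k \<Rightarrow> complex) \<Rightarrow> complex^'k.
            (\<forall>\<gamma>\<in>characters H. zz \<gamma> \<in> torus \<and> (\<forall>h\<in>H. zpow (zz \<gamma>) h = \<gamma> h)) \<longrightarrow>
            bij_betw (\<lambda>(\<gamma>, \<pi>). pull (zz \<gamma>) \<pi>) (characters H \<times> Irr B) (Irr A))"
proof -
  have cA: "cstar_algebra A" and famA: "ck_family Nk (pullback f \<Gamma>) A s"
    and genA: "generates_cstar A (s ` mor (pullback f \<Gamma>))"
    and cB: "cstar_algebra B" and famB: "ck_family P \<Gamma> B t" and genB: "generates_cstar B (t ` mor \<Gamma>)"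
    using A B by (simp_all add: universal_ck_algebra_def)
  have pf: "pullback_family f \<Gamma> A s"
    using f graph cA famA
    by (simp add: pullback_family_def pullback_family_axioms_def pullback_graph_def
        pullback_graph_axioms_def P)
  interpret pullback_family f \<Gamma> A s by (rule pf)
  define \<theta> where "\<theta> z x = \<psi> z (q z x)" for z x
  have \<theta>: "\<theta> z \<in> star_hom A B" "\<theta> z ` carrier A = carrier B"
    "\<And>x y. \<lbrakk>x \<in> carrier A; y \<in> carrier A\<rbrakk> \<Longrightarrow> \<theta> z x = \<theta> z y \<longleftrightarrow> x \<ominus>\<^bsub>A\<^esub> y \<in> ideal_z f \<Gamma> A s z"
    if z: "z \<in> torus" for z
  proof -
    interpret selfadjoint_ideal A "ideal_z f \<Gamma> A s z" by (rule ideal_z_selfadjoint[OF z])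
    have "\<theta> z = (\<lambda>x. \<psi> z (quot_map A (ideal_z f \<Gamma> A s z) x))" by (simp add: fun_eq_iff \<theta>_def q z)
    then show "\<theta> z \<in> star_hom A B" "\<theta> z ` carrier A = carrier B"
      "\<And>x y. \<lbrakk>x \<in> carrier A; y \<in> carrier A\<rbrakk> \<Longrightarrow> \<theta> z x = \<theta> z y \<longleftrightarrow> x \<ominus>\<^bsub>A\<^esub> y \<in> ideal_z f \<Gamma> A s z"
      using star_iso_quot_map[OF \<psi>_iso[OF z]] by simp_all
  qed
  have pull\<theta>: "pull z \<pi> = restrict (\<lambda>x. \<pi> (\<theta> z x)) (carrier A)" for z \<pi>
    by (simp add: pull \<theta>_def o_def)
  have irr: "pull z \<pi> \<in> Irr A" if "z \<in> torus" "\<pi> \<in> Irr B" for z \<pi>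
    using irreducible_rep_comp_star_hom[OF cA \<theta>(1,2)[OF that(1)]] that by (simp add: Irr_def pull\<theta>)
  have "bij_betw (\<lambda>(\<gamma>, \<pi>). pull (zz \<gamma>) \<pi>) (characters H \<times> Irr B) (Irr A)"
    if zz: "\<forall>\<gamma>\<in>characters H. zz \<gamma> \<in> torus \<and> (\<forall>h\<in>H. zpow (zz \<gamma>) h = \<gamma> h)"
    for zz :: "(int^'k \<Rightarrow> complex) \<Rightarrow> complex^'k"
    unfolding bij_betw_def
  proof (intro conjI inj_onI equalityI subsetI)
    fix x y
    assume xy: "x \<in> characters H \<times> Irr B" "y \<in> characters H \<times> Irr B"
      "(\<lambda>(\<gamma>, \<pi>). pull (zz \<gamma>) \<pi>) x = (\<lambda>(\<gamma>, \<pi>). pull (zz \<gamma>) \<pi>) y"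
    obtain \<gamma> \<pi> where x: "x = (\<gamma>, \<pi>)" "\<gamma> \<in> characters H" "\<pi> \<in> Irr B" using xy by auto
    obtain \<gamma>' \<pi>' where y: "y = (\<gamma>', \<pi>')" "\<gamma>' \<in> characters H" "\<pi>' \<in> Irr B" using xy by auto
    define z where "z = zz \<gamma>"
    define z' where "z' = zz \<gamma>'"
    have z: "z \<in> torus" "z' \<in> torus" using zz x y by (auto simp: z_def z'_def)
    have eq: "\<pi> (\<theta> z a) = \<pi>' (\<theta> z' a)" if "a \<in> carrier A" for a
      using fun_cong[OF xy(3), of a] that by (simp add: x(1) y(1) pull\<theta> z_def z'_def)
    interpret B: star_representation B \<pi>
      using cB x(3) by (simp add: star_representation_def star_representation_axioms_def
          Irr_def irreducible_rep_def)
    interpret B': star_representation B \<pi>'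
      using cB y(3) by (simp add: star_representation_def star_representation_axioms_def
          Irr_def irreducible_rep_def)
    have tB: "t \<xi> \<in> carrier B" if "\<xi> \<in> mor \<Gamma>" for \<xi> using famB that by (simp add: ck_family_def)
    have gen_eq: "cscale (zpow z n) (\<pi> (t \<xi>) \<eta>) = cscale (zpow z' n) (\<pi>' (t \<xi>) \<eta>)"
      if \<xi>: "\<xi> \<in> mor \<Gamma>" "n \<in> Nk" "deg \<Gamma> \<xi> = f n" for \<xi> n \<eta>
    proof -
      have "(\<xi>, n) \<in> mor (pullback f \<Gamma>)" using \<xi> by (simp add: mor_pullback)
      then have "\<theta> z (s (\<xi>, n)) = zpow z n \<odot>\<^bsub>B\<^esub> t \<xi>" "\<theta> z' (s (\<xi>, n)) = zpow z' n \<odot>\<^bsub>B\<^esub> t \<xi>"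
        using \<psi>_gen z by (simp_all add: \<theta>_def)
      then have "\<pi> (zpow z n \<odot>\<^bsub>B\<^esub> t \<xi>) = \<pi>' (zpow z' n \<odot>\<^bsub>B\<^esub> t \<xi>)"
        using eq[OF s_closed[OF \<xi>]] by simp
      then show ?thesis using B.rep_smult[OF tB[OF \<xi>(1)]] B'.rep_smult[OF tB[OF \<xi>(1)]] by metis
    qed
    obtain b where "b \<in> carrier B" "\<pi> b \<noteq> 0" using x(3) by (auto simp: Irr_def irreducible_rep_def)
    then obtain v where v: "v \<in> vertices \<Gamma>" "\<pi> (t v) \<noteq> 0"
      using B.rep_nonzero_vertex[OF famB genB src_vertex] by blast
    \<comment> \<open>Both representations agree on \<open>s\<^bsub>(\<xi>,m)\<^esub>\<close> and \<open>s\<^bsub>(\<xi>,n)\<^esub>\<close>; on a vector where \<open>\<pi>(t\<^sub>\<xi>)\<close> is nonzero the two equations leave \<open>z\<^bsup>m-n\<^esup> = z'\<^bsup>m-n\<^esup>\<close>.\<close>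
    have zpow_eq: "\<gamma> h = \<gamma>' h" if h: "h \<in> H" for h
    proof -
      obtain m n where mn: "m \<in> Nk" "n \<in> Nk" "h = m - n" by (rule diff_of_Nk)
      then have fmn: "f m = f n" using h by (simp add: H f_simps)
      have "f n \<in> P" using mn by (simp add: P)
      then obtain \<xi> where \<xi>: "\<xi> \<in> paths_into \<Gamma> v (f n)" "\<pi> (t \<xi>) \<noteq> 0"
        using B.rep_nonzero_path[OF famB v] by blast
      then obtain \<eta> where \<eta>: "\<pi> (t \<xi>) \<eta> \<noteq> 0" by (metis blinfun_eqI zero_blinfun.rep_eq)
      let ?u = "\<pi> (t \<xi>) \<eta>" and ?u' = "\<pi>' (t \<xi>) \<eta>"
      have e: "cscale (zpow z m) ?u = cscale (zpow z' m) ?u'"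
        "cscale (zpow z n) ?u = cscale (zpow z' n) ?u'"
        using gen_eq[of \<xi> m \<eta>] gen_eq[of \<xi> n \<eta>] paths_intoD[OF \<xi>(1)] mn fmn by simp_all
      have "norm (cscale (zpow z n) ?u) \<noteq> 0" using \<eta> by (simp add: cmod_zpow[OF z(1)])
      then have nz: "cscale (zpow z n) ?u \<noteq> 0" by (metis norm_zero)
      have "cscale (zpow z' h) (cscale (zpow z n) ?u) = cscale (zpow z' m) ?u'"
        unfolding e(2) using zpow_diff[OF z(2), of m n] by (simp add: mn(3) cscale_cscale)
      also have "\<dots> = cscale (zpow z h) (cscale (zpow z n) ?u)"
        unfolding e(1)[symmetric] using zpow_diff[OF z(1), of m n] by (simp add: mn(3) cscale_cscale)
      finally have "zpow z' h = zpow z h"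
        using nz by (rule cscale_cancel)
      then show ?thesis using zz x y h by (simp add: z_def z'_def)
    qed
    have "\<gamma> = \<gamma>'"
      by (rule PiE_ext[where k = H and s = "\<lambda>_. sphere 0 1"]) (use x y zpow_eq in \<open>auto simp: characters_def\<close>)
    then have "z = z'" by (simp add: z_def z'_def)
    have "\<pi> c = \<pi>' c" if c: "c \<in> carrier B" for c
    proof -
      have "c \<in> \<theta> z ` carrier A" using c \<theta>(2)[OF z(1)] by simp
      then obtain a where "a \<in> carrier A" "c = \<theta> z a" by blast
      then show ?thesis using eq[of a] \<open>z = z'\<close> by simp
    qed
    then have "\<pi> = \<pi>'"
      using B.representation B'.representation
      by (intro extensionalityI[of \<pi> "carrier B" \<pi>']) (auto simp: representation_def)
    with \<open>\<gamma> = \<gamma>'\<close> show "x = y" by (simp add: x y)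
  next
    fix \<rho> assume "\<rho> \<in> (\<lambda>(\<gamma>, \<pi>). pull (zz \<gamma>) \<pi>) ` (characters H \<times> Irr B)"
    then show "\<rho> \<in> Irr A" using irr zz by auto
  next
    fix \<rho> :: "'a \<Rightarrow> 'h \<Rightarrow>\<^sub>L 'h" assume \<rho>: "\<rho> \<in> Irr A"
    interpret irreducible_pullback f \<Gamma> A s \<rho>
      using pf cA genA \<rho> by (simp add: irreducible_pullback_def irreducible_pullback_axioms_def
          irreducible_representation_def irreducible_representation_axioms_def Irr_def)
    obtain \<gamma> where \<gamma>: "\<gamma> \<in> characters H"
      and ker: "\<And>z x. \<lbrakk>z \<in> torus; \<And>h. f h = 0 \<Longrightarrow> zpow z h = \<gamma> h; x \<in> ideal_z f \<Gamma> A s z\<rbrakk> \<Longrightarrow> \<rho> x = 0"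
      using kernel_contains_ideal_z unfolding H by blast
    have z: "zz \<gamma> \<in> torus" "\<And>h. f h = 0 \<Longrightarrow> zpow (zz \<gamma>) h = \<gamma> h" using zz \<gamma> by (auto simp: H)
    have "\<exists>\<pi>. irreducible_rep B \<pi> \<and> restrict (\<lambda>x. \<pi> (\<theta> (zz \<gamma>) x)) (carrier A) = \<rho>"
    proof (rule irreducible_rep_factor[OF cA \<theta>(1,2)[OF z(1)] irreducible])
      fix x y assume xy: "x \<in> carrier A" "y \<in> carrier A" "\<theta> (zz \<gamma>) x = \<theta> (zz \<gamma>) y"
      then have "\<rho> (x \<ominus>\<^bsub>A\<^esub> y) = 0" using ker[OF z] \<theta>(3)[OF z(1)] by blast
      then show "\<rho> x = \<rho> y" using xy by (simp add: rep_diff)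
    qed
    then obtain \<pi> where "\<pi> \<in> Irr B" "pull (zz \<gamma>) \<pi> = \<rho>" by (auto simp: Irr_def pull\<theta>)
    with \<gamma> show "\<rho> \<in> (\<lambda>(\<gamma>, \<pi>). pull (zz \<gamma>) \<pi>) ` (characters H \<times> Irr B)" by force
  qed
  with irr show ?thesis by blast
qed

end
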